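(* Let $\mathcal L$ be the operator in $L_2(\mathbb R^d)$ given by $(\mathcal L u)(x)=\int_{\mathbb R^d}a(x-y)u(y)\,dy+V(x)u(x)$, where $a$ and $V$ satisfy the standing assumptions in the context. Assume that $V_{\min}\le a_{\min}$ and that $x_0$ is a point of the global minimum of $V$. Fix $r>0$, let $a_n$, $\mathbb J_0$, $V_n$, $\nu_{\mathbb J}$ be as defined in the context (for these $r$ and $x_0$), with $\mathbb J_0\neq\emptyset$, and assume that there exists a nonempty subset $\mathbb I\subset\mathbb J_0$ such that $$r^d\max_{n\in\mathbb I}a_{2n}+(2r)^d\sup_{n\in\mathbb Z^d\setminus(2\mathbb Z)^d}a_n+\nu_{\mathbb I}<0.$$ Then $\mathcal L$ possesses at least $\#\mathbb I$ eigenvalues (counted with multiplicity) below $V_{\min}$, where $\#\mathbb I$ is the number of indices in $\mathbb I$. Moreover, the lowest eigenvalue $\lambda_{\min}$ of $\mathcal L$ satisfies the upper bound $$\lambda_{\min}\le r^d\min_{n\in\mathbb Z^d}a_{2n}+(2r)^d\sup_{n\in\mathbb Z^d\setminus(2\mathbb Z)^d}a_n+r^{-d}\int_{Q_r(x_0)}\big(V(x)-V_{\min}\big)\,dx.$$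
   Context: Let $d\ge 1$. Standing assumptions: $a\in L_1(\mathbb R^d)$ is complex-valued with $a(-x)=\overline{a(x)}$; $V=\mathcal F[\hat V]$ for some $\hat V\in L_1(\mathbb R^d)$ with $\hat V(-x)=\overline{\hat V(x)}$, where $\mathcal F[u](x):=\int_{\mathbb R^d}u(\xi)e^{-\mathrm i x\cdot\xi}\,d\xi$. Put $\hat a:=\mathcal F[a]$. Then $\hat a$ and $V$ are real-valued, bounded, continuous and tend to zero at infinity. Define $a_{\min}:=\inf_{\mathbb R^d}\hat a$ and $V_{\min}:=\inf_{\mathbb R^d}V$. The operator $\mathcal L$ is bounded and self-adjoint in $L_2(\mathbb R^d)$. $Q_r(x_0)$ denotes the cube in $\mathbb R^d$ with side $r$ centered at $x_0$. For fixed $r>0$ define $$a_n:=(2r)^{-d}\int_{Q_{2r}(0)}a(x)e^{-\frac{\pi\mathrm i}{r}n\cdot x}\,dx,\qquad n\in\mathbb Z^d;$$ these numbers are real. Let $\mathbb J_0:=\{n\in\mathbb Z^d:\ a_{2n}<0\}$. For a global minimum point $x_0$ of $V$ define $$V_n:=\int_{Q_r(0)}\big(V(x+x_0)-V_{\min}\big)e^{\frac{2\pi\mathrm i}{r}n\cdot x}\,dx,\qquad n\in\mathbb Z^d,$$ and for a subset $\mathbb J\subset\mathbb J_0$ define $\nu_{\mathbb J}:=r^{-d}\sup_{n\in\mathbb J}\sum_{m\in\mathbb J}|V_{n-m}|$. *)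

theory Defs
  imports "HOL-Analysis.Analysis"
begin

text \<open>The space $\mathbb R^d$ is \<^typ>\<open>real ^ 'n\<close> with $d$ the cardinality of \<open>'n\<close>, and
  $\mathbb Z^d$ is \<^typ>\<open>int ^ 'n\<close>.\<close>

definition fourier :: "(real ^ 'n \<Rightarrow> complex) \<Rightarrow> real ^ 'n \<Rightarrow> complex" where
  "fourier u x = (LINT \<xi>|lborel. u \<xi> * exp (- (\<i> * of_real (x \<bullet> \<xi>))))"

text \<open>The symmetry is required almost everywhere, because elements of $L_1$ are classes
  of functions.\<close>

definition hermitian_L1 :: "(real ^ 'n \<Rightarrow> complex) \<Rightarrow> bool" where
  "hermitian_L1 u \<longleftrightarrow> integrable lborel u \<and> (AE x in lborel. u (- x) = cnj (u x))"

text \<open>Used for the functions $\hat a$ and $V$, which are real-valued since they are Fourier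
  transforms of functions satisfying \<^const>\<open>hermitian_L1\<close>; \<^const>\<open>Re\<close> only changes the type.\<close>

definition inf_val :: "(real ^ 'n \<Rightarrow> complex) \<Rightarrow> real" where
  "inf_val f = (INF x. Re (f x))"

definition cube :: "real \<Rightarrow> real ^ 'n \<Rightarrow> (real ^ 'n) set" where
  "cube r x0 = cbox (x0 - (\<chi> i. r / 2)) (x0 + (\<chi> i. r / 2))"

definition rvec :: "int ^ 'n \<Rightarrow> real ^ 'n" where
  "rvec n = (\<chi> i. of_int (n $ i))"

definition even_lattice :: "(int ^ 'n) set" where
  "even_lattice = {n. \<forall>i. even (n $ i)}"

definition a_coeff_complex :: "(real ^ 'n \<Rightarrow> complex) \<Rightarrow> real \<Rightarrow> int ^ 'n \<Rightarrow> complex" where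
  "a_coeff_complex a r n =
     (LINT x:cube (2 * r) 0|lborel. a x * exp (- (\<i> * of_real (pi / r * (rvec n \<bullet> x)))))
       / of_real ((2 * r) ^ CARD('n))"

text \<open>For \<open>a\<close> satisfying \<^const>\<open>hermitian_L1\<close> these coefficients are real.\<close>

definition a_coeff :: "(real ^ 'n \<Rightarrow> complex) \<Rightarrow> real \<Rightarrow> int ^ 'n \<Rightarrow> real" where
  "a_coeff a r n = Re (a_coeff_complex a r n)"

definition J0 :: "(real ^ 'n \<Rightarrow> complex) \<Rightarrow> real \<Rightarrow> (int ^ 'n) set" where
  "J0 a r = {n. a_coeff a r (2 *s n) < 0}"

definition V_coeff :: "(real ^ 'n \<Rightarrow> complex) \<Rightarrow> real \<Rightarrow> real ^ 'n \<Rightarrow> int ^ 'n \<Rightarrow> complex" where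
  "V_coeff V r x0 n =
     (LINT x:cube r 0|lborel.
        (V (x + x0) - of_real (inf_val V)) * exp (\<i> * of_real (2 * pi / r * (rvec n \<bullet> x))))"

text \<open>Extended-valued, since the sums need not converge when \<open>J\<close> is infinite.\<close>

definition nu :: "(real ^ 'n \<Rightarrow> complex) \<Rightarrow> real \<Rightarrow> real ^ 'n \<Rightarrow> (int ^ 'n) set \<Rightarrow> ennreal" where
  "nu V r x0 J =
     ennreal (1 / r ^ CARD('n)) *
       (SUP n\<in>J. \<Sum>\<^sub>\<infinity>m\<in>J. ennreal (cmod (V_coeff V r x0 (n - m))))"

text \<open>Elements of $L_2(\mathbb R^d)$ are represented by functions; identities between them
  are understood almost everywhere.\<close>

definition L2 :: "(real ^ 'n \<Rightarrow> complex) set" where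
  "L2 = {u. u \<in> borel_measurable lborel \<and> integrable lborel (\<lambda>x. (cmod (u x))\<^sup>2)}"

definition conv_op ::
  "(real ^ 'n \<Rightarrow> complex) \<Rightarrow> (real ^ 'n \<Rightarrow> complex) \<Rightarrow> (real ^ 'n \<Rightarrow> complex) \<Rightarrow> real ^ 'n \<Rightarrow> complex"
where
  "conv_op a V u x = (LINT y|lborel. a (x - y) * u y) + V x * u x"

definition eigenspace ::
  "((real ^ 'n \<Rightarrow> complex) \<Rightarrow> real ^ 'n \<Rightarrow> complex) \<Rightarrow> real \<Rightarrow> (real ^ 'n \<Rightarrow> complex) set"
where
  "eigenspace T t = {u \<in> L2. AE x in lborel. T u x = of_real t * u x}"

text \<open>Only real eigenvalues are considered; a self-adjoint operator has no others.\<close>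

definition eigenvalues :: "((real ^ 'n \<Rightarrow> complex) \<Rightarrow> real ^ 'n \<Rightarrow> complex) \<Rightarrow> real set" where
  "eigenvalues T = {t. \<exists>u\<in>eigenspace T t. \<not> (AE x in lborel. u x = 0)}"

text \<open>The multiplicity is the complex dimension of the eigenspace modulo null functions: the
  supremum of the lengths of linearly independent families in it.\<close>

definition multiplicity_of ::
  "((real ^ 'n \<Rightarrow> complex) \<Rightarrow> real ^ 'n \<Rightarrow> complex) \<Rightarrow> real \<Rightarrow> enat"
where
  "multiplicity_of T t =
     Sup {enat k | k. \<exists>u. (\<forall>i<k. u i \<in> eigenspace T t) \<and>
            (\<forall>c :: nat \<Rightarrow> complex. (AE x in lborel. (\<Sum>i<k. c i * u i x) = 0) \<longrightarrow> (\<forall>i<k. c i = 0))}"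

definition num_eigenvalues_below ::
  "((real ^ 'n \<Rightarrow> complex) \<Rightarrow> real ^ 'n \<Rightarrow> complex) \<Rightarrow> real \<Rightarrow> enat"
where
  "num_eigenvalues_below T b =
     (SUP S\<in>{S. finite S \<and> S \<subseteq> {t \<in> eigenvalues T. t < b}}. \<Sum>t\<in>S. multiplicity_of T t)"

definition is_lowest_eigenvalue ::
  "((real ^ 'n \<Rightarrow> complex) \<Rightarrow> real ^ 'n \<Rightarrow> complex) \<Rightarrow> real \<Rightarrow> bool"
where
  "is_lowest_eigenvalue T t \<longleftrightarrow> t \<in> eigenvalues T \<and> (\<forall>s\<in>eigenvalues T. t \<le> s)"

text \<open>Unlike \<^const>\<open>card\<close>, this does not collapse infinite sets to 0.\<close>

definition ecard :: "'a set \<Rightarrow> enat" where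
  "ecard A = (if finite A then enat (card A) else \<infinity>)"

end

theory Submission
  imports Defs "HOL-Complex_Analysis.Great_Picard"
begin

text \<open>With \<open>m = - V\<^sub>m\<^sub>i\<^sub>n \<ge> 0\<close> put \<open>A = L + m\<close> and let \<open>Q\<close> be multiplication by \<open>\<surd>(m + V)\<close>. Since
  \<open>Q = \<surd>m + g\<close> with \<open>g\<close> vanishing at infinity, \<open>A = (1/m) Q (a * _ + m) Q - K\<close> holds exactly for \<open>m > 0\<close>, where \<open>K\<close> is
  built from the compact operators \<open>g (a * _)\<close> and \<open>a * (g _)\<close>; the first term is nonnegative because
  \<open>a * _ \<ge> a\<^sub>m\<^sub>i\<^sub>n \<ge> - m\<close>. For such an \<open>A\<close>, a minimising sequence of the Rayleigh quotient with negative infimum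
  \<open>l\<close> converges strongly: \<open>(A - l) v\<^sub>k \<longrightarrow> 0\<close>, a subsequence of \<open>K v\<^sub>k\<close> converges, and \<open>A + K - l\<close> is
  coercive. Iterating on orthogonal complements gives \<open>N\<close> negative eigenvalues of \<open>A\<close> as soon as its form is
  negative on an \<open>N\<close>-dimensional space.

  The test space is spanned by the exponentials \<open>e\<^sub>n(x) = exp(2\<pi>i n \<sqdot> x / r)\<close>, \<open>n \<in> I\<close>, cut off to \<open>Q\<^sub>r(x\<^sub>0)\<close>.
  For \<open>u\<close> supported in \<open>Q\<^sub>r(x\<^sub>0)\<close> only \<open>a\<close> on \<open>Q\<^sub>2\<^sub>r(0)\<close> matters, so approximating it by trigonometric polynomials
  of period \<open>2r\<close> turns the form of \<open>a * _\<close> into \<open>\<Sum> a\<^sub>n |u\<^sub>n|\<^sup>2\<close>. The coefficients \<open>u\<^sub>2\<^sub>n\<close> of a test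
  function are explicit, the others are controlled by Bessel's inequality, and the potential by a Schur bound. The same
  expansion on growing cubes gives \<open>a * _ \<ge> - m\<close>.\<close>

section \<open>Compact perturbations of nonnegative operators\<close>

text \<open>Neither \<open>a * _\<close> nor multiplication by \<open>V\<close> is compact in
  general, so a minimising sequence could lose mass at infinity or oscillate away, and no spectral
  theorem is invoked to exclude this. What saves the argument is the level: \<open>A + K\<close> is
  nonnegative and the infimum is strictly below 0, so only the compact term could cause a defect.
  The condition V_min \<le> a_min enters through the sign of \<open>a * _ + m\<close>. The space is
  treated as a real one, with the real part of the Hermitian product; complex orthogonality to
  \<open>u\<close> becomes orthogonality to \<open>u\<close> and to \<open>J u\<close>, where
  \<open>J\<close> is multiplication by the imaginary unit. The doubled period comes from
  differences: for x and y in a cube of side r, x - y ranges over a cube of side 2r. Waves of period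
  r are the even frequencies of period 2r. There the coefficients of a test function are known, and
  comparing r^(2d) |\<alpha>_k|^2 with the squared norm r^d sum |\<alpha>_k|^2 yields the factor r^d
  of the hypothesis. At the remaining frequencies only Bessel's inequality on the cube of side 2r is
  available, whence (2r)^d.\<close>

definition compact_operator :: "('a::real_normed_vector \<Rightarrow> 'b::real_normed_vector) \<Rightarrow> bool" where
  "compact_operator T \<longleftrightarrow> bounded_linear T \<and> compact (closure (T ` cball 0 1))"

section \<open>Closure properties of compact operators\<close>

lemma compact_closure_subset:
  fixes S :: "'a::metric_space set"
  assumes "S \<subseteq> T" "compact T"
  shows "compact (closure S)"
proof -
  have "closure S \<subseteq> T" using assms by (simp add: closure_minimal compact_imp_closed)
  hence "T \<inter> closure S = closure S" by blast
  thus ?thesis using compact_Int_closed[OF assms(2), of "closure S"] by simp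
qed

lemma compact_operatorI:
  assumes "bounded_linear T" "compact C" "\<And>u. norm u \<le> 1 \<Longrightarrow> T u \<in> C"
  shows "compact_operator T"
  unfolding compact_operator_def
  using assms by (auto intro!: compact_closure_subset[of _ C])

lemma compact_operatorD:
  assumes "compact_operator T"
  obtains C where "bounded_linear T" "compact C" "\<And>u. norm u \<le> 1 \<Longrightarrow> T u \<in> C"
proof (rule that)
  show "bounded_linear T" "compact (closure (T ` cball 0 1))"
    using assms by (auto simp: compact_operator_def)
  show "T u \<in> closure (T ` cball 0 1)" if "norm u \<le> 1" for u
    using that closure_subset by (force simp: dist_norm)
qed

lemma compact_operator_add:
  assumes "compact_operator S" "compact_operator T"
  shows "compact_operator (\<lambda>u. S u + T u)"
proof -
  obtain C where C: "bounded_linear S" "compact C" "\<And>u. norm u \<le> 1 \<Longrightarrow> S u \<in> C"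
    using assms(1) by (rule compact_operatorD) blast
  obtain D where D: "bounded_linear T" "compact D" "\<And>u. norm u \<le> 1 \<Longrightarrow> T u \<in> D"
    using assms(2) by (rule compact_operatorD) blast
  show ?thesis
    by (rule compact_operatorI[where C = "{x + y |x y. x \<in> C \<and> y \<in> D}"])
       (use C D in \<open>auto intro: bounded_linear_add compact_sums\<close>)
qed

lemma compact_operator_compose_left:
  assumes "bounded_linear S" "compact_operator T"
  shows "compact_operator (\<lambda>u. S (T u))"
proof -
  obtain C where C: "bounded_linear T" "compact C" "\<And>u. norm u \<le> 1 \<Longrightarrow> T u \<in> C"
    using assms(2) by (rule compact_operatorD) blast
  show ?thesis
  proof (rule compact_operatorI)
    show "bounded_linear (\<lambda>u. S (T u))"
      by (rule bounded_linear_compose[OF assms(1) C(1)])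
    show "compact (S ` C)"
      by (rule compact_continuous_image[OF linear_continuous_on[OF assms(1)] C(2)])
  qed (use C(3) in auto)
qed

lemma compact_operator_scaleR:
  "compact_operator T \<Longrightarrow> compact_operator (\<lambda>u. c *\<^sub>R T u)"
  by (rule compact_operator_compose_left[OF bounded_linear_scaleR_right])

lemma compact_operator_compose_right:
  assumes "compact_operator T" "bounded_linear S"
  shows "compact_operator (\<lambda>u. T (S u))"
proof -
  obtain C where C: "bounded_linear T" "compact C" "\<And>u. norm u \<le> 1 \<Longrightarrow> T u \<in> C"
    using assms(1) by (rule compact_operatorD) blast
  obtain k where k: "k > 0" "\<And>u. norm (S u) \<le> norm u * k"
    using bounded_linear.pos_bounded[OF assms(2)] by blast
  show ?thesis
  proof (rule compact_operatorI)
    show "bounded_linear (\<lambda>u. T (S u))"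
      by (rule bounded_linear_compose[OF C(1) assms(2)])
    show "compact ((*\<^sub>R) k ` C)"
      by (rule compact_scaling[OF C(2)])
    fix u :: 'c assume u: "norm u \<le> 1"
    have "norm (S u) \<le> 1 * k"
      using k(2)[of u] u k(1) by (meson mult_right_mono less_imp_le order_trans)
    hence "norm ((1/k) *\<^sub>R S u) \<le> 1"
      using k(1) by (simp add: field_simps)
    hence "T ((1/k) *\<^sub>R S u) \<in> C" by (rule C(3))
    hence "k *\<^sub>R T ((1/k) *\<^sub>R S u) \<in> (*\<^sub>R) k ` C" by blast
    thus "T (S u) \<in> (*\<^sub>R) k ` C"
      using k(1) by (simp add: linear_scale[OF bounded_linear.linear[OF C(1)]])
  qed
qed

text \<open>A finite net of mesh \<open>e/4\<close> for the image of the unit ball under an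
  approximant \<open>S\<close> is a net of mesh \<open>e\<close> for the image under
  \<open>T\<close>. Completeness of the codomain turns total boundedness into compactness.\<close>

lemma compact_operator_limit:
  fixes T :: "'a::real_normed_vector \<Rightarrow> 'b::banach"
  assumes "bounded_linear T"
    and approx: "\<And>e. e > 0 \<Longrightarrow> \<exists>S. compact_operator S \<and> (\<forall>u. norm u \<le> 1 \<longrightarrow> norm (T u - S u) \<le> e)"
  shows "compact_operator T"
proof -
  have "\<exists>k. finite k \<and> closure (T ` cball 0 1) \<subseteq> (\<Union>x\<in>k. ball x e)" if e: "e > 0" for e
  proof -
    obtain S where S: "compact_operator S" "\<And>u. norm u \<le> 1 \<Longrightarrow> norm (T u - S u) \<le> e/4"
      using approx[of "e/4"] e by auto
    obtain C where C: "compact C" "\<And>u. norm u \<le> 1 \<Longrightarrow> S u \<in> C"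
      using S(1) by (rule compact_operatorD) blast
    obtain k where k: "finite k" "C \<subseteq> (\<Union>x\<in>k. ball x (e/4))"
      using C(1) e unfolding compact_eq_totally_bounded by (metis zero_less_divide_iff zero_less_numeral)
    have "y \<in> (\<Union>x\<in>k. ball x e)" if y: "y \<in> closure (T ` cball 0 1)" for y
    proof -
      obtain u where u: "norm u \<le> 1" "dist (T u) y < e/4"
        using y e unfolding closure_approachable by (metis imageE mem_cball_0 zero_less_divide_iff zero_less_numeral)
      obtain x where x: "x \<in> k" "dist x (S u) < e/4"
        using k(2) C(2)[OF u(1)] by auto
      have "dist x y \<le> dist x (S u) + dist (S u) (T u) + dist (T u) y"
        by (meson add_right_mono dist_triangle order_trans)
      moreover have "dist (S u) (T u) \<le> e/4"
        using S(2)[OF u(1)] by (simp add: dist_norm norm_minus_commute)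
      ultimately have "dist x y < e" using x(2) u(2) e by linarith
      thus ?thesis using x(1) by auto
    qed
    thus ?thesis using k(1) by blast
  qed
  moreover have "complete (closure (T ` cball 0 1))"
    by (simp add: complete_eq_closed)
  ultimately show ?thesis
    using assms(1) unfolding compact_operator_def compact_eq_totally_bounded by blast
qed

section \<open>Minimising the Rayleigh quotient of a symmetric operator\<close>

lemma nonneg_form_norm_bound:
  fixes D :: "'a::real_inner \<Rightarrow> 'a"
  assumes lin: "linear D" and sym: "\<And>u v. D u \<bullet> v = u \<bullet> D v" and c: "c > 0" "\<And>u. norm (D u) \<le> c * norm u"
    and M: "subspace M" "\<And>u. u \<in> M \<Longrightarrow> D u \<in> M" "\<And>u. u \<in> M \<Longrightarrow> 0 \<le> D u \<bullet> u" and x: "x \<in> M"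
  shows "(norm (D x))\<^sup>2 \<le> c * (D x \<bullet> x)"
proof -
  \<comment> \<open>Cauchy-Schwarz for the form of \<open>D\<close> in disguise: moving by
    \<open>1/c\<close> down the gradient gains \<open>(2/c) * (D x \<bullet> D x)\<close> and costs
    at most half of that, because \<open>norm (D (D x)) \<le> c * norm (D x)\<close>.\<close>
  define y where "y = x - (1/c) *\<^sub>R D x"
  have "y \<in> M" unfolding y_def using M x by (simp add: subspace_diff subspace_scale)
  hence "0 \<le> D y \<bullet> y" by (rule M(3))
  also have "D y \<bullet> y = D x \<bullet> x - (2/c) * (D x \<bullet> D x) + (1/c)\<^sup>2 * (D (D x) \<bullet> D x)"
    unfolding y_def
    by (simp add: linear_diff[OF lin] linear_scale[OF lin] inner_diff_left inner_diff_right sym[of "D x" x]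
        algebra_simps power2_eq_square)
  finally have 1: "(2/c) * (D x \<bullet> D x) \<le> D x \<bullet> x + (1/c)\<^sup>2 * (D (D x) \<bullet> D x)" by simp
  have "D (D x) \<bullet> D x \<le> norm (D (D x)) * norm (D x)" by (rule norm_cauchy_schwarz)
  also have "\<dots> \<le> c * norm (D x) * norm (D x)" by (intro mult_right_mono c) simp
  finally have "D (D x) \<bullet> D x \<le> c * (D x \<bullet> D x)"
    by (simp add: power2_norm_eq_inner[symmetric] power2_eq_square algebra_simps)
  hence "(1/c)\<^sup>2 * (D (D x) \<bullet> D x) \<le> (1/c)\<^sup>2 * (c * (D x \<bullet> D x))" by (intro mult_left_mono) auto
  also have "\<dots> = (1/c) * (D x \<bullet> D x)" using c by (simp add: power2_eq_square)
  finally have "(1/c) * (D x \<bullet> D x) \<le> D x \<bullet> x" using 1 by (simp add: algebra_simps)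
  thus ?thesis using c by (simp add: power2_norm_eq_inner field_simps)
qed

text \<open>Strictness of \<open>l < 0\<close> replaces compactness of \<open>A\<close>: it makes
  \<open>A + K - l\<close> bounded below by \<open>\<bar>l\<bar>\<close>, so convergence of
  \<open>K (v k)\<close> along a subsequence forces convergence of \<open>v k\<close>. Invariance of
  \<open>M\<close> keeps the auxiliary vector of \<open>nonneg_form_norm_bound\<close> inside
  \<open>M\<close>. The last conclusion, minimality on \<open>M\<close>, later identifies the lowest
  eigenvalue.\<close>

lemma lowest_eigenvector:
  fixes A K :: "'a::{real_inner,banach} \<Rightarrow> 'a"
  assumes A: "bounded_linear A" and K: "compact_operator K"
    and sym: "\<And>u v. A u \<bullet> v = u \<bullet> A v"
    and pos: "\<And>u. 0 \<le> (A u + K u) \<bullet> u"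
    and M: "subspace M" "closed M" "\<And>u. u \<in> M \<Longrightarrow> A u \<in> M"
    and w: "w \<in> M" "A w \<bullet> w < 0"
  obtains u l where "u \<in> M" "norm u = 1" "l < 0" "A u = l *\<^sub>R u"
    "\<And>v. v \<in> M \<Longrightarrow> l * (v \<bullet> v) \<le> A v \<bullet> v"
proof -
  obtain b where b: "b > 0" "\<And>u. norm (A u) \<le> norm u * b"
    using bounded_linear.pos_bounded[OF A] by blast
  note linA = bounded_linear.linear[OF A]
  define R where "R = (\<lambda>v. A v \<bullet> v) ` {v \<in> M. norm v = 1}"
  define l where "l = Inf R"
  have bdd: "bdd_below R"
  proof (rule bdd_belowI)
    fix x assume "x \<in> R"
    then obtain v where v: "x = A v \<bullet> v" "norm v = 1" unfolding R_def by auto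
    have "\<bar>x\<bar> \<le> norm (A v) * norm v" unfolding v(1) by (rule Cauchy_Schwarz_ineq2)
    thus "-b \<le> x" using b(2)[of v] v by simp
  qed
  have normalize: "A v \<bullet> v = (A ((1/norm v) *\<^sub>R v) \<bullet> ((1/norm v) *\<^sub>R v)) * (v \<bullet> v)" if "v \<noteq> 0" for v
    using that by (simp add: linear_scale[OF linA] power2_norm_eq_inner[symmetric] power2_eq_square)
  have inR: "A ((1/norm v) *\<^sub>R v) \<bullet> ((1/norm v) *\<^sub>R v) \<in> R" if "v \<noteq> 0" "v \<in> M" for v
    unfolding R_def using that M(1) by (intro imageI) (simp add: subspace_scale)
  have lb: "l * (v \<bullet> v) \<le> A v \<bullet> v" if v: "v \<in> M" for v
  proof (cases "v = 0")
    case False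
    show ?thesis
      unfolding normalize[OF False] l_def
      by (intro mult_right_mono cInf_lower inR bdd False v) simp
  qed (use linA in \<open>simp add: linear_0\<close>)
  have "w \<noteq> 0" using w(2) by auto
  have lneg: "l < 0"
  proof -
    have "l \<le> A ((1/norm w) *\<^sub>R w) \<bullet> ((1/norm w) *\<^sub>R w)"
      unfolding l_def by (intro cInf_lower inR bdd \<open>w \<noteq> 0\<close> w)
    also have "\<dots> < 0"
    proof (rule ccontr)
      assume "\<not> A ((1/norm w) *\<^sub>R w) \<bullet> ((1/norm w) *\<^sub>R w) < 0"
      hence "0 \<le> A w \<bullet> w"
        unfolding normalize[OF \<open>w \<noteq> 0\<close>] by (intro mult_nonneg_nonneg) (auto simp del: inner_scaleR_right)
      thus False using w(2) by simp
    qed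
    finally show ?thesis .
  qed
  have "\<exists>v. v \<in> M \<and> norm v = 1 \<and> A v \<bullet> v < l + 1 / real (Suc k)" for k
  proof -
    have "R \<noteq> {}" using inR[OF \<open>w \<noteq> 0\<close> w(1)] by blast
    hence "\<exists>x\<in>R. x < l + 1 / real (Suc k)"
      unfolding l_def by (subst cInf_less_iff[OF _ bdd, symmetric]) auto
    thus ?thesis unfolding R_def by auto
  qed
  then obtain v where v: "\<And>k. v k \<in> M" "\<And>k. norm (v k) = 1" "\<And>k. A (v k) \<bullet> v k < l + 1 / real (Suc k)"
    by metis
  define D where "D u = A u - l *\<^sub>R u" for u
  have D: "bounded_linear D"
    unfolding D_def[abs_def] by (intro bounded_linear_sub A bounded_linear_scaleR_right)
  define c where "c = b + \<bar>l\<bar>"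
  have c: "c > 0" "\<And>u. norm (D u) \<le> c * norm u"
  proof -
    fix u
    have "norm (D u) \<le> norm (A u) + norm (l *\<^sub>R u)" unfolding D_def by (rule norm_triangle_ineq4)
    thus "norm (D u) \<le> c * norm u" using b(2)[of u] by (simp add: c_def algebra_simps)
  qed (use b in \<open>simp add: c_def\<close>)
  \<comment> \<open>A near-minimiser is a near-eigenvector: the form of \<open>D\<close> is
    nonnegative on \<open>M\<close>, and at \<open>v k\<close> it is the gap between the Rayleigh
    quotient and its infimum.\<close>
  have Dv: "(norm (D (v k)))\<^sup>2 \<le> c * (1 / real (Suc k))" for k
  proof -
    have "(norm (D (v k)))\<^sup>2 \<le> c * (D (v k) \<bullet> v k)"
      by (rule nonneg_form_norm_bound[OF bounded_linear.linear[OF D] _ c M(1) _ _ v(1)])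
         (use M lb sym in \<open>auto simp: D_def inner_diff_left inner_diff_right subspace_diff subspace_scale\<close>)
    also have "D (v k) \<bullet> v k = A (v k) \<bullet> v k - l"
      using v(2)[of k] by (simp add: D_def inner_diff_left power2_norm_eq_inner[symmetric])
    also have "c * (A (v k) \<bullet> v k - l) \<le> c * (1 / real (Suc k))"
      using v(3)[of k] c(1) by (intro mult_left_mono) auto
    finally show ?thesis .
  qed
  have D0: "(\<lambda>k. D (v k)) \<longlonglongrightarrow> 0"
  proof -
    have "(\<lambda>k. c * (1 / real (Suc k))) \<longlonglongrightarrow> c * 0"
      by (intro tendsto_intros LIMSEQ_Suc[OF lim_1_over_n])
    hence "(\<lambda>k. c * (1 / real (Suc k))) \<longlonglongrightarrow> 0" by simp
    hence "(\<lambda>k. (norm (D (v k)))\<^sup>2) \<longlonglongrightarrow> 0"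
      by (rule Lim_null_comparison[rotated]) (use Dv in \<open>simp add: always_eventually\<close>)
    hence "(\<lambda>k. norm (D (v k))) \<longlonglongrightarrow> 0" by simp
    thus ?thesis by (simp add: tendsto_norm_zero_iff)
  qed
  obtain C where C: "bounded_linear K" "compact C" "\<And>u. norm u \<le> 1 \<Longrightarrow> K u \<in> C"
    using K by (rule compact_operatorD) blast
  have "\<forall>k. K (v k) \<in> C" using C(3) v(2) by simp
  then obtain h s where s: "strict_mono s" "((\<lambda>k. K (v k)) \<circ> s) \<longlonglongrightarrow> h"
    using C(2) unfolding compact_eq_seq_compact_metric seq_compact_def by metis
  define E where "E u = D u + K u" for u
  have E: "bounded_linear E" unfolding E_def[abs_def] by (intro bounded_linear_add D C)
  have "(\<lambda>k. D (v (s k)) + K (v (s k))) \<longlonglongrightarrow> 0 + h"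
    using LIMSEQ_subseq_LIMSEQ[OF D0 s(1)] s(2) by (intro tendsto_add) (simp_all add: o_def)
  hence "(\<lambda>k. E (v (s k))) \<longlonglongrightarrow> h" by (simp add: E_def)
  hence CauE: "Cauchy (\<lambda>k. E (v (s k)))" by (rule LIMSEQ_imp_Cauchy)
  \<comment> \<open>Nonnegativity of \<open>A + K\<close> leaves the term
    \<open>- l * (x \<bullet> x)\<close>, whose coefficient is positive. Being bounded below,
    \<open>E\<close> pulls Cauchy sequences back.\<close>
  have coer: "\<bar>l\<bar> * norm x \<le> norm (E x)" for x
  proof -
    have "\<bar>l\<bar> * (norm x * norm x) \<le> (A x + K x) \<bullet> x - l * (x \<bullet> x)"
      using pos[of x] lneg by (simp add: power2_norm_eq_inner[symmetric] power2_eq_square)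
    also have "\<dots> = E x \<bullet> x"
      by (simp add: E_def D_def inner_diff_left inner_add_left)
    also have "\<dots> \<le> norm (E x) * norm x" by (rule norm_cauchy_schwarz)
    finally have "(\<bar>l\<bar> * norm x) * norm x \<le> norm (E x) * norm x" by (simp add: mult.assoc)
    thus ?thesis by (cases "x = 0") auto
  qed
  have "Cauchy (\<lambda>k. v (s k))"
  proof (rule metric_CauchyI)
    fix e :: real assume e: "e > 0"
    hence "e * \<bar>l\<bar> > 0" using lneg by (intro mult_pos_pos) auto
    then obtain N where N: "\<And>m n. m \<ge> N \<Longrightarrow> n \<ge> N \<Longrightarrow> dist (E (v (s m))) (E (v (s n))) < e * \<bar>l\<bar>"
      using metric_CauchyD[OF CauE] by metis
    show "\<exists>N. \<forall>m\<ge>N. \<forall>n\<ge>N. dist (v (s m)) (v (s n)) < e"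
    proof (intro exI allI impI)
      fix m n assume mn: "N \<le> m" "N \<le> n"
      have "\<bar>l\<bar> * norm (v (s m) - v (s n)) \<le> norm (E (v (s m) - v (s n)))" by (rule coer)
      also have "\<dots> < e * \<bar>l\<bar>"
        using N[OF mn] by (simp add: dist_norm linear_diff[OF bounded_linear.linear[OF E]])
      finally show "dist (v (s m)) (v (s n)) < e"
        using lneg by (simp add: dist_norm mult.commute)
    qed
  qed
  then obtain u where u: "(\<lambda>k. v (s k)) \<longlonglongrightarrow> u"
    using Cauchy_convergent_iff convergent_def by blast
  show ?thesis
  proof (rule that)
    show "u \<in> M" using closed_sequentially[OF M(2) _ u] v(1) by simp
    have "(\<lambda>k. norm (v (s k))) \<longlonglongrightarrow> norm u" by (rule tendsto_norm[OF u])
    thus "norm u = 1" using v(2) by (simp add: LIMSEQ_const_iff)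
    have "(\<lambda>k. D (v (s k))) \<longlonglongrightarrow> D u" by (rule bounded_linear.tendsto[OF D u])
    moreover have "(\<lambda>k. D (v (s k))) \<longlonglongrightarrow> 0" using LIMSEQ_subseq_LIMSEQ[OF D0 s(1)] by (simp add: o_def)
    ultimately have "D u = 0" using LIMSEQ_unique by blast
    thus "A u = l *\<^sub>R u" by (simp add: D_def)
  qed (use lneg lb in auto)
qed

text \<open>The vectors found so far and their images under \<open>J\<close> are eigenvectors, so by
  symmetry their orthogonal complement is invariant and the minimisation can be repeated there. The
  hypothesis on \<open>w\<close> quantifies over all small \<open>U\<close> because the eigenvectors
  to be avoided are not known in advance.\<close>

lemma negative_eigenvectors:
  fixes A K J :: "'a::{real_inner,banach} \<Rightarrow> 'a"
  assumes A: "bounded_linear A" and K: "compact_operator K"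
    and sym: "\<And>u v. A u \<bullet> v = u \<bullet> A v"
    and pos: "\<And>u. 0 \<le> (A u + K u) \<bullet> u"
    and J: "\<And>u. A (J u) = J (A u)" "\<And>c u. J (c *\<^sub>R u) = c *\<^sub>R J u"
    and w: "\<And>U. finite U \<Longrightarrow> card U < N \<Longrightarrow> \<exists>w. A w \<bullet> w < 0 \<and> (\<forall>u\<in>U. w \<bullet> u = 0 \<and> w \<bullet> J u = 0)"
  shows "\<exists>u l. \<forall>i<N. norm (u i :: 'a) = 1 \<and> l i < (0::real) \<and> A (u i) = l i *\<^sub>R u i \<and>
           (\<forall>j<i. u i \<bullet> u j = 0 \<and> u i \<bullet> J (u j) = 0)"
  using w
proof (induction N)
  case (Suc N)
  obtain u l where ul: "\<forall>i<N. norm (u i) = 1 \<and> l i < 0 \<and> A (u i) = l i *\<^sub>R u i \<and>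
      (\<forall>j<i. u i \<bullet> u j = 0 \<and> u i \<bullet> J (u j) = 0)"
    using Suc.IH[OF Suc.prems] by auto
  define M where "M = {v. \<forall>i<N. v \<bullet> u i = 0 \<and> v \<bullet> J (u i) = 0}"
  have M: "subspace M" by (auto simp: subspace_def M_def inner_add_left)
  have "M = (\<Inter>i\<in>{..<N}. {v. u i \<bullet> v = 0} \<inter> {v. J (u i) \<bullet> v = 0})"
    by (auto simp: M_def inner_commute)
  hence "closed M" by (auto intro!: closed_INT closed_Int closed_hyperplane)
  have inv: "A v \<in> M" if "v \<in> M" for v
    using that ul by (auto simp: M_def sym J)
  have "card (u ` {..<N}) < Suc N" by (metis card_image_le card_lessThan finite_lessThan le_imp_less_Suc)
  then obtain w where w: "A w \<bullet> w < 0" "w \<in> M"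
    using Suc.prems[of "u ` {..<N}"] by (auto simp: M_def)
  obtain x t where x: "x \<in> M" "norm x = 1" "t < 0" "A x = t *\<^sub>R x"
    using lowest_eigenvector[OF A K sym pos M \<open>closed M\<close> inv w(2,1)] by metis
  show ?case
    by (rule exI[of _ "u(N := x)"], rule exI[of _ "l(N := t)"])
       (use ul x in \<open>auto simp: less_Suc_eq M_def\<close>)
qed auto

section \<open>The Hilbert space of square-integrable functions\<close>

lemma borel_measurable_cnj [measurable]:
  "f \<in> borel_measurable M \<Longrightarrow> (\<lambda>x. cnj (f x)) \<in> borel_measurable M"
  by (rule measurable_compose[OF _ borel_measurable_continuous_onI[OF continuous_on_cnj[OF continuous_on_id]]])

lemma L2_I:
  "u \<in> borel_measurable borel \<Longrightarrow> integrable lborel (\<lambda>x. (cmod (u x))\<^sup>2) \<Longrightarrow> u \<in> L2"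
  by (simp add: L2_def)

lemma L2_measurable [measurable_dest]: "u \<in> L2 \<Longrightarrow> u \<in> borel_measurable borel"
  by (simp add: L2_def)

lemma L2_integrable: "u \<in> L2 \<Longrightarrow> integrable lborel (\<lambda>x. (cmod (u x))\<^sup>2)"
  by (simp add: L2_def)

lemma L2_bound:
  assumes "f \<in> borel_measurable borel" "integrable lborel g" "\<And>x. (cmod (f x))\<^sup>2 \<le> g x"
  shows "f \<in> L2"
  using assms(1,3)
  by (intro L2_I Bochner_Integration.integrable_bound[OF assms(2)])
     (auto intro: order_trans[OF _ abs_ge_self])

lemma norm_mult_le_squares: "cmod (a * b) \<le> (cmod a)\<^sup>2 + (cmod b)\<^sup>2"
proof -
  have "2 * (cmod a * cmod b) \<le> (cmod a)\<^sup>2 + (cmod b)\<^sup>2"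
    using sum_squares_bound[of "cmod a" "cmod b"] by (simp add: mult.assoc)
  moreover have "0 \<le> cmod a * cmod b" by simp
  ultimately show ?thesis unfolding norm_mult by linarith
qed

lemma norm_add_square_le: "(cmod (a + b))\<^sup>2 \<le> 2 * (cmod a)\<^sup>2 + 2 * (cmod b)\<^sup>2"
proof -
  have "(cmod (a + b))\<^sup>2 \<le> (cmod a + cmod b)\<^sup>2" by (intro power_mono norm_triangle_ineq) simp
  also have "\<dots> \<le> 2 * (cmod a)\<^sup>2 + 2 * (cmod b)\<^sup>2"
    using sum_squares_bound[of "cmod a" "cmod b"] by (simp add: power2_sum)
  finally show ?thesis .
qed

lemma L2_mult_integrable:
  assumes "u \<in> L2" "v \<in> L2"
  shows "integrable lborel (\<lambda>x. u x * v x)"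
proof -
  note [measurable] = L2_measurable[OF assms(1)] L2_measurable[OF assms(2)]
  show ?thesis
  proof (rule Bochner_Integration.integrable_bound)
    show "integrable lborel (\<lambda>x. (cmod (u x))\<^sup>2 + (cmod (v x))\<^sup>2)"
      using assms by (intro Bochner_Integration.integrable_add L2_integrable)
    show "AE x in lborel. norm (u x * v x) \<le> norm ((cmod (u x))\<^sup>2 + (cmod (v x))\<^sup>2)"
      using norm_mult_le_squares by (auto intro!: order_trans[OF _ abs_ge_self])
  qed measurable
qed

lemma L2_zero: "(\<lambda>x. 0) \<in> L2"
  by (simp add: L2_def)

lemma L2_add:
  assumes "u \<in> L2" "v \<in> L2"
  shows "(\<lambda>x. u x + v x) \<in> L2"
proof -
  note [measurable] = L2_measurable[OF assms(1)] L2_measurable[OF assms(2)]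
  show ?thesis
    by (rule L2_bound[where g = "\<lambda>x. 2 * (cmod (u x))\<^sup>2 + 2 * (cmod (v x))\<^sup>2"])
       (use assms norm_add_square_le in
         \<open>auto intro!: Bochner_Integration.integrable_add Bochner_Integration.integrable_mult_right L2_integrable\<close>)
qed

lemma L2_bounded_mult:
  assumes "u \<in> L2" "g \<in> borel_measurable borel" "\<And>x. cmod (g x) \<le> C"
  shows "(\<lambda>x. g x * u x) \<in> L2"
proof -
  note [measurable] = L2_measurable[OF assms(1)] assms(2)
  show ?thesis
  proof (rule L2_bound[where g = "\<lambda>x. C\<^sup>2 * (cmod (u x))\<^sup>2"])
    fix x show "(cmod (g x * u x))\<^sup>2 \<le> C\<^sup>2 * (cmod (u x))\<^sup>2"
      unfolding norm_mult power_mult_distrib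
      by (intro mult_right_mono power_mono assms(3)) auto
  qed (use assms(1) in \<open>auto intro: L2_integrable\<close>)
qed

lemma L2_mult: "u \<in> L2 \<Longrightarrow> (\<lambda>x. c * u x) \<in> L2"
  by (rule L2_bounded_mult[where C = "cmod c"]) auto

lemma L2_cnj: "u \<in> L2 \<Longrightarrow> (\<lambda>x. cnj (u x)) \<in> L2"
  by (auto simp: L2_def)

lemma L2_diff: "u \<in> L2 \<Longrightarrow> v \<in> L2 \<Longrightarrow> (\<lambda>x. u x - v x) \<in> L2"
  using L2_add[of u "\<lambda>x. (-1) * v x"] L2_mult[of v "-1"] by simp

lemma L2_sum: "(\<And>i. i \<in> S \<Longrightarrow> u i \<in> L2) \<Longrightarrow> (\<lambda>x. \<Sum>i\<in>S. u i x) \<in> L2"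
  by (induction S rule: infinite_finite_induct) (auto simp: L2_zero L2_add)

section \<open>The quotient by null functions and its real inner product\<close>

definition l2_rel :: "(real ^ 'n \<Rightarrow> complex) \<Rightarrow> (real ^ 'n \<Rightarrow> complex) \<Rightarrow> bool" where
  "l2_rel u v \<longleftrightarrow> u \<in> L2 \<and> v \<in> L2 \<and> (AE x in lborel. u x = v x)"

\<comment> \<open>With a partial relation, reflexive only on \<open>L2\<close>, one step both
  restricts to square-integrable functions and identifies those that agree almost
  everywhere.\<close>
quotient_type 'n l2 = "real ^ 'n \<Rightarrow> complex" / partial: l2_rel
proof (rule part_equivpI)
  show "\<exists>u :: real ^ 'n \<Rightarrow> complex. l2_rel u u"
    using L2_zero by (auto simp: l2_rel_def)
  show "symp (l2_rel :: (real ^ 'n \<Rightarrow> complex) \<Rightarrow> _)"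
    by (auto intro!: sympI simp: l2_rel_def)
  show "transp (l2_rel :: (real ^ 'n \<Rightarrow> complex) \<Rightarrow> _)"
  proof (rule transpI)
    fix u v w :: "real ^ 'n \<Rightarrow> complex"
    assume "l2_rel u v" "l2_rel v w"
    thus "l2_rel u w" unfolding l2_rel_def by (auto elim!: eventually_elim2)
  qed
qed

lemma rep_l2_in_L2 [simp]: "rep_l2 u \<in> L2"
  using Quotient_rep_reflp[OF Quotient_l2] by (auto simp: l2_rel_def)

lemma rep_l2_measurable [measurable]: "rep_l2 u \<in> borel_measurable borel"
  by (rule L2_measurable) simp

lemma abs_rep_l2 [simp]: "abs_l2 (rep_l2 u) = u"
  by (rule Quotient_abs_rep[OF Quotient_l2])

lemma abs_l2_eqI: "u \<in> L2 \<Longrightarrow> v \<in> L2 \<Longrightarrow> AE x in lborel. u x = v x \<Longrightarrow> abs_l2 u = abs_l2 v"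
  by (rule Quotient_rel_abs[OF Quotient_l2]) (simp add: l2_rel_def)

lemma rep_abs_l2: "u \<in> L2 \<Longrightarrow> AE x in lborel. rep_l2 (abs_l2 u) x = u x"
  using Quotient_rep_abs[OF Quotient_l2, of u] by (simp add: l2_rel_def)

lemma l2_eqI: "AE x in lborel. rep_l2 u x = rep_l2 v x \<Longrightarrow> u = v"
  using abs_l2_eqI[of "rep_l2 u" "rep_l2 v"] by simp

text \<open>The class \<open>real_inner\<close> sees only real scalars, so the complex structure is
  carried alongside; real scaling is then defined through it.\<close>

definition scaleC_l2 :: "complex \<Rightarrow> 'n::finite l2 \<Rightarrow> 'n l2" where
  "scaleC_l2 c u = abs_l2 (\<lambda>x. c * rep_l2 u x)"

instantiation l2 :: (finite) real_inner
begin

definition zero_l2 :: "'a l2" where "zero_l2 = abs_l2 (\<lambda>x. 0)"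
definition plus_l2 :: "'a l2 \<Rightarrow> 'a l2 \<Rightarrow> 'a l2" where
  "plus_l2 u v = abs_l2 (\<lambda>x. rep_l2 u x + rep_l2 v x)"
definition minus_l2 :: "'a l2 \<Rightarrow> 'a l2 \<Rightarrow> 'a l2" where
  "minus_l2 u v = abs_l2 (\<lambda>x. rep_l2 u x - rep_l2 v x)"
definition uminus_l2 :: "'a l2 \<Rightarrow> 'a l2" where
  "uminus_l2 u = abs_l2 (\<lambda>x. (-1) * rep_l2 u x)"
definition scaleR_l2 :: "real \<Rightarrow> 'a l2 \<Rightarrow> 'a l2" where
  "scaleR_l2 c u = scaleC_l2 (of_real c) u"
text \<open>The real part of the Hermitian product. Pairing with \<open>scaleC_l2 \<i> v\<close> in
  place of \<open>v\<close> yields its imaginary part, so the two real conditions together express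
  complex orthogonality.\<close>

definition inner_l2 :: "'a l2 \<Rightarrow> 'a l2 \<Rightarrow> real" where
  "inner_l2 u v = Re (LINT x|lborel. rep_l2 u x * cnj (rep_l2 v x))"
definition norm_l2 :: "'a l2 \<Rightarrow> real" where
  "norm_l2 u = sqrt (inner u u)"
definition sgn_l2 :: "'a l2 \<Rightarrow> 'a l2" where
  "sgn_l2 u = inverse (norm u) *\<^sub>R u"
definition dist_l2 :: "'a l2 \<Rightarrow> 'a l2 \<Rightarrow> real" where
  "dist_l2 u v = norm (u - v)"
definition uniformity_l2 :: "('a l2 \<times> 'a l2) filter" where
  "uniformity_l2 = (INF e\<in>{0<..}. principal {(u, v). dist u v < e})"
definition open_l2 :: "'a l2 set \<Rightarrow> bool" where
  "open_l2 U \<longleftrightarrow> (\<forall>u\<in>U. \<forall>\<^sub>F (u', v) in uniformity. u' = u \<longrightarrow> v \<in> U)"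

lemma rep_l2_zero: "AE x in lborel. rep_l2 (0 :: 'a l2) x = 0"
  unfolding zero_l2_def by (rule rep_abs_l2[OF L2_zero])

lemma rep_l2_add: "AE x in lborel. rep_l2 (u + v :: 'a l2) x = rep_l2 u x + rep_l2 v x"
  unfolding plus_l2_def by (rule rep_abs_l2) (intro L2_add; simp)

lemma rep_l2_diff: "AE x in lborel. rep_l2 (u - v :: 'a l2) x = rep_l2 u x - rep_l2 v x"
  unfolding minus_l2_def by (rule rep_abs_l2) (intro L2_diff; simp)

lemma rep_l2_uminus: "AE x in lborel. rep_l2 (- u :: 'a l2) x = - rep_l2 u x"
  unfolding uminus_l2_def using rep_abs_l2[OF L2_mult[of "rep_l2 u" "-1"]] by simp

lemma rep_l2_scaleC: "AE x in lborel. rep_l2 (scaleC_l2 c u :: 'a l2) x = c * rep_l2 u x"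
  unfolding scaleC_l2_def by (rule rep_abs_l2) (intro L2_mult; simp)

lemma rep_l2_scaleR: "AE x in lborel. rep_l2 (c *\<^sub>R u :: 'a l2) x = of_real c * rep_l2 u x"
  unfolding scaleR_l2_def by (rule rep_l2_scaleC)

lemma inner_l2_integrable: "integrable lborel (\<lambda>x. rep_l2 u x * cnj (rep_l2 v x :: complex))"
  by (intro L2_mult_integrable L2_cnj rep_l2_in_L2)

lemma inner_l2_self: "inner u u = (LINT x|lborel. (cmod (rep_l2 (u :: 'a l2) x))\<^sup>2)"
  unfolding inner_l2_def
  by (simp add: complex_norm_square[symmetric] del: of_real_power)

instance
proof
  fix u v w :: "'a l2" and r s :: real
  show "u + v + w = u + (v + w)"
    by (rule l2_eqI) (use rep_l2_add[of "u+v" w] rep_l2_add[of u v] rep_l2_add[of u "v+w"] rep_l2_add[of v w] in eventually_elim, simp)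
  show "u + v = v + u"
    by (simp add: plus_l2_def add.commute)
  show "0 + u = u"
    by (rule l2_eqI) (use rep_l2_add[of 0 u] rep_l2_zero in eventually_elim, simp)
  show "- u + u = 0"
    by (rule l2_eqI) (use rep_l2_add[of "-u" u] rep_l2_uminus[of u] rep_l2_zero in eventually_elim, simp)
  show "u - v = u + - v"
    by (rule l2_eqI) (use rep_l2_add[of u "-v"] rep_l2_uminus[of v] rep_l2_diff[of u v] in eventually_elim, simp)
  show "r *\<^sub>R (u + v) = r *\<^sub>R u + r *\<^sub>R v"
    by (rule l2_eqI) (use rep_l2_add[of u v] rep_l2_add[of "r *\<^sub>R u" "r *\<^sub>R v"] rep_l2_scaleR[of r u]
      rep_l2_scaleR[of r v] rep_l2_scaleR[of r "u+v"] in eventually_elim, simp add: algebra_simps)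
  show "(r + s) *\<^sub>R u = r *\<^sub>R u + s *\<^sub>R u"
    by (rule l2_eqI) (use rep_l2_add[of "r *\<^sub>R u" "s *\<^sub>R u"] rep_l2_scaleR[of r u]
      rep_l2_scaleR[of s u] rep_l2_scaleR[of "r+s" u] in eventually_elim, simp add: algebra_simps)
  show "r *\<^sub>R s *\<^sub>R u = (r * s) *\<^sub>R u"
    by (rule l2_eqI) (use rep_l2_scaleR[of r "s *\<^sub>R u"]
      rep_l2_scaleR[of s u] rep_l2_scaleR[of "r * s" u] in eventually_elim, simp add: algebra_simps)
  show "1 *\<^sub>R u = u"
    by (rule l2_eqI) (use rep_l2_scaleR[of 1 u] in eventually_elim, simp)
  show "dist u v = norm (u - v)" by (rule dist_l2_def)
  show "sgn u = inverse (norm u) *\<^sub>R u" by (rule sgn_l2_def)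
  show "uniformity = (INF e\<in>{0<..}. principal {(u, v :: 'a l2). dist u v < e})"
    by (rule uniformity_l2_def)
  show "open U \<longleftrightarrow> (\<forall>u\<in>U. \<forall>\<^sub>F (u', v) in uniformity. u' = u \<longrightarrow> v \<in> U)" for U :: "'a l2 set"
    by (rule open_l2_def)
  show "norm u = sqrt (inner u u)" by (rule norm_l2_def)
  show "inner u v = inner v u"
  proof -
    have "inner v u = Re (LINT x|lborel. cnj (rep_l2 u x * cnj (rep_l2 v x)))"
      unfolding inner_l2_def by (simp add: mult.commute)
    also have "\<dots> = inner u v"
      unfolding inner_l2_def by (subst Bochner_Integration.integral_cnj) simp
    finally show ?thesis by simp
  qed
  show "inner (u + v) w = inner u w + inner v w"
  proof -
    have "(LINT x|lborel. rep_l2 (u + v) x * cnj (rep_l2 w x)) =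
        (LINT x|lborel. rep_l2 u x * cnj (rep_l2 w x) + rep_l2 v x * cnj (rep_l2 w x))"
      by (rule integral_cong_AE)
         (measurable, use rep_l2_add[of u v] in eventually_elim, simp add: algebra_simps)
    thus ?thesis unfolding inner_l2_def by (simp add: inner_l2_integrable)
  qed
  show "inner (r *\<^sub>R u) v = r * inner u v"
  proof -
    have "(LINT x|lborel. rep_l2 (r *\<^sub>R u) x * cnj (rep_l2 v x)) =
        (LINT x|lborel. of_real r * (rep_l2 u x * cnj (rep_l2 v x)))"
      by (rule integral_cong_AE)
         (measurable, use rep_l2_scaleR[of r u] in eventually_elim, simp add: algebra_simps)
    thus ?thesis unfolding inner_l2_def by simp
  qed
  show "0 \<le> inner u u" unfolding inner_l2_self by simp
  show "inner u u = 0 \<longleftrightarrow> u = 0"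
  proof
    assume "inner u u = 0"
    hence "AE x in lborel. (cmod (rep_l2 u x))\<^sup>2 = 0"
      unfolding inner_l2_self by (subst (asm) integral_nonneg_eq_0_iff_AE) (auto intro: L2_integrable)
    hence "AE x in lborel. rep_l2 u x = rep_l2 0 x"
      using rep_l2_zero by eventually_elim simp
    thus "u = 0" by (rule l2_eqI)
  next
    assume "u = 0"
    hence "AE x in lborel. rep_l2 u x = 0" using rep_l2_zero by simp
    hence "(LINT x|lborel. (cmod (rep_l2 u x))\<^sup>2) = (LINT x|(lborel :: (real^'a) measure). 0)"
      by (intro integral_cong_AE) (auto elim: eventually_mono)
    thus "inner u u = 0" unfolding inner_l2_self by simp
  qed
qed

end

section \<open>Completeness\<close>

lemma norm_l2_square: "(norm u)\<^sup>2 = (LINT x|lborel. (cmod (rep_l2 u x))\<^sup>2)"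
  by (simp add: power2_norm_eq_inner inner_l2_self)

lemma norm_abs_l2:
  assumes "f \<in> L2"
  shows "(norm (abs_l2 f))\<^sup>2 = (LINT x|lborel. (cmod (f x))\<^sup>2)"
  unfolding norm_l2_square
  by (rule integral_cong_AE)
     (use assms L2_measurable rep_abs_l2[OF assms] in \<open>auto elim: eventually_mono\<close>)

lemma inner_abs_l2:
  assumes "f \<in> L2" "g \<in> L2"
  shows "abs_l2 f \<bullet> abs_l2 g = Re (LINT x|lborel. f x * cnj (g x))"
proof -
  note [measurable] = L2_measurable[OF assms(1)] L2_measurable[OF assms(2)]
  have "(LINT x|lborel. rep_l2 (abs_l2 f) x * cnj (rep_l2 (abs_l2 g) x)) = (LINT x|lborel. f x * cnj (g x))"
    by (rule integral_cong_AE)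
       (measurable, use rep_abs_l2[OF assms(1)] rep_abs_l2[OF assms(2)] in eventually_elim, simp)
  thus ?thesis by (simp add: inner_l2_def)
qed

lemma nn_integral_l2: "(\<integral>\<^sup>+x. ennreal ((cmod (rep_l2 u x))\<^sup>2) \<partial>lborel) = ennreal ((norm u)\<^sup>2)"
  unfolding norm_l2_square by (rule nn_integral_eq_integral) (auto intro: L2_integrable)

text \<open>The pointwise half of Riesz-Fischer. The weights \<open>4^k\<close> still leave summable
  integrals, since \<open>4^k * (1/16)^k = (1/4)^k\<close>; where the weighted series is finite, the
  increments are eventually below \<open>(1/2)^k\<close> and the telescoping series converges
  absolutely.\<close>

lemma rapid_Cauchy_l2_converges_AE:
  fixes X :: "nat \<Rightarrow> 'n::finite l2"
  assumes X: "\<And>k. norm (X (Suc k) - X k) \<le> (1/4)^k"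
  shows "AE x in lborel. convergent (\<lambda>k. rep_l2 (X k) x)"
proof -
  define d where "d k x = cmod (rep_l2 (X (Suc k) - X k) x)" for k x
  have [measurable]: "d k \<in> borel_measurable borel" for k unfolding d_def by measurable
  have int: "(\<integral>\<^sup>+x. ennreal (4^k * (d k x)\<^sup>2) \<partial>lborel) \<le> ennreal ((1/4)^k)" for k
  proof -
    have "(\<integral>\<^sup>+x. ennreal (4^k * (d k x)\<^sup>2) \<partial>lborel) = ennreal (4^k) * (\<integral>\<^sup>+x. ennreal ((d k x)\<^sup>2) \<partial>lborel)"
      by (subst nn_integral_cmult[symmetric]) (auto simp: ennreal_mult)
    also have "\<dots> = ennreal (4^k * (norm (X (Suc k) - X k))\<^sup>2)"
      unfolding d_def nn_integral_l2 by (simp add: ennreal_mult)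
    also have "\<dots> \<le> ennreal (4^k * ((1/4)^k)\<^sup>2)"
      by (intro ennreal_leI mult_left_mono power_mono X) auto
    also have "4^k * ((1/4)^k)\<^sup>2 = (1/4::real)^k"
      by (simp add: power2_eq_square power_mult_distrib[symmetric] field_simps)
    finally show ?thesis .
  qed
  have "(\<integral>\<^sup>+x. (\<Sum>k. ennreal (4^k * (d k x)\<^sup>2)) \<partial>lborel) = (\<Sum>k. (\<integral>\<^sup>+x. ennreal (4^k * (d k x)\<^sup>2) \<partial>lborel))"
    by (rule nn_integral_suminf) measurable
  also have "\<dots> \<le> (\<Sum>k. ennreal ((1/4)^k))" by (intro suminf_le int) auto
  also have "\<dots> = ennreal (\<Sum>k. (1/4)^k)" by (intro suminf_ennreal2) (auto intro: summable_geometric)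
  also have "\<dots> < \<infinity>" by simp
  finally have "AE x in lborel. (\<Sum>k. ennreal (4^k * (d k x)\<^sup>2)) \<noteq> \<infinity>"
    by (intro nn_integral_PInf_AE) auto
  moreover have "AE x in lborel. \<forall>k. d k x = cmod (rep_l2 (X (Suc k)) x - rep_l2 (X k) x)"
    unfolding d_def AE_all_countable
  proof
    fix k show "AE x in lborel. cmod (rep_l2 (X (Suc k) - X k) x) = cmod (rep_l2 (X (Suc k)) x - rep_l2 (X k) x)"
      using rep_l2_diff[of "X (Suc k)" "X k"] by eventually_elim simp
  qed
  ultimately show ?thesis
  proof eventually_elim
    case (elim x)
    have "summable (\<lambda>k. 4^k * (d k x)\<^sup>2)"
      using elim(1) by (intro summable_suminf_not_top) (auto simp: top_ennreal.rep_eq infinity_ennreal_def)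
    hence "(\<lambda>k. 4^k * (d k x)\<^sup>2) \<longlonglongrightarrow> 0" by (rule summable_LIMSEQ_zero)
    hence "\<forall>\<^sub>F k in sequentially. 4^k * (d k x)\<^sup>2 < 1" by (rule order_tendstoD) simp
    hence "\<forall>\<^sub>F k in sequentially. norm (rep_l2 (X (Suc k)) x - rep_l2 (X k) x) \<le> (1/2)^k"
    proof eventually_elim
      case (elim k)
      have "(2^k * d k x)\<^sup>2 < 1\<^sup>2"
        using elim by (simp add: power_mult_distrib power_mult[symmetric] mult.commute[of _ 2] power_mult)
      hence "2^k * d k x < 1" by (rule power_less_imp_less_base) simp
      hence "d k x \<le> (1/2)^k" by (simp add: field_simps)
      thus ?case using \<open>\<forall>k. d k x = _ k\<close> by simp
    qed
    hence "summable (\<lambda>k. rep_l2 (X (Suc k)) x - rep_l2 (X k) x)"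
      by (rule summable_comparison_test_ev) (simp add: summable_geometric)
    hence "convergent (\<lambda>n. \<Sum>k<n. rep_l2 (X (Suc k)) x - rep_l2 (X k) x)"
      by (simp add: summable_iff_convergent)
    hence "convergent (\<lambda>n. rep_l2 (X n) x - rep_l2 (X 0) x)"
      by (subst (asm) sum_lessThan_telescope)
    hence "convergent (\<lambda>n. rep_l2 (X 0) x + (rep_l2 (X n) x - rep_l2 (X 0) x))"
      by (intro convergent_add convergent_const)
    thus ?case by simp
  qed
qed

text \<open>The pointwise limit \<open>f\<close> is not yet known to be square-integrable, so the
  estimate is made in \<open>ennreal\<close>, where Fatou applies; membership in \<open>L2\<close>
  follows from it afterwards.\<close>

lemma Fatou_l2:
  fixes X :: "nat \<Rightarrow> 'n::finite l2"
  assumes [measurable]: "f \<in> borel_measurable borel"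
    and lim: "AE x in lborel. (\<lambda>k. rep_l2 (X k) x) \<longlonglongrightarrow> f x"
    and bound: "\<And>k. k \<ge> N \<Longrightarrow> norm (X k - Y) \<le> e"
  shows "(\<integral>\<^sup>+x. ennreal ((cmod (f x - rep_l2 Y x))\<^sup>2) \<partial>lborel) \<le> ennreal (e\<^sup>2)"
proof -
  have "AE x in lborel. \<forall>k. rep_l2 (X k - Y) x = rep_l2 (X k) x - rep_l2 Y x"
    unfolding AE_all_countable using rep_l2_diff by blast
  with lim have ae: "AE x in lborel. ennreal ((cmod (f x - rep_l2 Y x))\<^sup>2) = liminf (\<lambda>k. ennreal ((cmod (rep_l2 (X k - Y) x))\<^sup>2))"
  proof eventually_elim
    case (elim x)
    have "(\<lambda>k. ennreal ((cmod (rep_l2 (X k) x - rep_l2 Y x))\<^sup>2)) \<longlonglongrightarrow> ennreal ((cmod (f x - rep_l2 Y x))\<^sup>2)"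
      by (intro tendsto_intros elim(1))
    from lim_imp_Liminf[OF sequentially_bot this] show ?case using elim(2) by simp
  qed
  have "(\<integral>\<^sup>+x. ennreal ((cmod (f x - rep_l2 Y x))\<^sup>2) \<partial>lborel) = (\<integral>\<^sup>+x. liminf (\<lambda>k. ennreal ((cmod (rep_l2 (X k - Y) x))\<^sup>2)) \<partial>lborel)"
    by (rule nn_integral_cong_AE[OF ae])
  also have "\<dots> \<le> liminf (\<lambda>k. \<integral>\<^sup>+x. ennreal ((cmod (rep_l2 (X k - Y) x))\<^sup>2) \<partial>lborel)"
    by (rule nn_integral_liminf) measurable
  also have "\<dots> = liminf (\<lambda>k. ennreal ((norm (X k - Y))\<^sup>2))" unfolding nn_integral_l2 ..
  also have "\<dots> \<le> limsup (\<lambda>k. ennreal ((norm (X k - Y))\<^sup>2))"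
    by (rule Liminf_le_Limsup) simp
  also have "\<dots> \<le> ennreal (e\<^sup>2)"
    by (rule Limsup_bounded, rule eventually_sequentiallyI[of N])
       (use bound in \<open>auto intro!: ennreal_leI power_mono\<close>)
  finally show ?thesis .
qed

instance l2 :: (finite) banach
proof
  fix X :: "nat \<Rightarrow> 'a l2"
  assume C: "Cauchy X"
  have "\<exists>s. strict_mono s \<and> (\<forall>k. norm (X (s (Suc k)) - X (s k)) \<le> (1/4)^k)"
  proof -
    have "\<exists>N. \<forall>m\<ge>N. \<forall>n\<ge>N. dist (X m) (X n) < (1/4)^k" for k :: nat
      using metric_CauchyD[OF C, of "(1/4)^k"] by auto
    then obtain N where N: "\<And>k m n. m \<ge> N k \<Longrightarrow> n \<ge> N k \<Longrightarrow> dist (X m) (X n) < (1/4)^k"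
      by metis
    \<comment> \<open>The maximum makes \<open>s\<close> strictly increasing and pushes
      \<open>s k\<close> beyond the Cauchy index \<open>N k\<close>.\<close>
    define s where "s = rec_nat (N 0) (\<lambda>k m. max (Suc m) (N (Suc k)))"
    have s: "s 0 = N 0" "s (Suc k) = max (Suc (s k)) (N (Suc k))" for k by (simp_all add: s_def)
    have "strict_mono s" unfolding strict_mono_Suc_iff by (simp add: s less_max_iff_disj)
    moreover have "N k \<le> s k" for k by (cases k) (simp_all add: s)
    moreover have "s k \<le> s (Suc k)" for k by (simp add: s)
    ultimately show ?thesis
      by (intro exI[of _ s]) (auto simp: dist_norm[symmetric] intro!: less_imp_le[OF N] intro: order_trans)
  qed
  then obtain s where s: "strict_mono s" "\<And>k. norm (X (s (Suc k)) - X (s k)) \<le> (1/4)^k" by blast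
  define Y where "Y = X \<circ> s"
  define f where "f x = lim (\<lambda>k. rep_l2 (Y k) x)" for x
  have [measurable]: "f \<in> borel_measurable borel"
    unfolding f_def[abs_def] by (rule borel_measurable_lim_metric) measurable
  have "AE x in lborel. convergent (\<lambda>k. rep_l2 (Y k) x)"
    by (rule rapid_Cauchy_l2_converges_AE) (simp add: Y_def s(2))
  hence lim: "AE x in lborel. (\<lambda>k. rep_l2 (Y k) x) \<longlonglongrightarrow> f x"
    by eventually_elim (simp add: f_def convergent_LIMSEQ_iff)
  have CY: "Cauchy Y" unfolding Y_def by (rule Cauchy_subseq_Cauchy[OF C s(1)])
  have close: "\<exists>N. \<forall>m\<ge>N. (\<integral>\<^sup>+x. ennreal ((cmod (f x - rep_l2 (Y m) x))\<^sup>2) \<partial>lborel) \<le> ennreal (e\<^sup>2)" if "e > 0" for e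
  proof -
    obtain N where N: "\<And>m n. m \<ge> N \<Longrightarrow> n \<ge> N \<Longrightarrow> dist (Y m) (Y n) < e"
      using metric_CauchyD[OF CY \<open>e > 0\<close>] by metis
    show ?thesis
    proof (intro exI[of _ N] allI impI)
      fix m assume m: "N \<le> m"
      show "(\<integral>\<^sup>+x. ennreal ((cmod (f x - rep_l2 (Y m) x))\<^sup>2) \<partial>lborel) \<le> ennreal (e\<^sup>2)"
        using N[OF _ m] by (intro Fatou_l2[OF _ lim, of N]) (auto simp: dist_norm less_imp_le)
    qed
  qed
  have fm: "(\<lambda>x. f x - rep_l2 (Y m) x) \<in> L2"
    if "(\<integral>\<^sup>+x. ennreal ((cmod (f x - rep_l2 (Y m) x))\<^sup>2) \<partial>lborel) \<le> ennreal c" for m c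
  proof (rule L2_I)
    have "(\<integral>\<^sup>+x. ennreal ((cmod (f x - rep_l2 (Y m) x))\<^sup>2) \<partial>lborel) < \<infinity>"
      using that by (rule le_less_trans) simp
    thus "integrable lborel (\<lambda>x. (cmod (f x - rep_l2 (Y m) x))\<^sup>2)"
      by (intro integrableI_bounded) simp_all
  qed measurable
  have fL2: "f \<in> L2"
  proof -
    obtain N where "\<forall>m\<ge>N. (\<integral>\<^sup>+x. ennreal ((cmod (f x - rep_l2 (Y m) x))\<^sup>2) \<partial>lborel) \<le> ennreal (1\<^sup>2)"
      using close[of 1] by fastforce
    from L2_add[OF fm[OF this[rule_format, OF order_refl]] rep_l2_in_L2[of "Y N"]] show ?thesis by simp
  qed
  have "Y \<longlonglongrightarrow> abs_l2 f"
  proof (rule metric_LIMSEQ_I)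
    fix e :: real assume e: "e > 0"
    then obtain N where N: "\<And>m. m \<ge> N \<Longrightarrow> (\<integral>\<^sup>+x. ennreal ((cmod (f x - rep_l2 (Y m) x))\<^sup>2) \<partial>lborel) \<le> ennreal ((e/2)\<^sup>2)"
      using close[of "e/2"] by auto
    show "\<exists>N. \<forall>m\<ge>N. dist (Y m) (abs_l2 f) < e"
    proof (intro exI[of _ N] allI impI)
      fix m assume m: "N \<le> m"
      have "ennreal ((norm (abs_l2 f - Y m))\<^sup>2) = (\<integral>\<^sup>+x. ennreal ((cmod (rep_l2 (abs_l2 f - Y m) x))\<^sup>2) \<partial>lborel)"
        by (rule nn_integral_l2[symmetric])
      also have "\<dots> = (\<integral>\<^sup>+x. ennreal ((cmod (f x - rep_l2 (Y m) x))\<^sup>2) \<partial>lborel)"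
        by (rule nn_integral_cong_AE)
           (use rep_l2_diff[of "abs_l2 f" "Y m"] rep_abs_l2[OF fL2] in eventually_elim, simp)
      also have "\<dots> \<le> ennreal ((e/2)\<^sup>2)" by (rule N[OF m])
      finally have "(norm (abs_l2 f - Y m))\<^sup>2 \<le> (e/2)\<^sup>2" by (simp add: ennreal_le_iff)
      hence "norm (abs_l2 f - Y m) \<le> e/2" by (rule power2_le_imp_le) (use e in simp)
      hence "dist (Y m) (abs_l2 f) \<le> e/2" by (simp only: dist_norm norm_minus_commute)
      thus "dist (Y m) (abs_l2 f) < e" using e by linarith
    qed
  qed
  thus "convergent X"
    using Cauchy_converges_subseq[OF C s(1)] by (auto simp: Y_def o_def convergent_def)
qed

section \<open>Multiplication and convolution operators\<close>

lemma lborel_distr_reflect: "distr lborel borel (\<lambda>x. t - x) = (lborel :: 'a::euclidean_space measure)"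
  using lborel_affine[of "-1" t, symmetric] by (simp add: density_1)

lemma nn_integral_reflect:
  fixes f :: "'a::euclidean_space \<Rightarrow> ennreal"
  assumes [measurable]: "f \<in> borel_measurable borel"
  shows "(\<integral>\<^sup>+x. f (t - x) \<partial>lborel) = (\<integral>\<^sup>+x. f x \<partial>lborel)"
  by (subst (2) lborel_distr_reflect[of t, symmetric], subst nn_integral_distr) auto

lemma integral_reflect:
  fixes f :: "'a::euclidean_space \<Rightarrow> 'b::{banach, second_countable_topology}"
  assumes [measurable]: "f \<in> borel_measurable borel"
  shows "(LINT x|lborel. f (t - x)) = (LINT x|lborel. f x)"
  by (subst (2) lborel_distr_reflect[of t, symmetric], subst integral_distr) auto

lemma AE_reflect:
  fixes P :: "'a::euclidean_space \<Rightarrow> bool"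
  assumes [measurable]: "Measurable.pred borel P" and "AE x in lborel. P x"
  shows "AE x in lborel. P (t - x)"
  using assms(2) by (subst (asm) lborel_distr_reflect[of t, symmetric], subst (asm) AE_distr_iff) auto

lemma integral_translate:
  fixes f :: "'a::euclidean_space \<Rightarrow> 'b::{banach, second_countable_topology}"
  assumes [measurable]: "f \<in> borel_measurable borel"
  shows "(LINT x|lborel. f (x + t)) = (LINT x|lborel. f x)"
  by (subst (2) lborel_distr_plus[of t, symmetric], subst integral_distr) (auto simp: add.commute)

section \<open>Multiplication by bounded functions\<close>

definition mult_l2 :: "(real ^ 'n \<Rightarrow> complex) \<Rightarrow> 'n::finite l2 \<Rightarrow> 'n l2" where
  "mult_l2 g u = abs_l2 (\<lambda>x. g x * rep_l2 u x)"

locale bounded_function =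
  fixes g :: "real ^ 'n::finite \<Rightarrow> complex" and C :: real
  assumes measurable_g [measurable]: "g \<in> borel_measurable borel"
    and bounded_g: "\<And>x. cmod (g x) \<le> C"
begin

lemma C_nonneg: "0 \<le> C"
  using norm_ge_zero bounded_g order_trans by blast

lemma rep_mult_l2: "AE x in lborel. rep_l2 (mult_l2 g u) x = g x * rep_l2 u x"
  unfolding mult_l2_def
  by (intro rep_abs_l2 L2_bounded_mult[where C = C] bounded_g) auto

lemma mult_l2_abs:
  assumes "f \<in> L2"
  shows "mult_l2 g (abs_l2 f) = abs_l2 (\<lambda>x. g x * f x)"
  unfolding mult_l2_def
  by (intro abs_l2_eqI L2_bounded_mult[where C = C] bounded_g)
     (use assms rep_abs_l2[OF assms] in \<open>auto elim: eventually_mono\<close>)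

lemma norm_mult_l2: "norm (mult_l2 g u) \<le> C * norm u"
proof (rule power2_le_imp_le)
  have "(norm (mult_l2 g u))\<^sup>2 = (LINT x|lborel. (cmod (g x * rep_l2 u x))\<^sup>2)"
    unfolding mult_l2_def by (intro norm_abs_l2 L2_bounded_mult[where C = C] bounded_g) auto
  also have "\<dots> \<le> (LINT x|lborel. C\<^sup>2 * (cmod (rep_l2 u x))\<^sup>2)"
    by (intro integral_mono L2_integrable L2_bounded_mult[where C = C] bounded_g integrable_mult_right)
       (auto simp: norm_mult power_mult_distrib intro!: mult_right_mono power_mono bounded_g)
  also have "\<dots> = (C * norm u)\<^sup>2" by (simp add: norm_l2_square power_mult_distrib)
  finally show "(norm (mult_l2 g u))\<^sup>2 \<le> (C * norm u)\<^sup>2" .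
qed (simp add: C_nonneg)

lemma bounded_linear_mult_l2: "bounded_linear (mult_l2 g)"
proof (rule bounded_linear_intro)
  fix u v :: "'n l2" and c :: real
  show "mult_l2 g (u + v) = mult_l2 g u + mult_l2 g v"
    by (rule l2_eqI)
       (use rep_mult_l2[of "u+v"] rep_mult_l2[of u] rep_mult_l2[of v] rep_l2_add[of u v]
         rep_l2_add[of "mult_l2 g u" "mult_l2 g v"] in \<open>eventually_elim, simp add: algebra_simps\<close>)
  show "mult_l2 g (c *\<^sub>R u) = c *\<^sub>R mult_l2 g u"
    by (rule l2_eqI)
       (use rep_mult_l2[of "c *\<^sub>R u"] rep_mult_l2[of u] rep_l2_scaleR[of c u]
         rep_l2_scaleR[of c "mult_l2 g u"] in \<open>eventually_elim, simp add: algebra_simps\<close>)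
  show "norm (mult_l2 g u) \<le> norm u * C" using norm_mult_l2[of u] by (simp add: mult.commute)
qed

lemma mult_l2_scaleC: "mult_l2 g (scaleC_l2 c u) = scaleC_l2 c (mult_l2 g u)"
  by (rule l2_eqI)
     (use rep_mult_l2[of "scaleC_l2 c u"] rep_mult_l2[of u] rep_l2_scaleC[of c u]
       rep_l2_scaleC[of c "mult_l2 g u"] in \<open>eventually_elim, simp add: algebra_simps\<close>)

lemma mult_l2_symmetric:
  assumes "\<And>x. Im (g x) = 0"
  shows "mult_l2 g u \<bullet> v = u \<bullet> mult_l2 g v"
proof -
  have c: "cnj (g x) = g x" for x using assms[of x] by (simp add: complex_eq_iff)
  have "(LINT x|lborel. rep_l2 (mult_l2 g u) x * cnj (rep_l2 v x)) =
      (LINT x|lborel. rep_l2 u x * cnj (rep_l2 (mult_l2 g v) x))"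
    by (rule integral_cong_AE)
       (measurable, use rep_mult_l2[of u] rep_mult_l2[of v] in \<open>eventually_elim, simp add: c\<close>)
  thus ?thesis by (simp add: inner_l2_def)
qed

end

section \<open>Convolution with an integrable kernel\<close>

definition convolution :: "(real ^ 'n \<Rightarrow> complex) \<Rightarrow> (real ^ 'n \<Rightarrow> complex) \<Rightarrow> real ^ 'n \<Rightarrow> complex" where
  "convolution a u x = (LINT y|lborel. a (x - y) * u y)"

definition conv_l2 :: "(real ^ 'n \<Rightarrow> complex) \<Rightarrow> 'n::finite l2 \<Rightarrow> 'n l2" where
  "conv_l2 a u = abs_l2 (convolution a (rep_l2 u))"

text \<open>An everywhere defined majorant. Its finiteness almost everywhere is what makes the
  Bochner integral in \<open>convolution\<close> meaningful and additive.\<close>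

definition abs_conv :: "(real ^ 'n \<Rightarrow> complex) \<Rightarrow> (real ^ 'n \<Rightarrow> complex) \<Rightarrow> real ^ 'n \<Rightarrow> ennreal" where
  "abs_conv a u x = (\<integral>\<^sup>+y. ennreal (cmod (a (x - y))) * ennreal (cmod (u y)) \<partial>lborel)"

lemma measurable_convolution [measurable]:
  assumes [measurable]: "a \<in> borel_measurable borel" "u \<in> borel_measurable borel"
  shows "convolution a u \<in> borel_measurable borel"
proof -
  have "(\<lambda>x. LINT y|lborel. a (x - y) * u y) \<in> borel_measurable lborel"
    by (rule lborel.borel_measurable_lebesgue_integral) measurable
  thus ?thesis unfolding convolution_def[abs_def] by simp
qed

lemma measurable_abs_conv [measurable]:
  assumes [measurable]: "a \<in> borel_measurable borel" "u \<in> borel_measurable borel"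
  shows "abs_conv a u \<in> borel_measurable borel"
proof -
  have "(\<lambda>x. \<integral>\<^sup>+y. ennreal (cmod (a (x - y))) * ennreal (cmod (u y)) \<partial>lborel) \<in> borel_measurable lborel"
    by (rule lborel.borel_measurable_nn_integral) measurable
  thus ?thesis unfolding abs_conv_def[abs_def] by simp
qed

text \<open>Young's inequality for exponents 1 and 2: after writing the modulus of the kernel as the
  square of its square root, Cauchy-Schwarz bounds \<open>abs_conv\<close> pointwise, and Tonelli
  integrates the bound.\<close>

lemma nn_integral_abs_conv_square:
  fixes a u :: "real ^ 'n \<Rightarrow> complex"
  assumes a: "integrable lborel a" and [measurable]: "u \<in> borel_measurable borel"
  shows "(\<integral>\<^sup>+x. (abs_conv a u x)\<^sup>2 \<partial>lborel) \<le>
    ennreal ((LINT x|lborel. cmod (a x))\<^sup>2) * (\<integral>\<^sup>+x. ennreal ((cmod (u x))\<^sup>2) \<partial>lborel)"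
proof -
  have [measurable]: "a \<in> borel_measurable borel" using a by auto
  define N where "N = (LINT x|lborel. cmod (a x))"
  have N: "(\<integral>\<^sup>+x. ennreal (cmod (a x)) \<partial>lborel) = ennreal N" "N \<ge> 0"
    using a unfolding N_def by (auto intro: nn_integral_eq_integral)
  have "(abs_conv a u x)\<^sup>2 \<le> ennreal N * (\<integral>\<^sup>+y. ennreal (cmod (a (x - y))) * ennreal ((cmod (u y))\<^sup>2) \<partial>lborel)" for x
  proof -
    have "abs_conv a u x = (\<integral>\<^sup>+y. ennreal (sqrt (cmod (a (x - y)))) * ennreal (sqrt (cmod (a (x - y))) * cmod (u y)) \<partial>lborel)"
      unfolding abs_conv_def
      by (intro nn_integral_cong) (simp add: ennreal_mult[symmetric] mult.assoc[symmetric])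
    also have "\<dots>\<^sup>2 \<le> (\<integral>\<^sup>+y. (ennreal (sqrt (cmod (a (x - y)))))\<^sup>2 \<partial>lborel) *
        (\<integral>\<^sup>+y. (ennreal (sqrt (cmod (a (x - y))) * cmod (u y)))\<^sup>2 \<partial>lborel)"
      by (rule Cauchy_Schwarz_nn_integral) measurable
    also have "(\<integral>\<^sup>+y. (ennreal (sqrt (cmod (a (x - y)))))\<^sup>2 \<partial>lborel) = (\<integral>\<^sup>+y. ennreal (cmod (a (x - y))) \<partial>lborel)"
      by (intro nn_integral_cong) (simp add: ennreal_power)
    also have "\<dots> = ennreal N" by (subst nn_integral_reflect[where f = "\<lambda>z. ennreal (cmod (a z))"]) (simp_all add: N)
    also have "(\<integral>\<^sup>+y. (ennreal (sqrt (cmod (a (x - y))) * cmod (u y)))\<^sup>2 \<partial>lborel) =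
        (\<integral>\<^sup>+y. ennreal (cmod (a (x - y))) * ennreal ((cmod (u y))\<^sup>2) \<partial>lborel)"
      by (intro nn_integral_cong) (simp add: ennreal_power power_mult_distrib ennreal_mult)
    finally show ?thesis .
  qed
  hence "(\<integral>\<^sup>+x. (abs_conv a u x)\<^sup>2 \<partial>lborel) \<le>
      (\<integral>\<^sup>+x. ennreal N * (\<integral>\<^sup>+y. ennreal (cmod (a (x - y))) * ennreal ((cmod (u y))\<^sup>2) \<partial>lborel) \<partial>lborel)"
    by (intro nn_integral_mono)
  also have "\<dots> = ennreal N * (\<integral>\<^sup>+x. (\<integral>\<^sup>+y. ennreal (cmod (a (x - y))) * ennreal ((cmod (u y))\<^sup>2) \<partial>lborel) \<partial>lborel)"
    by (rule nn_integral_cmult) measurable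
  also have "(\<integral>\<^sup>+x. (\<integral>\<^sup>+y. ennreal (cmod (a (x - y))) * ennreal ((cmod (u y))\<^sup>2) \<partial>lborel) \<partial>lborel) =
      (\<integral>\<^sup>+y. (\<integral>\<^sup>+x. ennreal (cmod (a (x - y))) * ennreal ((cmod (u y))\<^sup>2) \<partial>lborel) \<partial>lborel)"
    by (rule lborel_pair.Fubini'[symmetric]) measurable
  also have "\<dots> = (\<integral>\<^sup>+y. ennreal N * ennreal ((cmod (u y))\<^sup>2) \<partial>lborel)"
  proof (intro nn_integral_cong)
    fix y :: "real ^ 'n"
    have "(\<integral>\<^sup>+x. ennreal (cmod (a (x - y))) \<partial>lborel) = ennreal N"
      unfolding N(1)[symmetric]
      by (subst (2) lborel_distr_plus[of "-y", symmetric], subst nn_integral_distr) auto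
    thus "(\<integral>\<^sup>+x. ennreal (cmod (a (x - y))) * ennreal ((cmod (u y))\<^sup>2) \<partial>lborel) = ennreal N * ennreal ((cmod (u y))\<^sup>2)"
      by (subst nn_integral_multc) auto
  qed
  also have "\<dots> = ennreal N * (\<integral>\<^sup>+y. ennreal ((cmod (u y))\<^sup>2) \<partial>lborel)"
    by (rule nn_integral_cmult) measurable
  finally show ?thesis
    unfolding N_def[symmetric] using N(2) by (simp add: power2_eq_square ennreal_mult mult.assoc)
qed

lemma abs_conv_finite_AE:
  fixes a u :: "real ^ 'n \<Rightarrow> complex"
  assumes a: "integrable lborel a" and u: "u \<in> L2"
  shows "AE x in lborel. abs_conv a u x < \<infinity>"
proof -
  have [measurable]: "a \<in> borel_measurable borel" "u \<in> borel_measurable borel" using a u L2_measurable by auto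
  have "(\<integral>\<^sup>+x. ennreal ((cmod (u x))\<^sup>2) \<partial>lborel) < \<infinity>"
    using L2_integrable[OF u] by (simp add: integrable_iff_bounded)
  hence "ennreal ((LINT x|lborel. cmod (a x))\<^sup>2) * (\<integral>\<^sup>+x. ennreal ((cmod (u x))\<^sup>2) \<partial>lborel) < \<infinity>"
    by (simp add: ennreal_mult_less_top)
  hence "(\<integral>\<^sup>+x. (abs_conv a u x)\<^sup>2 \<partial>lborel) \<noteq> \<infinity>"
    using nn_integral_abs_conv_square[OF a, of u] by (auto simp: top_unique)
  hence "AE x in lborel. (abs_conv a u x)\<^sup>2 \<noteq> \<infinity>"
    by (intro nn_integral_PInf_AE) auto
  thus ?thesis by eventually_elim (auto simp: less_top power2_eq_square ennreal_mult_eq_top_iff)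
qed

lemma convolution_integrable_AE:
  fixes a u :: "real ^ 'n \<Rightarrow> complex"
  assumes a: "integrable lborel a" and u: "u \<in> L2"
  shows "AE x in lborel. integrable lborel (\<lambda>y. a (x - y) * u y)"
  using abs_conv_finite_AE[OF assms]
proof eventually_elim
  case (elim x)
  have [measurable]: "a \<in> borel_measurable borel" "u \<in> borel_measurable borel" using a u L2_measurable by auto
  show ?case
    by (rule integrableI_bounded) (use elim in \<open>simp_all add: abs_conv_def norm_mult ennreal_mult\<close>)
qed

text \<open>Valid at every point, because the Bochner integral of a function that is not integrable
  has the default value 0.\<close>

lemma norm_convolution_le: "ennreal (cmod (convolution a u x)) \<le> abs_conv a u x"
proof (cases "integrable lborel (\<lambda>y. a (x - y) * u y)")
  case True
  from integral_norm_bound_ennreal[OF True] show ?thesis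
    by (simp add: convolution_def abs_conv_def norm_mult ennreal_mult)
qed (simp add: convolution_def not_integrable_integral_eq)

lemma nn_integral_convolution_square:
  fixes a u :: "real ^ 'n \<Rightarrow> complex"
  assumes a: "integrable lborel a" and u: "u \<in> borel_measurable borel"
  shows "(\<integral>\<^sup>+x. ennreal ((cmod (convolution a u x))\<^sup>2) \<partial>lborel) \<le>
    ennreal ((LINT x|lborel. cmod (a x))\<^sup>2) * (\<integral>\<^sup>+x. ennreal ((cmod (u x))\<^sup>2) \<partial>lborel)"
proof -
  have "(\<integral>\<^sup>+x. ennreal ((cmod (convolution a u x))\<^sup>2) \<partial>lborel) \<le> (\<integral>\<^sup>+x. (abs_conv a u x)\<^sup>2 \<partial>lborel)"
    by (intro nn_integral_mono) (auto simp: ennreal_power[symmetric] intro!: power_mono norm_convolution_le)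
  also note nn_integral_abs_conv_square[OF assms]
  finally show ?thesis .
qed

lemma convolution_L2:
  fixes a u :: "real ^ 'n \<Rightarrow> complex"
  assumes a: "integrable lborel a" and u: "u \<in> L2"
  shows "convolution a u \<in> L2"
proof -
  have [measurable]: "a \<in> borel_measurable borel" "u \<in> borel_measurable borel" using a u L2_measurable by auto
  have "(\<integral>\<^sup>+x. ennreal ((cmod (u x))\<^sup>2) \<partial>lborel) < \<infinity>"
    using L2_integrable[OF u] by (simp add: integrable_iff_bounded)
  hence "ennreal ((LINT x|lborel. cmod (a x))\<^sup>2) * (\<integral>\<^sup>+x. ennreal ((cmod (u x))\<^sup>2) \<partial>lborel) < \<infinity>"
    by (simp add: ennreal_mult_less_top)
  with nn_integral_convolution_square[OF a, of u]
  have "(\<integral>\<^sup>+x. ennreal ((cmod (convolution a u x))\<^sup>2) \<partial>lborel) < \<infinity>" by auto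
  thus ?thesis by (intro L2_I integrableI_bounded) simp_all
qed

text \<open>The values agree at every point although the factors agree only almost everywhere, so
  representatives can be exchanged inside a convolution without a further null set.\<close>

lemma convolution_cong_AE:
  assumes "AE x in lborel. u x = v x" and [measurable]: "a \<in> borel_measurable borel"
    "u \<in> borel_measurable borel" "v \<in> borel_measurable borel"
  shows "convolution a u x = convolution a v x"
  unfolding convolution_def
  by (rule integral_cong_AE) (measurable, use assms(1) in \<open>eventually_elim, simp\<close>)

lemma rep_conv_l2:
  assumes "integrable lborel a"
  shows "AE x in lborel. rep_l2 (conv_l2 a u) x = convolution a (rep_l2 u) x"
  unfolding conv_l2_def by (rule rep_abs_l2) (rule convolution_L2[OF assms rep_l2_in_L2])

lemma conv_l2_abs:
  assumes "integrable lborel a" "f \<in> L2"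
  shows "conv_l2 a (abs_l2 f) = abs_l2 (convolution a f)"
proof -
  have "convolution a (rep_l2 (abs_l2 f)) = convolution a f"
    by (rule ext, rule convolution_cong_AE) (use assms rep_abs_l2 L2_measurable in auto)
  thus ?thesis by (simp add: conv_l2_def)
qed

lemma norm_conv_l2:
  assumes "integrable lborel a"
  shows "norm (conv_l2 a u) \<le> (LINT x|lborel. cmod (a x)) * norm u"
proof (rule power2_le_imp_le)
  have "ennreal ((norm (conv_l2 a u))\<^sup>2) = (\<integral>\<^sup>+x. ennreal ((cmod (rep_l2 (conv_l2 a u) x))\<^sup>2) \<partial>lborel)"
    by (rule nn_integral_l2[symmetric])
  also have "\<dots> = (\<integral>\<^sup>+x. ennreal ((cmod (convolution a (rep_l2 u) x))\<^sup>2) \<partial>lborel)"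
    by (rule nn_integral_cong_AE) (use rep_conv_l2[OF assms, of u] in \<open>eventually_elim, simp\<close>)
  also have "\<dots> \<le> ennreal ((LINT x|lborel. cmod (a x))\<^sup>2) * (\<integral>\<^sup>+x. ennreal ((cmod (rep_l2 u x))\<^sup>2) \<partial>lborel)"
    by (rule nn_integral_convolution_square[OF assms]) simp
  also have "\<dots> = ennreal (((LINT x|lborel. cmod (a x)) * norm u)\<^sup>2)"
    unfolding nn_integral_l2 by (simp add: ennreal_mult power_mult_distrib)
  finally show "(norm (conv_l2 a u))\<^sup>2 \<le> ((LINT x|lborel. cmod (a x)) * norm u)\<^sup>2"
    by (simp add: ennreal_le_iff)
qed (auto intro!: mult_nonneg_nonneg integral_nonneg_AE)

lemma conv_l2_add:
  assumes a: "integrable lborel a"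
  shows "conv_l2 a (u + v) = conv_l2 a u + conv_l2 a v"
proof (rule l2_eqI)
  have [measurable]: "a \<in> borel_measurable borel" using a by auto
  have cg: "convolution a (rep_l2 (u + v)) = convolution a (\<lambda>y. rep_l2 u y + rep_l2 v y)"
    by (rule ext, rule convolution_cong_AE[OF rep_l2_add]) auto
  from rep_conv_l2[OF a, of "u + v"] rep_conv_l2[OF a, of u] rep_conv_l2[OF a, of v]
    rep_l2_add[of "conv_l2 a u" "conv_l2 a v"] convolution_integrable_AE[OF a rep_l2_in_L2, of u]
    convolution_integrable_AE[OF a rep_l2_in_L2, of v]
  show "AE x in lborel. rep_l2 (conv_l2 a (u + v)) x = rep_l2 (conv_l2 a u + conv_l2 a v) x"
    by eventually_elim (simp add: cg, simp add: convolution_def distrib_left)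
qed

lemma conv_l2_scaleC:
  assumes a: "integrable lborel a"
  shows "conv_l2 a (scaleC_l2 c u) = scaleC_l2 c (conv_l2 a u)"
proof (rule l2_eqI)
  have [measurable]: "a \<in> borel_measurable borel" using a by auto
  have cg: "convolution a (rep_l2 (scaleC_l2 c u)) = convolution a (\<lambda>y. c * rep_l2 u y)"
    by (rule ext, rule convolution_cong_AE[OF rep_l2_scaleC]) auto
  from rep_conv_l2[OF a, of "scaleC_l2 c u"] rep_conv_l2[OF a, of u] rep_l2_scaleC[of c "conv_l2 a u"]
  show "AE x in lborel. rep_l2 (conv_l2 a (scaleC_l2 c u)) x = rep_l2 (scaleC_l2 c (conv_l2 a u)) x"
    by eventually_elim (simp add: cg, simp add: convolution_def mult.left_commute)
qed

lemma bounded_linear_conv_l2: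
  assumes a: "integrable lborel a"
  shows "bounded_linear (conv_l2 a)"
  by (rule bounded_linear_intro[where K = "LINT x|lborel. cmod (a x)"])
     (use norm_conv_l2[OF a] in \<open>auto simp: conv_l2_add[OF a] scaleR_l2_def conv_l2_scaleC[OF a] mult.commute\<close>)

lemma conv_l2_diff_kernel:
  assumes a: "integrable lborel a" and b: "integrable lborel b"
  shows "conv_l2 (\<lambda>x. a x - b x) u = conv_l2 a u - conv_l2 b u"
proof (rule l2_eqI)
  from rep_conv_l2[OF Bochner_Integration.integrable_diff[OF a b], of u] rep_conv_l2[OF a, of u] rep_conv_l2[OF b, of u]
    rep_l2_diff[of "conv_l2 a u" "conv_l2 b u"] convolution_integrable_AE[OF a rep_l2_in_L2, of u]
    convolution_integrable_AE[OF b rep_l2_in_L2, of u]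
  show "AE x in lborel. rep_l2 (conv_l2 (\<lambda>x. a x - b x) u) x = rep_l2 (conv_l2 a u - conv_l2 b u) x"
    by eventually_elim (simp add: convolution_def left_diff_distrib)
qed

text \<open>Fubini together with \<open>a (x - y) = cnj (a (y - x))\<close>. The exchange needs
  absolute integrability of the double integrand, obtained from Young's inequality and
  Cauchy-Schwarz.\<close>

lemma conv_l2_symmetric:
  fixes u v :: "'n::finite l2"
  assumes "hermitian_L1 a"
  shows "conv_l2 a u \<bullet> v = u \<bullet> conv_l2 a v"
proof -
  have a: "integrable lborel a" and sym: "AE x in lborel. a (- x) = cnj (a x)"
    using assms by (auto simp: hermitian_L1_def)
  have [measurable]: "a \<in> borel_measurable borel" using a by auto
  define f where "f x y = a (x - y) * rep_l2 u y * cnj (rep_l2 v x)" for x y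
  have [measurable]: "case_prod f \<in> borel_measurable (lborel \<Otimes>\<^sub>M lborel)"
    unfolding f_def[abs_def] by measurable
  have "(\<integral>\<^sup>+z. ennreal (norm (case_prod f z)) \<partial>(lborel \<Otimes>\<^sub>M lborel)) = (\<integral>\<^sup>+x. (\<integral>\<^sup>+y. ennreal (norm (f x y)) \<partial>lborel) \<partial>lborel)"
    by (subst lborel.nn_integral_fst[symmetric]) (simp_all add: case_prod_beta')
  also have "\<dots> = (\<integral>\<^sup>+x. abs_conv a (rep_l2 u) x * ennreal (cmod (rep_l2 v x)) \<partial>lborel)"
  proof (intro nn_integral_cong)
    fix x
    show "(\<integral>\<^sup>+y. ennreal (norm (f x y)) \<partial>lborel) = abs_conv a (rep_l2 u) x * ennreal (cmod (rep_l2 v x))"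
      unfolding abs_conv_def f_def
      by (subst nn_integral_multc[symmetric]) (auto simp: norm_mult ennreal_mult)
  qed
  finally have eq: "(\<integral>\<^sup>+z. ennreal (norm (case_prod f z)) \<partial>(lborel \<Otimes>\<^sub>M lborel)) =
    (\<integral>\<^sup>+x. abs_conv a (rep_l2 u) x * ennreal (cmod (rep_l2 v x)) \<partial>lborel)" .
  have "(\<integral>\<^sup>+x. abs_conv a (rep_l2 u) x * ennreal (cmod (rep_l2 v x)) \<partial>lborel)\<^sup>2 \<le>
      (\<integral>\<^sup>+x. (abs_conv a (rep_l2 u) x)\<^sup>2 \<partial>lborel) * (\<integral>\<^sup>+x. (ennreal (cmod (rep_l2 v x)))\<^sup>2 \<partial>lborel)"
    by (rule Cauchy_Schwarz_nn_integral) measurable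
  also have "\<dots> \<le> (ennreal ((LINT x|lborel. cmod (a x))\<^sup>2) * ennreal ((norm u)\<^sup>2)) * ennreal ((norm v)\<^sup>2)"
    using nn_integral_abs_conv_square[OF a, of "rep_l2 u"]
    by (simp add: nn_integral_l2 ennreal_power mult_right_mono)
  also have "\<dots> < \<infinity>" by (simp add: ennreal_mult_less_top)
  finally have "(\<integral>\<^sup>+x. abs_conv a (rep_l2 u) x * ennreal (cmod (rep_l2 v x)) \<partial>lborel) < \<infinity>"
    by (auto simp: power2_eq_square ennreal_mult_less_top)
  hence int: "integrable (lborel \<Otimes>\<^sub>M lborel) (case_prod f)"
    by (intro integrableI_bounded) (simp_all add: eq)
  have "(LINT x|lborel. rep_l2 (conv_l2 a u) x * cnj (rep_l2 v x)) = (LINT x|lborel. (LINT y|lborel. f x y))"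
  proof (rule integral_cong_AE)
    show "AE x in lborel. rep_l2 (conv_l2 a u) x * cnj (rep_l2 v x) = (LINT y|lborel. f x y)"
      using rep_conv_l2[OF a, of u] by eventually_elim (simp add: f_def convolution_def)
  qed measurable
  also have "\<dots> = (LINT y|lborel. (LINT x|lborel. f x y))"
    by (rule lborel_pair.Fubini_integral[OF int, symmetric])
  also have "\<dots> = (LINT y|lborel. rep_l2 u y * cnj (rep_l2 (conv_l2 a v) y))"
  proof (rule integral_cong_AE)
    have *: "(LINT x|lborel. f x y) = rep_l2 u y * cnj (convolution a (rep_l2 v) y)" for y
    proof -
      \<comment> \<open>The symmetry of \<open>a\<close> holds off a null set; the reflection
        \<open>x \<mapsto> y - x\<close> carries it to almost every \<open>x\<close>, for each fixed
        \<open>y\<close>.\<close>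
      have ae: "AE x in lborel. a (x - y) = cnj (a (y - x))"
        using AE_reflect[OF _ sym, of y] by simp
      have "(LINT x|lborel. f x y) = (LINT x|lborel. rep_l2 u y * cnj (a (y - x) * rep_l2 v x))"
        unfolding f_def
        by (rule integral_cong_AE) (measurable, use ae in \<open>eventually_elim, simp\<close>)
      also have "\<dots> = rep_l2 u y * (LINT x|lborel. cnj (a (y - x) * rep_l2 v x))"
        by (rule Bochner_Integration.integral_mult_right_zero)
      finally show ?thesis unfolding convolution_def by (subst (asm) Bochner_Integration.integral_cnj)
    qed
    show "AE y in lborel. (LINT x|lborel. f x y) = rep_l2 u y * cnj (rep_l2 (conv_l2 a v) y)"
      using rep_conv_l2[OF a, of v] by eventually_elim (simp add: *)
    show "(\<lambda>y. LINT x|lborel. f x y) \<in> borel_measurable lborel"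
      unfolding * by measurable
  qed measurable
  finally show ?thesis by (simp add: inner_l2_def)
qed

section \<open>Approximation in the mean and compactness\<close>

lemma integrable_indicator_compact:
  fixes S :: "'a::euclidean_space set"
  assumes "compact S"
  shows "integrable lborel (indicator S :: 'a \<Rightarrow> real)"
  using assms emeasure_bounded_finite[OF compact_imp_bounded[OF assms]]
  by (simp add: compact_imp_closed)

text \<open>Regularity gives a compact \<open>K\<close> inside \<open>A\<close> and an open
  \<open>U\<close> around \<open>K\<close>, each costing \<open>e/2\<close>. A tent function that is
  1 on \<open>K\<close> and 0 off a small neighbourhood differs from the indicator only on
  \<open>A - K\<close> and \<open>U - K\<close>.\<close>

lemma indicator_approx_continuous:
  fixes A :: "'a::euclidean_space set"
  assumes A: "A \<in> sets borel" "emeasure lborel A < \<infinity>" and O: "open \<Omega>" "A \<subseteq> \<Omega>" and e: "e > 0"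
  obtains g :: "'a \<Rightarrow> real" and L where "continuous_on UNIV g" "compact L" "L \<subseteq> \<Omega>" "\<And>x. x \<notin> L \<Longrightarrow> g x = 0"
    "integrable lborel g" "(LINT x|lborel. \<bar>indicator A x - g x\<bar>) < e"
proof -
  \<comment> \<open>Restricting Lebesgue measure to \<open>A\<close> yields a finite measure, as
    inner regularity requires.\<close>
  define M where "M = density lborel (indicator A :: 'a \<Rightarrow> ennreal)"
  have M: "emeasure M B = emeasure lborel (A \<inter> B)" if "B \<in> sets borel" for B
    using A(1) that unfolding M_def by (simp add: emeasure_density indicator_inter_arith[symmetric])
  have sM: "sets M = sets borel" "space M = UNIV" by (simp_all add: M_def)
  have "emeasure lborel A = emeasure M A" using M[OF A(1)] by simp
  also have "\<dots> = (SUP K \<in> {K. K \<subseteq> A \<and> compact K}. emeasure M K)"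
    by (rule inner_regular) (use sM M[of UNIV] A in auto)
  finally have sup: "emeasure lborel A = (SUP K \<in> {K. K \<subseteq> A \<and> compact K}. emeasure M K)" .
  obtain K where K: "K \<subseteq> A" "compact K" "emeasure lborel A < emeasure M K + ennreal (e/2)"
  proof (cases "emeasure lborel A = 0")
    case True
    thus ?thesis using that[of "{}"] e by simp
  next
    case False
    have "emeasure lborel A - ennreal (e/2) < emeasure lborel A"
      using False A(2) e by (intro ennreal_between) (auto simp: zero_less_iff_neq_zero)
    also have "\<dots> = (SUP K \<in> {K. K \<subseteq> A \<and> compact K}. emeasure M K)" by (rule sup)
    finally obtain K where "K \<subseteq> A" "compact K" "emeasure lborel A - ennreal (e/2) < emeasure M K"
      unfolding less_SUP_iff by auto
    moreover from this have "emeasure lborel A < emeasure M K + ennreal (e/2)"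
    \<comment> \<open>Subtraction in \<open>ennreal\<close> is truncated at 0; when
      \<open>e/2\<close> exceeds the measure of \<open>A\<close> the claim is immediate.\<close>
    proof (cases "ennreal (e/2) \<le> emeasure lborel A")
      case False
      hence "emeasure lborel A < 0 + ennreal (e/2)" by simp
      also have "\<dots> \<le> emeasure M K + ennreal (e/2)" by (intro add_right_mono) simp
      finally show ?thesis .
    qed (simp add: minus_less_iff_ennreal)
    ultimately show ?thesis using that by blast
  qed
  have Kb: "K \<in> sets borel" using K(2) by (simp add: compact_imp_closed)
  have eK: "emeasure M K = emeasure lborel K" using M[OF Kb] K(1) by (simp add: inf.absorb2)
  have Kfin: "emeasure lborel K < \<infinity>" using emeasure_mono[OF K(1), of lborel] A by (auto simp: less_top)
  have AK: "emeasure lborel (A - K) \<le> ennreal (e/2)"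
    using K(1,3) Kb A(1) Kfin unfolding eK
    by (subst emeasure_Diff) (auto simp: ennreal_minus_le_iff intro: less_imp_le)
  obtain U where U: "open U" "K \<subseteq> U" "emeasure lborel (U - K) < ennreal (e/2)"
    using outer_regular_lborel[OF Kb, of "e/2"] e by auto
  show ?thesis
  proof (cases "K = {}")
    case True
    show ?thesis
    proof (rule that[of "\<lambda>_. 0" "{}"])
      have "(LINT x|lborel. \<bar>indicator A x - 0\<bar>) = measure lborel A" by simp
      also have "\<dots> \<le> e/2" unfolding measure_def by (rule enn2real_leI) (use AK True e in auto)
      finally show "(LINT x|lborel. \<bar>indicator A x - 0\<bar>) < e" using e by linarith
    qed auto
  next
    case False
    have "open (U \<inter> \<Omega>)" "K \<subseteq> U \<inter> \<Omega>" using U O K by auto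
    then obtain d where d: "d > 0" "{x. infdist x K \<le> d} \<subseteq> U \<inter> \<Omega>"
      using compact_in_open_separated[OF False K(2)] by metis
    define L where "L = {x. infdist x K \<le> d}"
    define g where "g x = max 0 (1 - infdist x K / d)" for x
    have L: "compact L" unfolding L_def using compact_infdist_le[OF False K(2) d(1)] .
    have gc: "continuous_on UNIV g" unfolding g_def[abs_def] by (intro continuous_intros) (use d in auto)
    have [measurable]: "g \<in> borel_measurable borel" by (rule borel_measurable_continuous_onI[OF gc])
    have gL: "g x = 0" if "x \<notin> L" for x using that d by (simp add: g_def L_def field_simps)
    have gK: "g x = 1" if "x \<in> K" for x using that by (simp add: g_def)
    have g01: "0 \<le> g x" "g x \<le> 1" for x using d by (simp_all add: g_def infdist_nonneg)
    have [measurable]: "A \<in> sets borel" "K \<in> sets borel" "U \<in> sets borel" "L \<in> sets borel"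
      using A Kb U L by (auto simp: compact_imp_closed)
    have gint: "integrable lborel g"
    proof (rule Bochner_Integration.integrable_bound)
      show "integrable lborel (indicator L :: 'a \<Rightarrow> real)"
        by (rule integrable_indicator_compact[OF L])
      show "AE x in lborel. norm (g x) \<le> norm (indicator L x :: real)"
        using gL g01 by (auto simp: indicator_def)
    qed simp
    show ?thesis
    proof (rule that[OF gc L _ gL gint])
      show "L \<subseteq> \<Omega>" using d unfolding L_def by auto
      have int: "integrable lborel (indicator (A - K) :: 'a \<Rightarrow> real)" "integrable lborel (indicator (U - K) :: 'a \<Rightarrow> real)"
      proof -
        have "emeasure lborel (A - K) < \<infinity>" "emeasure lborel (U - K) < \<infinity>"
          using AK U(3) by (auto intro: le_less_trans less_trans)
        thus "integrable lborel (indicator (A - K) :: 'a \<Rightarrow> real)" "integrable lborel (indicator (U - K) :: 'a \<Rightarrow> real)"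
          by simp_all
      qed
      have "(LINT x|lborel. \<bar>indicator A x - g x\<bar>) \<le> (LINT x|lborel. indicator (A - K) x + indicator (U - K) x)"
      proof (rule integral_mono)
        show "integrable lborel (\<lambda>x. \<bar>indicator A x - g x\<bar>)"
          using A gint by (intro Bochner_Integration.integrable_abs Bochner_Integration.integrable_diff) auto
        show "integrable lborel (\<lambda>x. indicator (A - K) x + indicator (U - K) x :: real)"
          using int by (intro Bochner_Integration.integrable_add)
        fix x
        have "x \<notin> U \<Longrightarrow> g x = 0" using gL d unfolding L_def by blast
        thus "\<bar>indicator A x - g x\<bar> \<le> indicator (A - K) x + indicator (U - K) x"
          using gK[of x] g01[of x] K(1) U(2) by (auto simp: indicator_def)
      qed
      also have "\<dots> = measure lborel (A - K) + measure lborel (U - K)"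
        by (subst Bochner_Integration.integral_add[OF int]) simp
      also have "\<dots> < e/2 + e/2"
      proof (rule add_le_less_mono)
        show "measure lborel (A - K) \<le> e/2" unfolding measure_def by (rule enn2real_leI) (use AK e in auto)
        show "measure lborel (U - K) < e/2"
          using U(3) e unfolding measure_def by (metis enn2real_less_iff ennreal_less_top half_gt_zero less_imp_le order_less_trans zero_less_divide_iff zero_less_numeral)
      qed
      finally show "(LINT x|lborel. \<bar>indicator A x - g x\<bar>) < e" by simp
    qed
  qed
qed

text \<open>The prescribed open set matters: for the interior of a cube it yields approximants that
  descend continuously to the torus, for \<open>UNIV\<close> it is plain density.\<close>

lemma L1_approx_continuous:
  fixes f :: "'a::euclidean_space \<Rightarrow> complex"
  assumes "integrable lborel f" "open \<Omega>" "e > 0"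
  shows "\<exists>g L. continuous_on UNIV g \<and> compact L \<and> L \<subseteq> \<Omega> \<and> (\<forall>x. x \<notin> L \<longrightarrow> g x = 0) \<and>
    integrable lborel g \<and> (LINT x|lborel. cmod (indicator \<Omega> x *\<^sub>R f x - g x)) < e"
  using assms(1,3)
proof (induction f arbitrary: e rule: integrable_induct)
  case (base A c)
  define A' where "A' = A \<inter> \<Omega>"
  have A': "A' \<in> sets borel" "A' \<subseteq> \<Omega>" using base assms(2) by (auto simp: A'_def)
  have fin: "emeasure lborel A' < \<infinity>"
    using emeasure_mono[of A' A lborel] base by (auto simp: A'_def less_top)
  \<comment> \<open>The summand 1 guards against \<open>c = 0\<close>.\<close>
  have pos: "e / (cmod c + 1) > 0" using base by (intro divide_pos_pos add_nonneg_pos) auto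
  obtain g :: "'a \<Rightarrow> real" and L where g: "continuous_on UNIV g" "compact L" "L \<subseteq> \<Omega>" "\<And>x. x \<notin> L \<Longrightarrow> g x = 0"
    "integrable lborel g" "(LINT x|lborel. \<bar>indicator A' x - g x\<bar>) < e / (cmod c + 1)"
    using indicator_approx_continuous[OF A'(1) fin assms(2) A'(2) pos] by blast
  show ?case
  proof (intro exI[of _ "\<lambda>x. g x *\<^sub>R c"] exI[of _ L] conjI)
    have eq: "cmod (indicator \<Omega> x *\<^sub>R (indicator A x *\<^sub>R c) - g x *\<^sub>R c) = cmod c * \<bar>indicator A' x - g x\<bar>" for x
    proof -
      have "indicator \<Omega> x *\<^sub>R (indicator A x *\<^sub>R c) - g x *\<^sub>R c = (indicator A' x - g x) *\<^sub>R c"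
        by (auto simp: A'_def indicator_def scaleR_diff_left)
      thus ?thesis by (simp only: norm_scaleR mult.commute)
    qed
    have "(LINT x|lborel. cmod (indicator \<Omega> x *\<^sub>R (indicator A x *\<^sub>R c) - g x *\<^sub>R c)) = cmod c * (LINT x|lborel. \<bar>indicator A' x - g x\<bar>)"
      unfolding eq by simp
    also have "\<dots> \<le> cmod c * (e / (cmod c + 1))" using g(6) by (intro mult_left_mono) auto
    also have "\<dots> < e"
    proof -
      have "cmod c / (cmod c + 1) < 1" by (simp add: add_nonneg_pos)
      from mult_strict_left_mono[OF this \<open>e > 0\<close>] show ?thesis by (simp add: mult.commute)
    qed
    finally show "(LINT x|lborel. cmod (indicator \<Omega> x *\<^sub>R (indicator A x *\<^sub>R c) - g x *\<^sub>R c)) < e" .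
  qed (use g in \<open>auto intro!: continuous_intros\<close>)
next
  case (add f1 f2)
  have e2: "e/2 > 0" using add.prems by simp
  obtain g1 L1 where 1: "continuous_on UNIV g1" "compact L1" "L1 \<subseteq> \<Omega>" "\<forall>x. x \<notin> L1 \<longrightarrow> g1 x = 0" "integrable lborel g1"
    "(LINT x|lborel. cmod (indicator \<Omega> x *\<^sub>R f1 x - g1 x)) < e/2"
    using add.IH(1)[OF e2] by blast
  obtain g2 L2 where 2: "continuous_on UNIV g2" "compact L2" "L2 \<subseteq> \<Omega>" "\<forall>x. x \<notin> L2 \<longrightarrow> g2 x = 0" "integrable lborel g2"
    "(LINT x|lborel. cmod (indicator \<Omega> x *\<^sub>R f2 x - g2 x)) < e/2"
    using add.IH(2)[OF e2] by blast
  have i: "integrable lborel (\<lambda>x. indicator \<Omega> x *\<^sub>R f1 x - g1 x)" "integrable lborel (\<lambda>x. indicator \<Omega> x *\<^sub>R f2 x - g2 x)"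
    using add.hyps 1 2 assms(2)
    by (auto intro!: Bochner_Integration.integrable_diff integrable_mult_indicator)
  have "(LINT x|lborel. cmod (indicator \<Omega> x *\<^sub>R (f1 x + f2 x) - (g1 x + g2 x))) \<le>
     (LINT x|lborel. cmod (indicator \<Omega> x *\<^sub>R f1 x - g1 x) + cmod (indicator \<Omega> x *\<^sub>R f2 x - g2 x))"
  proof (rule integral_mono)
    show "integrable lborel (\<lambda>x. cmod (indicator \<Omega> x *\<^sub>R (f1 x + f2 x) - (g1 x + g2 x)))"
      using Bochner_Integration.integrable_norm[OF Bochner_Integration.integrable_add[OF i]]
      by (simp add: algebra_simps)
    show "integrable lborel (\<lambda>x. cmod (indicator \<Omega> x *\<^sub>R f1 x - g1 x) + cmod (indicator \<Omega> x *\<^sub>R f2 x - g2 x))"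
      using i by (intro Bochner_Integration.integrable_add Bochner_Integration.integrable_norm)
    fix x
    have "indicator \<Omega> x *\<^sub>R (f1 x + f2 x) - (g1 x + g2 x) = (indicator \<Omega> x *\<^sub>R f1 x - g1 x) + (indicator \<Omega> x *\<^sub>R f2 x - g2 x)"
      by (simp add: algebra_simps)
    thus "cmod (indicator \<Omega> x *\<^sub>R (f1 x + f2 x) - (g1 x + g2 x)) \<le> cmod (indicator \<Omega> x *\<^sub>R f1 x - g1 x) + cmod (indicator \<Omega> x *\<^sub>R f2 x - g2 x)"
      by (simp only: norm_triangle_ineq)
  qed
  also have "\<dots> < e"
    using 1(6) 2(6) i by (subst Bochner_Integration.integral_add) auto
  finally show ?case
    using 1 2 by (intro exI[of _ "\<lambda>x. g1 x + g2 x"] exI[of _ "L1 \<union> L2"]) (auto intro!: continuous_intros)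
next
  case (lim f s)
  have i: "integrable lborel (\<lambda>x. indicator \<Omega> x *\<^sub>R f x)" "\<And>i. integrable lborel (\<lambda>x. indicator \<Omega> x *\<^sub>R s i x)"
    using lim.hyps assms(2) by (auto intro!: integrable_mult_indicator)
  have "(\<lambda>i. LINT x|lborel. cmod (f x - s i x)) \<longlonglongrightarrow> (LINT x|(lborel :: 'a measure). 0)"
  proof (rule integral_dominated_convergence[where w = "\<lambda>x. 3 * cmod (f x)"])
    show "AE x in lborel. (\<lambda>i. cmod (f x - s i x)) \<longlonglongrightarrow> 0"
    proof (rule AE_I2)
      fix x :: 'a
      have "(\<lambda>i. f x - s i x) \<longlonglongrightarrow> f x - f x" by (intro tendsto_intros lim.hyps) simp
      thus "(\<lambda>i. cmod (f x - s i x)) \<longlonglongrightarrow> 0" by (simp add: tendsto_norm_zero_iff)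
    qed
    show "AE x in lborel. norm (cmod (f x - s i x)) \<le> 3 * cmod (f x)" for i
    proof (rule AE_I2)
      fix x :: 'a
      have "cmod (f x - s i x) \<le> cmod (f x) + cmod (s i x)" by (rule norm_triangle_ineq4)
      moreover have "cmod (s i x) \<le> 2 * cmod (f x)" by (rule lim.hyps) simp
      ultimately show "norm (cmod (f x - s i x)) \<le> 3 * cmod (f x)" by simp
    qed
  qed (use lim.hyps in auto)
  hence "\<forall>\<^sub>F i in sequentially. (LINT x|lborel. cmod (f x - s i x)) < e/2"
    using lim.prems by (intro order_tendstoD(2)) auto
  then obtain n where n: "(LINT x|lborel. cmod (f x - s n x)) < e/2" by (auto simp: eventually_sequentially)
  have e2: "e/2 > 0" using lim.prems by simp
  obtain g L where g: "continuous_on UNIV g" "compact L" "L \<subseteq> \<Omega>" "\<forall>x. x \<notin> L \<longrightarrow> g x = 0" "integrable lborel g"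
    "(LINT x|lborel. cmod (indicator \<Omega> x *\<^sub>R s n x - g x)) < e/2"
    using lim.IH[OF e2, of n] by blast
  have "(LINT x|lborel. cmod (indicator \<Omega> x *\<^sub>R f x - g x)) \<le>
     (LINT x|lborel. cmod (f x - s n x) + cmod (indicator \<Omega> x *\<^sub>R s n x - g x))"
  proof (rule integral_mono)
    fix x
    have "indicator \<Omega> x *\<^sub>R f x - g x = indicator \<Omega> x *\<^sub>R (f x - s n x) + (indicator \<Omega> x *\<^sub>R s n x - g x)"
      by (simp add: algebra_simps)
    hence "cmod (indicator \<Omega> x *\<^sub>R f x - g x) \<le> cmod (indicator \<Omega> x *\<^sub>R (f x - s n x)) + cmod (indicator \<Omega> x *\<^sub>R s n x - g x)"
      by (simp only: norm_triangle_ineq)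
    also have "cmod (indicator \<Omega> x *\<^sub>R (f x - s n x)) \<le> cmod (f x - s n x)"
      by (simp add: indicator_def)
    finally show "cmod (indicator \<Omega> x *\<^sub>R f x - g x) \<le> cmod (f x - s n x) + cmod (indicator \<Omega> x *\<^sub>R s n x - g x)" by simp
  qed (use i g lim.hyps in \<open>auto intro!: Bochner_Integration.integrable_add Bochner_Integration.integrable_norm Bochner_Integration.integrable_diff\<close>)
  also have "\<dots> < e"
    using n g i lim.hyps by (subst Bochner_Integration.integral_add) auto
  finally show ?case using g by blast
qed

lemma compactly_supported_uniformly_continuous:
  fixes g :: "'a::euclidean_space \<Rightarrow> complex"
  assumes "continuous_on UNIV g" "compact L" "\<And>x. x \<notin> L \<Longrightarrow> g x = 0" "e > 0"
  obtains d where "d > 0" "\<And>x y. dist x y < d \<Longrightarrow> cmod (g x - g y) < e"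
proof -
  obtain R where R: "\<And>x. x \<in> L \<Longrightarrow> norm x \<le> R"
    using compact_imp_bounded[OF assms(2)] unfolding bounded_iff by blast
  have "uniformly_continuous_on (cball 0 (R + 1)) g"
    by (rule compact_uniformly_continuous) (use assms in \<open>auto intro: continuous_on_subset\<close>)
  then obtain d where d: "d > 0" "\<And>x y. x \<in> cball 0 (R+1) \<Longrightarrow> y \<in> cball 0 (R+1) \<Longrightarrow> dist x y < d \<Longrightarrow> dist (g x) (g y) < e"
    using assms(4) unfolding uniformly_continuous_on_def by (metis dist_commute)
  show ?thesis
  \<comment> \<open>Capping the distance at 1 ensures that if one point leaves the ball of radius
    \<open>R + 1\<close>, both lie outside the ball of radius \<open>R\<close>, where
    \<open>g\<close> vanishes.\<close>
  proof (rule that[of "min d 1"])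
    fix x y :: 'a assume xy: "dist x y < min d 1"
    show "cmod (g x - g y) < e"
    proof (cases "x \<in> cball 0 (R+1) \<and> y \<in> cball 0 (R+1)")
      case True
      thus ?thesis using d(2)[of x y] xy by (auto simp: dist_norm)
    next
      case False
      have "norm x \<le> norm y + dist x y" "norm y \<le> norm x + dist x y"
        using norm_triangle_sub[of x y] norm_triangle_sub[of y x] by (auto simp: dist_norm norm_minus_commute)
      hence "norm x > R \<and> norm y > R" using False xy by auto
      hence "x \<notin> L" "y \<notin> L" using R[of x] R[of y] by linarith+
      thus ?thesis using assms by simp
    qed
  qed (use d in auto)
qed

section \<open>Decay of Fourier transforms at infinity\<close>

lemma integrable_fourier_integrand:
  assumes "integrable lborel u"
  shows "integrable lborel (\<lambda>\<xi>. u \<xi> * exp (- (\<i> * of_real (x \<bullet> \<xi>))))"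
proof (rule Bochner_Integration.integrable_bound[OF assms])
  have [measurable]: "u \<in> borel_measurable borel" using assms by auto
  have [measurable]: "(\<lambda>\<xi>. exp (- (\<i> * of_real (x \<bullet> \<xi>)))) \<in> borel_measurable borel"
    by (intro borel_measurable_continuous_onI continuous_intros)
  show "(\<lambda>\<xi>. u \<xi> * exp (- (\<i> * of_real (x \<bullet> \<xi>)))) \<in> borel_measurable lborel" by simp
qed (simp add: norm_mult)

lemma norm_fourier_le:
  assumes "integrable lborel u"
  shows "cmod (fourier u x) \<le> (LINT \<xi>|lborel. cmod (u \<xi>))"
  unfolding fourier_def
  using integral_norm_bound[of lborel "\<lambda>\<xi>. u \<xi> * exp (- (\<i> * of_real (x \<bullet> \<xi>)))"]
  by (simp add: norm_mult)

lemma fourier_diff: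
  assumes "integrable lborel u" "integrable lborel v"
  shows "fourier (\<lambda>\<xi>. u \<xi> - v \<xi>) x = fourier u x - fourier v x"
  unfolding fourier_def left_diff_distrib
  by (rule Bochner_Integration.integral_diff) (intro integrable_fourier_integrand assms)+

lemma measurable_fourier:
  assumes "integrable lborel u"
  shows "fourier u \<in> borel_measurable borel"
proof -
  have [measurable]: "u \<in> borel_measurable borel" using assms by auto
  have [measurable]: "(\<lambda>z::complex. exp z) \<in> borel_measurable borel"
    by (intro borel_measurable_continuous_onI continuous_intros)
  have "(\<lambda>x. LINT \<xi>|lborel. u \<xi> * exp (- (\<i> * of_real (x \<bullet> \<xi>)))) \<in> borel_measurable lborel"
    by (rule lborel.borel_measurable_lebesgue_integral) measurable
  thus ?thesis unfolding fourier_def[abs_def] by simp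
qed

text \<open>Translating by \<open>t = \<pi> x / |x|\<^sup>2\<close> flips the sign of the exponential.\<close>

lemma fourier_half_period:
  assumes "integrable lborel g" "x \<noteq> 0" and t: "t = (pi / (norm x)\<^sup>2) *\<^sub>R x"
  shows "2 * fourier g x = (LINT \<xi>|lborel. (g \<xi> - g (\<xi> + t)) * exp (- (\<i> * of_real (x \<bullet> \<xi>))))"
proof -
  have xt: "x \<bullet> t = pi" using assms(2) by (simp add: t power2_norm_eq_inner)
  have [measurable]: "g \<in> borel_measurable borel" using assms by auto
  have gt: "integrable lborel (\<lambda>\<xi>. g (\<xi> + t))"
  proof -
    have "integrable (distr lborel borel ((+) t)) g" using assms by (simp add: lborel_distr_plus)
    thus ?thesis by (subst (asm) integrable_distr_eq) (auto simp: add.commute)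
  qed
  have [measurable]: "(\<lambda>\<xi>. exp (- (\<i> * of_real (x \<bullet> \<xi>)))) \<in> borel_measurable borel"
    by (intro borel_measurable_continuous_onI continuous_intros)
  have "fourier g x = (LINT \<xi>|lborel. g (\<xi> + t) * exp (- (\<i> * of_real (x \<bullet> (\<xi> + t)))))"
    unfolding fourier_def
    by (rule integral_translate[symmetric]) measurable
  also have "\<dots> = (LINT \<xi>|lborel. - (g (\<xi> + t) * exp (- (\<i> * of_real (x \<bullet> \<xi>)))))"
  proof (rule Bochner_Integration.integral_cong[OF refl])
    fix \<xi>
    have "- (\<i> * of_real (x \<bullet> (\<xi> + t))) = - (\<i> * of_real (x \<bullet> \<xi>)) + - (\<i> * of_real pi)"
      by (simp add: inner_add_right xt algebra_simps)
    hence "exp (- (\<i> * of_real (x \<bullet> (\<xi> + t)))) = exp (- (\<i> * of_real (x \<bullet> \<xi>))) * exp (- (\<i> * of_real pi))"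
      by (simp only: exp_add)
    also have "exp (- (\<i> * of_real pi)) = -1" by (simp add: exp_minus)
    finally show "g (\<xi> + t) * exp (- (\<i> * of_real (x \<bullet> (\<xi> + t)))) = - (g (\<xi> + t) * exp (- (\<i> * of_real (x \<bullet> \<xi>))))"
      by simp
  qed
  finally have 1: "fourier g x = - (LINT \<xi>|lborel. g (\<xi> + t) * exp (- (\<i> * of_real (x \<bullet> \<xi>))))" by simp
  have "2 * fourier g x = fourier g x + fourier g x" by simp
  also have "\<dots> = (LINT \<xi>|lborel. g \<xi> * exp (- (\<i> * of_real (x \<bullet> \<xi>)))) - (LINT \<xi>|lborel. g (\<xi> + t) * exp (- (\<i> * of_real (x \<bullet> \<xi>))))"
    by (subst (2) 1) (simp add: fourier_def)
  also have "\<dots> = (LINT \<xi>|lborel. (g \<xi> - g (\<xi> + t)) * exp (- (\<i> * of_real (x \<bullet> \<xi>))))"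
    unfolding left_diff_distrib
    by (rule Bochner_Integration.integral_diff[symmetric]) (intro integrable_fourier_integrand assms gt)+
  finally show ?thesis .
qed

text \<open>For a continuous approximant of compact support the half-period shift has length
  \<open>pi / norm x\<close>, so uniform continuity makes \<open>g \<xi> - g (\<xi> + t)\<close>
  small on a fixed ball for large \<open>x\<close>. The approximation error is handled by the
  trivial \<open>L1\<close> bound.\<close>

lemma Riemann_Lebesgue:
  fixes u :: "real ^ 'n \<Rightarrow> complex"
  assumes u: "integrable lborel u" and e: "e > 0"
  shows "\<exists>R. \<forall>x. R \<le> norm x \<longrightarrow> cmod (fourier u x) < e"
proof -
  have e2: "e/2 > 0" using e by simp
  obtain g L where g: "continuous_on UNIV g" "compact L" "\<And>x. x \<notin> L \<Longrightarrow> g x = 0" "integrable lborel g"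
    "(LINT x|lborel. cmod (u x - g x)) < e/2"
    using L1_approx_continuous[OF u open_UNIV e2] by auto
  obtain R where R: "\<And>x. x \<in> L \<Longrightarrow> norm x \<le> R"
    using compact_imp_bounded[OF g(2)] unfolding bounded_iff by blast
  \<comment> \<open>Enlarged by 1 so as to contain the support of the shifted function as well, once
    \<open>norm t \<le> 1\<close>.\<close>
  define B where "B = cball (0 :: real ^ 'n) (R + 1)"
  define m where "m = measure lborel B"
  have m: "m \<ge> 0" by (simp add: m_def)
  have "e / (m + 1) > 0" using e m by simp
  then obtain d where d: "d > 0" "\<And>x y. dist x y < d \<Longrightarrow> cmod (g x - g y) < e / (m + 1)"
    using compactly_supported_uniformly_continuous[OF g(1-3)] by metis
  show ?thesis
  \<comment> \<open>The three bounds serve in turn for \<open>x \<noteq> 0\<close>,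
    \<open>norm t \<le> 1\<close> and \<open>norm t < d\<close>.\<close>
  proof (intro exI[of _ "max 1 (max (2 * pi) (2 * pi / d))"] allI impI)
    fix x :: "real ^ 'n" assume "max 1 (max (2 * pi) (2 * pi / d)) \<le> norm x"
    hence x: "norm x \<ge> 1" "norm x \<ge> 2 * pi" "norm x \<ge> 2 * pi / d" by auto
    define t where "t = (pi / (norm x)\<^sup>2) *\<^sub>R x"
    have nt: "norm t = pi / norm x" using x(1) by (simp add: t_def power2_eq_square)
    have "0 < norm x" "pi \<le> norm x" using x(1,2) pi_gt_zero by linarith+
    hence t1: "norm t \<le> 1" by (simp add: nt)
    have td: "norm t < d"
    proof -
      have "2 * pi \<le> norm x * d" using x(3) d(1) by (simp add: field_simps)
      hence "pi < norm x * d" using pi_gt_zero by linarith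
      thus ?thesis unfolding nt using \<open>0 < norm x\<close> by (simp add: field_simps)
    qed
    have bd: "cmod ((g \<xi> - g (\<xi> + t)) * exp (- (\<i> * of_real (x \<bullet> \<xi>)))) \<le> e / (m + 1) * indicator B \<xi>" for \<xi>
    proof (cases "\<xi> \<in> B")
      case True
      have "cmod (g \<xi> - g (\<xi> + t)) \<le> e / (m + 1)"
        using d(2)[of \<xi> "\<xi> + t"] td by (simp add: dist_norm less_imp_le)
      thus ?thesis using True by (simp add: norm_mult)
    next
      case False
      hence "norm \<xi> > R + 1" by (simp add: B_def)
      moreover have "norm \<xi> \<le> norm (\<xi> + t) + norm t"
        using norm_triangle_ineq4[of "\<xi> + t" t] by simp
      ultimately have "\<xi> \<notin> L" "\<xi> + t \<notin> L" using R[of \<xi>] R[of "\<xi> + t"] t1 by linarith+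
      thus ?thesis using g(3) False by simp
    qed
    have "cmod (2 * fourier g x) \<le> (LINT \<xi>|lborel. cmod ((g \<xi> - g (\<xi> + t)) * exp (- (\<i> * of_real (x \<bullet> \<xi>)))))"
      using \<open>0 < norm x\<close> by (subst fourier_half_period[OF g(4) _ t_def]) (auto intro: integral_norm_bound)
    also have "\<dots> \<le> (LINT \<xi>|lborel. e / (m + 1) * indicator B \<xi>)"
      by (rule Bochner_Integration.integral_mono')
         (use bd e m in \<open>auto simp: B_def simp del: times_divide_eq_left
            intro!: integrable_mult_right integrable_indicator_compact\<close>)
    also have "\<dots> = e / (m + 1) * m" by (simp add: m_def)
    also have "\<dots> < e"
    proof -
      have "m / (m + 1) < 1" using m by simp
      from mult_strict_left_mono[OF this e] show ?thesis by simp
    qed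
    finally have 1: "cmod (fourier g x) < e/2" by (simp add: norm_mult)
    have "cmod (fourier u x - fourier g x) \<le> (LINT x|lborel. cmod (u x - g x))"
      using norm_fourier_le[OF Bochner_Integration.integrable_diff[OF u g(4)], of x] by (simp add: fourier_diff u g)
    hence "cmod (fourier u x - fourier g x) < e/2" using g(5) by linarith
    thus "cmod (fourier u x) < e" using 1 norm_triangle_sub[of "fourier u x" "fourier g x"] by linarith
  qed
qed

section \<open>Compactness of convolutions with a nice kernel, cut off to a ball\<close>

lemma compact_closureI_sequential:
  fixes S :: "'a::metric_space set"
  assumes "\<And>f :: nat \<Rightarrow> 'a. (\<And>n. f n \<in> S) \<Longrightarrow> \<exists>l r. strict_mono (r :: nat \<Rightarrow> nat) \<and> (f \<circ> r) \<longlonglongrightarrow> l"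
  shows "compact (closure S)"
  unfolding compact_eq_seq_compact_metric seq_compact_def
proof (intro allI impI)
  fix f :: "nat \<Rightarrow> 'a" assume f: "\<forall>n. f n \<in> closure S"
  have "\<exists>y\<in>S. dist y (f n) < 1 / real (Suc n)" for n
    using f by (simp add: closure_approachable)
  \<comment> \<open>Replacing each \<open>f n\<close> by a point of \<open>S\<close> within
    \<open>1 / real (Suc n)\<close> leaves the limits of subsequences unchanged.\<close>
  then obtain g where g: "\<And>n. g n \<in> S" "\<And>n. dist (g n) (f n) < 1 / real (Suc n)" by metis
  obtain l r where r: "strict_mono (r :: nat \<Rightarrow> nat)" "(g \<circ> r) \<longlonglongrightarrow> l" using assms[of g, OF g(1)] by blast
  have "(\<lambda>n. dist (g n) (f n)) \<longlonglongrightarrow> 0"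
    by (rule Lim_null_comparison[OF _ LIMSEQ_Suc[OF lim_1_over_n]])
       (use g(2) in \<open>auto intro!: always_eventually less_imp_le\<close>)
  hence "((\<lambda>n. dist (g n) (f n)) \<circ> r) \<longlonglongrightarrow> 0" by (rule LIMSEQ_subseq_LIMSEQ[OF _ r(1)])
  moreover have "(\<lambda>n. dist ((g \<circ> r) n) l) \<longlonglongrightarrow> 0" using r(2) by (subst (asm) tendsto_dist_iff)
  ultimately have "(\<lambda>n. ((\<lambda>n. dist (g n) (f n)) \<circ> r) n + dist ((g \<circ> r) n) l) \<longlonglongrightarrow> 0 + 0"
    by (rule tendsto_add)
  hence 0: "(\<lambda>n. dist (g (r n)) (f (r n)) + dist (g (r n)) l) \<longlonglongrightarrow> 0" by (simp add: o_def)
  have "norm (dist (f (r n)) l) \<le> dist (g (r n)) (f (r n)) + dist (g (r n)) l" for n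
    using dist_triangle[of "f (r n)" l "g (r n)"] by (simp add: dist_commute)
  hence "(\<lambda>n. dist (f (r n)) l) \<longlonglongrightarrow> 0"
    by (intro Lim_null_comparison[OF _ 0] always_eventually allI)
  hence "(f \<circ> r) \<longlonglongrightarrow> l" by (subst tendsto_dist_iff) (simp add: o_def)
  moreover have "l \<in> closure S"
    using r(2) g(1) unfolding closure_sequential by (intro exI[of _ "g \<circ> r"]) auto
  ultimately show "\<exists>l\<in>closure S. \<exists>r. strict_mono r \<and> (f \<circ> r) \<longlonglongrightarrow> l" using r(1) by blast
qed

lemma abs_l2_diff:
  assumes "f \<in> L2" "g \<in> L2"
  shows "abs_l2 f - abs_l2 g = abs_l2 (\<lambda>x. f x - g x)"
  by (rule l2_eqI)
     (use rep_l2_diff[of "abs_l2 f" "abs_l2 g"] rep_abs_l2[OF assms(1)] rep_abs_l2[OF assms(2)]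
        rep_abs_l2[OF L2_diff[OF assms]] in \<open>eventually_elim, simp\<close>)

text \<open>The elementary bound \<open>t \<le> 1 + t\<^sup>2\<close> replaces Cauchy-Schwarz and
  gives an estimate linear in the sup bound \<open>w\<close>. This linearity yields equicontinuity
  when \<open>h\<close> is a difference of two translates of a kernel.\<close>

lemma bounded_support_integral:
  fixes u :: "'n::finite l2" and h :: "real ^ 'n \<Rightarrow> complex"
  assumes h: "h \<in> borel_measurable borel" "\<And>y. cmod (h y) \<le> w" "\<And>y. y \<notin> B \<Longrightarrow> h y = 0"
    and B: "compact B"
  shows "integrable lborel (\<lambda>y. h y * rep_l2 u y)" (is ?int)
    and "cmod (LINT y|lborel. h y * rep_l2 u y) \<le> w * (measure lborel B + (norm u)\<^sup>2)" (is ?bound)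
proof -
  note [measurable] = h(1)
  have w: "0 \<le> w" using h(2) norm_ge_zero order_trans by blast
  have Bint: "integrable lborel (indicator B :: _ \<Rightarrow> real)"
    by (rule integrable_indicator_compact[OF B])
  have int: "integrable lborel (\<lambda>y. w * (indicator B y + (cmod (rep_l2 u y))\<^sup>2))"
    by (intro integrable_mult_right Bochner_Integration.integrable_add Bint L2_integrable rep_l2_in_L2)
  have bd: "cmod (h y * rep_l2 u y) \<le> w * (indicator B y + (cmod (rep_l2 u y))\<^sup>2)" for y
  proof (cases "y \<in> B")
    case True
    have "cmod (rep_l2 u y) \<le> 1 + (cmod (rep_l2 u y))\<^sup>2"
      using norm_mult_le_squares[of 1 "rep_l2 u y"] by simp
    hence "cmod (h y) * cmod (rep_l2 u y) \<le> w * (1 + (cmod (rep_l2 u y))\<^sup>2)"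
      by (intro mult_mono h w) auto
    thus ?thesis using True by (simp add: norm_mult)
  next
    case False
    thus ?thesis using h(3)[OF False] w by simp
  qed
  show ?int
    by (rule Bochner_Integration.integrable_bound[OF int])
       (use bd in \<open>auto intro: order_trans[OF _ abs_ge_self]\<close>)
  have "cmod (LINT y|lborel. h y * rep_l2 u y) \<le> (LINT y|lborel. w * (indicator B y + (cmod (rep_l2 u y))\<^sup>2))"
    by (rule Bochner_Integration.integral_norm_bound_integral[OF \<open>?int\<close> int]) (rule bd)
  also have "\<dots> = w * (measure lborel B + (norm u)\<^sup>2)"
    using Bint by (simp add: norm_l2_square L2_integrable)
  finally show ?bound .
qed

lemma bounded_function_indicator: "S \<in> sets borel \<Longrightarrow> bounded_function (indicator S) 1"
  by unfold_locales (auto simp: indicator_def)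

text \<open>For a continuous kernel of compact support, \<open>a * u\<close> is equicontinuous as \<open>u\<close> ranges over
  the unit ball, so Arzela-Ascoli applies.\<close>

lemma compact_operator_truncated_conv:
  fixes a :: "real ^ 'n::finite \<Rightarrow> complex"
  assumes cont: "continuous_on UNIV a" and L: "compact L" "\<And>x. x \<notin> L \<Longrightarrow> a x = 0"
    and a: "integrable lborel a"
  shows "compact_operator (\<lambda>u. mult_l2 (indicator (cball 0 \<rho>)) (conv_l2 a u))"
proof -
  define S where "S = cball (0 :: real ^ 'n) \<rho>"
  interpret S: bounded_function "indicator S" 1
    by (rule bounded_function_indicator) (simp add: S_def)
  have [measurable]: "a \<in> borel_measurable borel" using a by auto
  obtain R where R: "\<And>x. x \<in> L \<Longrightarrow> norm x \<le> R"
    using compact_imp_bounded[OF L(1)] unfolding bounded_iff by blast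
  \<comment> \<open>For \<open>x\<close> in the cut-off ball only \<open>y\<close> in this larger
    ball can contribute to the convolution.\<close>
  define B where "B = cball (0 :: real ^ 'n) (\<rho> + R)"
  have B: "compact B" by (simp add: B_def)
  have supp: "a (x - y) = 0" if "x \<in> S" "y \<notin> B" for x y
  proof -
    have "norm x \<le> \<rho>" "norm y > \<rho> + R" using that by (auto simp: S_def B_def)
    hence "norm (x - y) > R" using norm_triangle_sub[of y x] by (simp add: norm_minus_commute)
    thus ?thesis using R L(2) by force
  qed
  have aL: "compact (a ` L)" by (rule compact_continuous_image) (use cont L in \<open>auto intro: continuous_on_subset\<close>)
  obtain w where w: "\<And>x. x \<in> L \<Longrightarrow> cmod (a x) \<le> w"
    using compact_imp_bounded[OF aL] unfolding bounded_iff by blast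
  have w': "cmod (a x) \<le> max w 0" for x using w[of x] L(2)[of x] by (cases "x \<in> L") auto
  define m where "m = measure lborel B + 1"
  have m: "m > 0" unfolding m_def by (simp add: add_nonneg_pos)
  have int: "integrable lborel (\<lambda>y. a (x - y) * rep_l2 u y)" if "x \<in> S" for u :: "'n l2" and x
    by (rule bounded_support_integral(1)[OF _ w' supp[OF that] B]) measurable
  have bound: "cmod (convolution a (rep_l2 u) x) \<le> max w 0 * m" if "x \<in> S" "norm u \<le> 1" for u :: "'n l2" and x
  proof -
    have "cmod (convolution a (rep_l2 u) x) \<le> max w 0 * (measure lborel B + (norm u)\<^sup>2)"
      unfolding convolution_def
      by (rule bounded_support_integral(2)[OF _ w' supp[OF that(1)] B]) measurable
    also have "\<dots> \<le> max w 0 * m"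
      unfolding m_def using that(2) by (intro mult_left_mono add_left_mono) (auto simp: power_le_one)
    finally show ?thesis .
  qed
  have equi: "\<exists>d>0. \<forall>u::'n l2. norm u \<le> 1 \<longrightarrow> (\<forall>x\<in>S. \<forall>y\<in>S. norm (x - y) < d \<longrightarrow>
      cmod (convolution a (rep_l2 u) x - convolution a (rep_l2 u) y) < e)" if "e > 0" for e
  proof -
    have "e / (2 * m) > 0" using that m by simp
    then obtain d where d: "d > 0" "\<And>x y. dist x y < d \<Longrightarrow> cmod (a x - a y) < e / (2 * m)"
      using compactly_supported_uniformly_continuous[OF cont L] by metis
    show ?thesis
    proof (intro exI[of _ d] conjI allI impI ballI)
      fix u :: "'n l2" and x y assume u: "norm u \<le> 1" and x: "x \<in> S" and y: "y \<in> S" and xy: "norm (x - y) < d"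
      have "convolution a (rep_l2 u) x - convolution a (rep_l2 u) y = (LINT z|lborel. (a (x - z) - a (y - z)) * rep_l2 u z)"
        unfolding convolution_def left_diff_distrib
        by (rule Bochner_Integration.integral_diff[symmetric]) (rule int x y)+
      also have "cmod \<dots> \<le> e / (2 * m) * (measure lborel B + (norm u)\<^sup>2)"
      proof (rule bounded_support_integral(2)[OF _ _ _ B])
        fix z
        show "cmod (a (x - z) - a (y - z)) \<le> e / (2 * m)"
          using d(2)[of "x - z" "y - z"] xy by (simp add: dist_norm less_imp_le)
        show "z \<notin> B \<Longrightarrow> a (x - z) - a (y - z) = 0" using supp x y by simp
      qed measurable
      also have "\<dots> \<le> e / (2 * m) * m"
        unfolding m_def using u that m by (intro mult_left_mono add_left_mono) (auto simp: power_le_one m_def)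
      also have "\<dots> < e" using m that by simp
      finally show "cmod (convolution a (rep_l2 u) x - convolution a (rep_l2 u) y) < e" .
    qed (rule d)
  qed
  have Tu: "mult_l2 (indicator S) (conv_l2 a u) = abs_l2 (\<lambda>x. indicator S x * convolution a (rep_l2 u) x)" for u
    unfolding conv_l2_def by (rule S.mult_l2_abs[OF convolution_L2[OF a rep_l2_in_L2]])
  have TuL2: "(\<lambda>x. indicator S x * convolution a (rep_l2 u) x) \<in> L2" for u :: "'n l2"
    by (rule L2_bounded_mult[OF convolution_L2[OF a rep_l2_in_L2] S.measurable_g S.bounded_g])
  have "compact (closure ((\<lambda>u. mult_l2 (indicator S) (conv_l2 a u)) ` cball 0 1))"
  proof (rule compact_closureI_sequential)
    fix f assume "\<And>n::nat. f n \<in> (\<lambda>u. mult_l2 (indicator S) (conv_l2 a u)) ` cball 0 1"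
    hence "\<forall>n. \<exists>u. norm u \<le> 1 \<and> f n = mult_l2 (indicator S) (conv_l2 a u)" by (simp add: image_iff Bex_def)
    then obtain u where u: "\<And>n. norm (u n) \<le> 1" "\<And>n. f n = mult_l2 (indicator S) (conv_l2 a (u n))" by metis
    obtain g k where gk: "continuous_on S g" "strict_mono (k :: nat \<Rightarrow> nat)"
      "\<And>e. 0 < e \<Longrightarrow> \<exists>N. \<forall>n x. n \<ge> N \<and> x \<in> S \<longrightarrow> norm (convolution a (rep_l2 (u (k n))) x - g x) < e"
    proof (rule Arzela_Ascoli[of S "\<lambda>n. convolution a (rep_l2 (u n))" "max w 0 * m"])
      show "compact S" by (simp add: S_def)
      show "\<exists>d. 0 < d \<and> (\<forall>n y. y \<in> S \<and> norm (x - y) < d \<longrightarrow>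
          norm (convolution a (rep_l2 (u n)) x - convolution a (rep_l2 (u n)) y) < e)" if "x \<in> S" "0 < e" for x e
        using equi[OF that(2)] that(1) u(1) by blast
    qed (use bound u in auto)
    \<comment> \<open>Arzela-Ascoli controls the limit on \<open>S\<close> only; the indicator makes
      it a function on the whole space.\<close>
    define h where "h x = indicator S x * g x" for x
    have [measurable]: "h \<in> borel_measurable borel"
    proof -
      have "h = (\<lambda>x. indicator S x *\<^sub>R g x)" by (auto simp: h_def indicator_def)
      thus ?thesis using borel_measurable_continuous_on_indicator[of S g] gk(1) by (simp add: S_def)
    qed
    \<comment> \<open>Uniform convergence on \<open>S\<close> gives convergence in the mean because
      \<open>S\<close> has finite measure; the tolerance \<open>sqrt (e\<^sup>2 / q)\<close> makes
      the squared error integrate to at most \<open>e\<^sup>2\<close>.\<close>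
    have diff: "\<exists>N. \<forall>n\<ge>N. (\<lambda>x. indicator S x * convolution a (rep_l2 (u (k n))) x - h x) \<in> L2 \<and>
        norm (abs_l2 (\<lambda>x. indicator S x * convolution a (rep_l2 (u (k n))) x - h x)) \<le> e" if e: "e > 0" for e
    proof -
      define q where "q = measure lborel S + 1"
      have q: "q > 0" unfolding q_def by (simp add: add_nonneg_pos)
      have "sqrt (e\<^sup>2 / q) > 0" using e q by simp
      from gk(3)[OF this] obtain N where
        N: "\<And>n x. n \<ge> N \<Longrightarrow> x \<in> S \<Longrightarrow> cmod (convolution a (rep_l2 (u (k n))) x - g x) < sqrt (e\<^sup>2 / q)" by auto
      have Sint: "integrable lborel (\<lambda>x. e\<^sup>2 / q * indicator S x :: real)"
        by (intro integrable_mult_right) (simp add: S_def integrable_indicator_compact)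
      show ?thesis
      proof (intro exI[of _ N] allI impI)
        fix n assume n: "N \<le> n"
        let ?d = "\<lambda>x. indicator S x * convolution a (rep_l2 (u (k n))) x - h x"
        have bd: "(cmod (?d x))\<^sup>2 \<le> e\<^sup>2 / q * indicator S x" for x
        proof (cases "x \<in> S")
          case True
          have "(cmod (convolution a (rep_l2 (u (k n))) x - g x))\<^sup>2 \<le> (sqrt (e\<^sup>2 / q))\<^sup>2"
            using N[OF n True] by (intro power_mono) auto
          thus ?thesis using True q by (simp add: h_def)
        qed (simp add: h_def)
        have dL2: "?d \<in> L2" by (rule L2_bound[OF _ Sint bd]) measurable
        have "(norm (abs_l2 ?d))\<^sup>2 = (LINT x|lborel. (cmod (?d x))\<^sup>2)" by (rule norm_abs_l2[OF dL2])
        also have "\<dots> \<le> (LINT x|lborel. e\<^sup>2 / q * indicator S x)"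
          by (rule integral_mono[OF L2_integrable[OF dL2] Sint bd])
        also have "\<dots> = e\<^sup>2 / q * measure lborel S" by simp
        also have "\<dots> \<le> e\<^sup>2 / q * q" using q by (intro mult_left_mono) (auto simp: q_def)
        also have "\<dots> = e\<^sup>2" using q by simp
        finally have "norm (abs_l2 ?d) \<le> e" by (rule power2_le_imp_le) (use e in simp)
        thus "?d \<in> L2 \<and> norm (abs_l2 ?d) \<le> e" using dL2 by blast
      qed
    qed
    have hL2: "h \<in> L2"
    proof -
      obtain N where "(\<lambda>x. indicator S x * convolution a (rep_l2 (u (k N))) x - h x) \<in> L2" using diff[of 1] by auto
      from L2_diff[OF TuL2[of "u (k N)"] this] show ?thesis by simp
    qed
    have "(f \<circ> k) \<longlonglongrightarrow> abs_l2 h"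
    proof (rule metric_LIMSEQ_I)
      fix e :: real assume e: "e > 0"
      hence "e/2 > 0" by simp
      from diff[OF this] obtain N where
        N: "\<And>n. n \<ge> N \<Longrightarrow> norm (abs_l2 (\<lambda>x. indicator S x * convolution a (rep_l2 (u (k n))) x - h x)) \<le> e/2" by blast
      show "\<exists>N. \<forall>n\<ge>N. dist ((f \<circ> k) n) (abs_l2 h) < e"
      proof (intro exI[of _ N] allI impI)
        fix n assume n: "N \<le> n"
        have "dist ((f \<circ> k) n) (abs_l2 h) \<le> e/2"
          using N[OF n] by (simp add: dist_norm u(2) Tu abs_l2_diff[OF TuL2 hL2])
        thus "dist ((f \<circ> k) n) (abs_l2 h) < e" using e by linarith
      qed
    qed
    thus "\<exists>l r. strict_mono r \<and> (f \<circ> r) \<longlonglongrightarrow> l" using gk(2) by blast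
  qed
  moreover have "bounded_linear (\<lambda>u. mult_l2 (indicator S) (conv_l2 a u))"
    by (rule bounded_linear_compose[OF S.bounded_linear_mult_l2 bounded_linear_conv_l2[OF a]])
  ultimately show ?thesis unfolding compact_operator_def S_def by blast
qed

lemma L1_approx_compact_support:
  fixes a :: "real ^ 'n \<Rightarrow> complex"
  assumes "integrable lborel a" "e > 0"
  obtains b R where "continuous_on UNIV b" "\<And>x. x \<notin> cball 0 R \<Longrightarrow> b x = 0" "integrable lborel b"
    "(LINT x|lborel. cmod (a x - b x)) < e"
proof -
  obtain b L where b: "continuous_on UNIV b" "compact L" "\<And>x. x \<notin> L \<Longrightarrow> b x = 0" "integrable lborel b"
    "(LINT x|lborel. cmod (a x - b x)) < e"
    using L1_approx_continuous[OF assms(1) open_UNIV assms(2)] by auto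
  obtain R where "\<And>x. x \<in> L \<Longrightarrow> norm x \<le> R"
    using compact_imp_bounded[OF b(2)] unfolding bounded_iff by blast
  hence "b x = 0" if "x \<notin> cball 0 R" for x using b(3)[of x] that by auto
  thus ?thesis using that b by blast
qed

text \<open>Functions supported in balls of radii \<open>R\<close> and \<open>s\<close> have a
  convolution supported in the ball of radius \<open>s + R\<close>. An output cut-off can thus be
  inserted for free, which makes \<open>compact_operator_truncated_conv\<close> applicable.\<close>

lemma conv_l2_indicator_support:
  fixes b :: "real ^ 'n::finite \<Rightarrow> complex"
  assumes b: "integrable lborel b" "\<And>x. x \<notin> cball 0 R \<Longrightarrow> b x = 0"
  shows "mult_l2 (indicator (cball 0 (s + R))) (conv_l2 b (mult_l2 (indicator (cball 0 s)) v)) =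
    conv_l2 b (mult_l2 (indicator (cball 0 s)) v)"
proof (rule l2_eqI)
  interpret A: bounded_function "indicator (cball 0 s)" 1 by (rule bounded_function_indicator) simp
  interpret B: bounded_function "indicator (cball 0 (s + R))" 1 by (rule bounded_function_indicator) simp
  have [measurable]: "b \<in> borel_measurable borel" using b by auto
  define w where "w = mult_l2 (indicator (cball 0 s)) v"
  have cg: "convolution b (rep_l2 w) = convolution b (\<lambda>y. indicator (cball 0 s) y * rep_l2 v y)"
    unfolding w_def by (rule ext, rule convolution_cong_AE[OF A.rep_mult_l2]) measurable
  have z: "convolution b (\<lambda>y. indicator (cball 0 s) y * rep_l2 v y) x = 0" if x: "x \<notin> cball 0 (s + R)" for x
  proof -
    have "b (x - y) * (indicator (cball 0 s) y * rep_l2 v y) = 0" for y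
    proof (cases "y \<in> cball 0 s")
      case True
      hence "norm (x - y) > R" using x norm_triangle_sub[of x y] by auto
      thus ?thesis using b(2)[of "x - y"] by simp
    qed simp
    thus ?thesis by (simp only: convolution_def Bochner_Integration.integral_zero)
  qed
  from B.rep_mult_l2[of "conv_l2 b w"] rep_conv_l2[OF b(1), of w]
  show "AE x in lborel. rep_l2 (mult_l2 (indicator (cball 0 (s + R))) (conv_l2 b (mult_l2 (indicator (cball 0 s)) v))) x =
      rep_l2 (conv_l2 b (mult_l2 (indicator (cball 0 s)) v)) x"
    unfolding w_def[symmetric]
  proof eventually_elim
    case (elim x)
    show ?case
    proof (cases "x \<in> cball 0 (s + R)")
      case False
      hence "rep_l2 (conv_l2 b w) x = 0" unfolding elim(2) cg by (rule z)
      thus ?thesis unfolding elim(1) by simp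
    qed (simp add: elim(1))
  qed
qed

lemma norm_indicator_mult_le: "norm (mult_l2 (indicator (cball 0 R)) u) \<le> norm u"
  using bounded_function.norm_mult_l2[OF bounded_function_indicator, of "cball 0 R" u] by simp

section \<open>Multipliers vanishing at infinity, composed with convolutions\<close>

lemma half_bound_scale:
  assumes "e > 0" "(N :: real) \<ge> 0"
  shows "e / (2 * (N + 1)) > 0" "e / (2 * (N + 1)) * N \<le> e / 2"
proof -
  have "N / (N + 1) \<le> 1" using assms by simp
  hence "e / 2 * (N / (N + 1)) \<le> e / 2 * 1" using assms by (intro mult_left_mono) auto
  thus "e / (2 * (N + 1)) * N \<le> e / 2" by simp
qed (use assms in simp)

locale vanishing_function = bounded_function g C for g :: "real ^ 'n::finite \<Rightarrow> complex" and C +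
  assumes vanishing: "\<And>e. e > 0 \<Longrightarrow> \<exists>R. \<forall>x. R \<le> norm x \<longrightarrow> cmod (g x) < e"
begin

text \<open>\<open>H\<close> is multiplication by the part of \<open>g\<close> outside a large ball.
  Cutting off before or after multiplying by \<open>g\<close> is the same, but the two orders of
  composition with a convolution call for different forms.\<close>

lemma truncation:
  assumes e: "e > 0"
  obtains R H where
    "\<And>u. mult_l2 g u = mult_l2 g (mult_l2 (indicator (cball 0 R)) u) + H u"
    "\<And>u. mult_l2 g u = mult_l2 (indicator (cball 0 R)) (mult_l2 g u) + H u"
    "\<And>u. norm (H u) \<le> e * norm u"
proof -
  obtain R where R: "\<And>x. R \<le> norm x \<Longrightarrow> cmod (g x) < e" using vanishing[OF e] by blast
  define S where "S = cball (0 :: real ^ 'n) R"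
  define h where "h x = (if x \<in> S then 0 else g x)" for x
  interpret S: bounded_function "indicator S" 1 by (rule bounded_function_indicator) (simp add: S_def)
  interpret h: bounded_function h e
  proof
    have [measurable]: "S \<in> sets borel" by (simp add: S_def)
    show "h \<in> borel_measurable borel" unfolding h_def[abs_def] by measurable
    show "cmod (h x) \<le> e" for x using R[of x] e by (auto simp: h_def S_def)
  qed
  show ?thesis
  proof (rule that[of R "mult_l2 h"])
    fix u :: "'n l2"
    show "mult_l2 g u = mult_l2 g (mult_l2 (indicator (cball 0 R)) u) + mult_l2 h u"
      unfolding S_def[symmetric] by (rule l2_eqI)
         (use rep_mult_l2[of u] rep_mult_l2[of "mult_l2 (indicator S) u"] S.rep_mult_l2[of u] h.rep_mult_l2[of u]
           rep_l2_add[of "mult_l2 g (mult_l2 (indicator S) u)" "mult_l2 h u"]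
          in \<open>eventually_elim, simp add: h_def\<close>)
    show "mult_l2 g u = mult_l2 (indicator (cball 0 R)) (mult_l2 g u) + mult_l2 h u"
      unfolding S_def[symmetric] by (rule l2_eqI)
         (use rep_mult_l2[of u] S.rep_mult_l2[of "mult_l2 g u"] h.rep_mult_l2[of u]
           rep_l2_add[of "mult_l2 (indicator S) (mult_l2 g u)" "mult_l2 h u"]
          in \<open>eventually_elim, simp add: h_def\<close>)
    show "norm (mult_l2 h u) \<le> e * norm u" by (rule h.norm_mult_l2)
  qed
qed

text \<open>A norm limit of compact operators: \<open>g\<close> is cut off to a ball and
  \<open>a\<close> is replaced by a continuous kernel of compact support, each at a cost of
  \<open>e/2\<close>. The cut-off acts after the convolution.\<close>

lemma compact_operator_mult_conv:
  assumes a: "integrable lborel a"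
  shows "compact_operator (\<lambda>u. mult_l2 g (conv_l2 a u))"
proof (rule compact_operator_limit)
  show "bounded_linear (\<lambda>u. mult_l2 g (conv_l2 a u))"
    by (rule bounded_linear_compose[OF bounded_linear_mult_l2 bounded_linear_conv_l2[OF a]])
  fix e :: real assume e: "e > 0"
  define N where "N = (LINT x|lborel. cmod (a x))"
  have N: "N \<ge> 0" unfolding N_def by simp
  obtain R H where RH: "\<And>u. mult_l2 g u = mult_l2 g (mult_l2 (indicator (cball 0 R)) u) + H u"
    "\<And>u. norm (H u) \<le> e / (2 * (N + 1)) * norm u"
    using truncation[OF half_bound_scale(1)[OF e N]] by metis
  obtain b R' where b: "continuous_on UNIV b" "\<And>x. x \<notin> cball 0 R' \<Longrightarrow> b x = 0" "integrable lborel b"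
    "(LINT x|lborel. cmod (a x - b x)) < e / (2 * (C + 1))"
    using L1_approx_compact_support[OF a half_bound_scale(1)[OF e C_nonneg]] by blast
  let ?S = "\<lambda>u. mult_l2 g (mult_l2 (indicator (cball 0 R)) (conv_l2 b u))"
  show "\<exists>S. compact_operator S \<and> (\<forall>u. norm u \<le> 1 \<longrightarrow> norm (mult_l2 g (conv_l2 a u) - S u) \<le> e)"
  proof (intro exI[of _ ?S] conjI allI impI)
    show "compact_operator ?S"
      by (rule compact_operator_compose_left[OF bounded_linear_mult_l2
            compact_operator_truncated_conv[OF b(1) compact_cball[of 0 R'] b(2,3)]]) simp
    fix u :: "'n l2" assume u: "norm u \<le> 1"
    have "mult_l2 g (conv_l2 a u) - ?S u = H (conv_l2 a u) + mult_l2 g (mult_l2 (indicator (cball 0 R)) (conv_l2 (\<lambda>x. a x - b x) u))"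
      by (simp add: RH(1)[of "conv_l2 a u"] conv_l2_diff_kernel[OF a b(3)] linear_diff[OF bounded_linear.linear]
          bounded_linear_mult_l2 bounded_function.bounded_linear_mult_l2[OF bounded_function_indicator])
    also have "norm \<dots> \<le> norm (H (conv_l2 a u)) + norm (mult_l2 g (mult_l2 (indicator (cball 0 R)) (conv_l2 (\<lambda>x. a x - b x) u)))"
      by (rule norm_triangle_ineq)
    also have "\<dots> \<le> e/2 + e/2"
    proof (rule add_mono)
      have "norm (H (conv_l2 a u)) \<le> e / (2 * (N + 1)) * norm (conv_l2 a u)" by (rule RH(2))
      also have "norm (conv_l2 a u) \<le> N * 1"
        using norm_conv_l2[OF a, of u] mult_left_mono[OF u N] unfolding N_def by linarith
      hence "e / (2 * (N + 1)) * norm (conv_l2 a u) \<le> e / (2 * (N + 1)) * N"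
        using e N by (intro mult_left_mono) auto
      also note half_bound_scale(2)[OF e N]
      finally show "norm (H (conv_l2 a u)) \<le> e/2" .
      have "norm (mult_l2 g (mult_l2 (indicator (cball 0 R)) (conv_l2 (\<lambda>x. a x - b x) u))) \<le> C * norm (conv_l2 (\<lambda>x. a x - b x) u)"
        by (rule order_trans[OF norm_mult_l2 mult_left_mono[OF norm_indicator_mult_le C_nonneg]])
      also have "norm (conv_l2 (\<lambda>x. a x - b x) u) \<le> (LINT x|lborel. cmod (a x - b x)) * 1"
        by (rule order_trans[OF norm_conv_l2[OF Bochner_Integration.integrable_diff[OF a b(3)]] mult_left_mono[OF u]]) simp
      hence "C * norm (conv_l2 (\<lambda>x. a x - b x) u) \<le> C * (e / (2 * (C + 1)))"
        using b(4) C_nonneg by (intro mult_left_mono) auto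
      also have "\<dots> \<le> e/2" using half_bound_scale(2)[OF e C_nonneg] by (simp add: mult.commute)
      finally show "norm (mult_l2 g (mult_l2 (indicator (cball 0 R)) (conv_l2 (\<lambda>x. a x - b x) u))) \<le> e/2" .
    qed
    finally show "norm (mult_l2 g (conv_l2 a u) - ?S u) \<le> e" by simp
  qed
qed

text \<open>Here the cut-off acts before the convolution, and it is the bounded support of the
  approximating kernel that confines the output to a ball.\<close>

lemma compact_operator_conv_mult:
  assumes a: "integrable lborel a"
  shows "compact_operator (\<lambda>u. conv_l2 a (mult_l2 g u))"
proof (rule compact_operator_limit)
  show "bounded_linear (\<lambda>u. conv_l2 a (mult_l2 g u))"
    by (rule bounded_linear_compose[OF bounded_linear_conv_l2[OF a] bounded_linear_mult_l2])
  fix e :: real assume e: "e > 0"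
  define N where "N = (LINT x|lborel. cmod (a x))"
  have N: "N \<ge> 0" unfolding N_def by simp
  obtain R H where RH: "\<And>u. mult_l2 g u = mult_l2 (indicator (cball 0 R)) (mult_l2 g u) + H u"
    "\<And>u. norm (H u) \<le> e / (2 * (N + 1)) * norm u"
    using truncation[OF half_bound_scale(1)[OF e N]] by metis
  obtain b R' where b: "continuous_on UNIV b" "\<And>x. x \<notin> cball 0 R' \<Longrightarrow> b x = 0" "integrable lborel b"
    "(LINT x|lborel. cmod (a x - b x)) < e / (2 * (C + 1))"
    using L1_approx_compact_support[OF a half_bound_scale(1)[OF e C_nonneg]] by blast
  let ?I = "mult_l2 (indicator (cball 0 R)) :: 'n l2 \<Rightarrow> 'n l2"
  let ?S = "\<lambda>u. conv_l2 b (?I (mult_l2 g u))"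
  show "\<exists>S. compact_operator S \<and> (\<forall>u. norm u \<le> 1 \<longrightarrow> norm (conv_l2 a (mult_l2 g u) - S u) \<le> e)"
  proof (intro exI[of _ ?S] conjI allI impI)
    have bl: "bounded_linear (\<lambda>u. ?I (mult_l2 g u))"
      by (rule bounded_linear_compose[OF bounded_function.bounded_linear_mult_l2[OF bounded_function_indicator] bounded_linear_mult_l2]) simp
    have "compact_operator (\<lambda>u. mult_l2 (indicator (cball 0 (R + R'))) (conv_l2 b (?I (mult_l2 g u))))"
      by (rule compact_operator_compose_right[OF compact_operator_truncated_conv[OF b(1) compact_cball[of 0 R'] b(2,3)] bl]) simp
    moreover have "mult_l2 (indicator (cball 0 (R + R'))) (conv_l2 b (?I (mult_l2 g u))) = ?S u" for u
      by (rule conv_l2_indicator_support[OF b(3,2)]) simp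
    ultimately show "compact_operator ?S" by simp
    fix u :: "'n l2" assume u: "norm u \<le> 1"
    have "conv_l2 a (mult_l2 g u) = conv_l2 a (?I (mult_l2 g u)) + conv_l2 a (H u)"
      by (subst RH(1)) (rule conv_l2_add[OF a])
    hence "conv_l2 a (mult_l2 g u) - ?S u = conv_l2 a (H u) + conv_l2 (\<lambda>x. a x - b x) (?I (mult_l2 g u))"
      by (simp add: conv_l2_diff_kernel[OF a b(3)])
    also have "norm \<dots> \<le> norm (conv_l2 a (H u)) + norm (conv_l2 (\<lambda>x. a x - b x) (?I (mult_l2 g u)))"
      by (rule norm_triangle_ineq)
    also have "\<dots> \<le> e/2 + e/2"
    proof (rule add_mono)
      have "norm (conv_l2 a (H u)) \<le> N * norm (H u)" unfolding N_def by (rule norm_conv_l2[OF a])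
      also have "\<dots> \<le> N * (e / (2 * (N + 1)) * 1)"
        using e N u by (intro mult_left_mono order_trans[OF RH(2)]) auto
      also have "\<dots> \<le> e/2" using half_bound_scale(2)[OF e N] by (simp add: mult.commute)
      finally show "norm (conv_l2 a (H u)) \<le> e/2" .
      have "norm (conv_l2 (\<lambda>x. a x - b x) (?I (mult_l2 g u))) \<le> (LINT x|lborel. cmod (a x - b x)) * norm (?I (mult_l2 g u))"
        by (rule norm_conv_l2[OF Bochner_Integration.integrable_diff[OF a b(3)]])
      also have "\<dots> \<le> (e / (2 * (C + 1))) * (C * 1)"
      proof (rule mult_mono)
        show "norm (?I (mult_l2 g u)) \<le> C * 1"
          by (rule order_trans[OF norm_indicator_mult_le order_trans[OF norm_mult_l2 mult_left_mono[OF u C_nonneg]]])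
      qed (use b(4) e C_nonneg in auto)
      also have "\<dots> \<le> e/2" using half_bound_scale(2)[OF e C_nonneg] by simp
      finally show "norm (conv_l2 (\<lambda>x. a x - b x) (?I (mult_l2 g u))) \<le> e/2" .
    qed
    finally show "norm (conv_l2 a (mult_l2 g u) - ?S u) \<le> e" by simp
  qed
qed

end

section \<open>Trigonometric polynomials on a cube\<close>

text \<open>The period in each coordinate is \<open>2 * pi / c\<close>: kernels on a cube of side
  \<open>2 * R\<close> use \<open>c = pi / R\<close>, test functions on a cube of side
  \<open>r\<close> use \<open>c = 2 * pi / r\<close>.\<close>

definition wave :: "real \<Rightarrow> int ^ 'n \<Rightarrow> real ^ 'n \<Rightarrow> complex" where
  "wave c n x = exp (\<i> * of_real (c * (rvec n \<bullet> x)))"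

lemma rvec_nth [simp]: "rvec n $ i = of_int (n $ i)"
  by (simp add: rvec_def)

lemma rvec_zero [simp]: "rvec 0 = 0"
  by (simp add: vec_eq_iff)

lemma rvec_add: "rvec (n + m) = rvec n + rvec m"
  by (simp add: vec_eq_iff)

lemma rvec_minus: "rvec (- n) = - rvec n"
  by (simp add: vec_eq_iff)

lemma rvec_scale: "rvec (k *s n) = of_int k *\<^sub>R rvec n"
  by (simp add: vec_eq_iff)

lemma norm_wave [simp]: "cmod (wave c n x) = 1"
  by (simp add: wave_def)

lemma wave_zero [simp]: "wave c 0 x = 1"
  by (simp add: wave_def)

lemma wave_add_index: "wave c (n + m) x = wave c n x * wave c m x"
  by (simp add: wave_def rvec_add inner_add_left exp_add[symmetric] algebra_simps)

lemma wave_add: "wave c n (x + y) = wave c n x * wave c n y"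
  by (simp add: wave_def inner_add_right exp_add[symmetric] algebra_simps)

lemma wave_minus_index: "wave c (- n) x = cnj (wave c n x)"
  by (simp add: wave_def rvec_minus exp_cnj)

lemma wave_minus: "wave c n (- x) = cnj (wave c n x)"
  by (simp add: wave_def exp_cnj)

lemma wave_diff_index: "wave c (n - m) x = wave c n x * cnj (wave c m x)"
  using wave_add_index[of c n "-m" x] by (simp add: wave_minus_index)

lemma wave_diff: "wave c n (x - y) = wave c n x * cnj (wave c n y)"
  using wave_add[of c n x "-y"] by (simp add: wave_minus)

text \<open>The link between the two scales: the even frequencies of period \<open>2 * r\<close> are
  the frequencies of period \<open>r\<close>. Hence the separate treatment of the coefficients with
  index \<open>2 *s n\<close>.\<close>

lemma wave_double: "wave c (2 *s n) = wave (2 * c) n"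
  by (rule ext) (simp add: wave_def rvec_scale mult.assoc mult.left_commute)

lemma continuous_on_wave [continuous_intros]: "continuous_on S (wave c n)"
  unfolding wave_def[abs_def] by (intro continuous_intros)

lemma measurable_wave [measurable]: "wave c n \<in> borel_measurable borel"
  by (intro borel_measurable_continuous_onI continuous_intros)

lemma compact_cube: "compact (cube s x0)"
  by (simp add: cube_def)

lemma cube_borel [measurable]: "cube s x0 \<in> sets borel"
  by (simp add: cube_def)

lemma mem_cube: "x \<in> cube s x0 \<longleftrightarrow> (\<forall>i. \<bar>x $ i - x0 $ i\<bar> \<le> s / 2)"
proof -
  have "(x0 $ i - s / 2 \<le> x $ i \<and> x $ i \<le> x0 $ i + s / 2) = (\<bar>x $ i - x0 $ i\<bar> \<le> s / 2)" for i
    by arith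
  thus ?thesis by (simp add: cube_def mem_box_cart)
qed

text \<open>The origin of the doubled side in \<open>a_coeff\<close>: inside a cube, a kernel is
  seen only at differences of points of the cube.\<close>

lemma cube_diff: "x \<in> cube s x0 \<Longrightarrow> y \<in> cube s x0 \<Longrightarrow> x - y \<in> cube (2 * s) 0"
  unfolding mem_cube
proof
  fix i assume "\<forall>i. \<bar>x $ i - x0 $ i\<bar> \<le> s / 2" "\<forall>i. \<bar>y $ i - x0 $ i\<bar> \<le> s / 2"
  from this(1)[rule_format, of i] this(2)[rule_format, of i]
  have "\<bar>x $ i - y $ i\<bar> \<le> s" by arith
  thus "\<bar>(x - y) $ i - 0 $ i\<bar> \<le> 2 * s / 2" by simp
qed

section \<open>Orthogonality of waves on a cube\<close>

lemma integral_full_period: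
  fixes s :: real
  assumes "s > 0" "k \<noteq> 0"
  shows "(LINT t|lborel. indicator {l..l + s} t *\<^sub>R exp (\<i> * of_real (2 * pi / s * (of_int k * t)))) = 0"
proof -
  define w where "w = \<i> * of_real (2 * pi / s * of_int k)"
  have w: "w \<noteq> 0" using assms by (simp add: w_def)
  define F where "F t = exp (w * of_real t) / w" for t :: real
  have "(LINT t|lborel. indicator {l..l + s} t *\<^sub>R exp (w * of_real t)) = F (l + s) - F l"
  proof (rule integral_FTC_atLeastAtMost)
    show "(F has_vector_derivative exp (w * of_real t)) (at t within {l..l + s})" for t
      unfolding F_def[abs_def]
      by (rule has_vector_derivative_real_field) (use w in \<open>auto intro!: derivative_eq_intros\<close>)
    show "continuous_on {l..l + s} (\<lambda>t. exp (w * of_real t))" by (intro continuous_intros)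
  qed (use assms in simp)
  also have "exp (w * of_real (l + s)) = exp (w * of_real l)"
  proof -
    have "w * of_real s = of_int (2 * k) * (of_real pi * \<i>)" using assms by (simp add: w_def)
    hence "exp (w * of_real s) = 1"
      using exp_integer_2pi[of "of_int k"] by (simp add: mult_ac)
    thus ?thesis by (simp add: distrib_left exp_add)
  qed
  hence "F (l + s) - F l = 0" by (simp add: F_def)
  finally show ?thesis by (simp add: w_def mult_ac)
qed

text \<open>Indicator and wave factor over the coordinates, so the integral is a product of
  one-dimensional ones, and a single coordinate with \<open>n $ i \<noteq> 0\<close> annihilates
  it.\<close>

lemma integral_wave_cube:
  fixes x0 :: "real ^ 'n"
  assumes s: "s > 0"
  shows "(LINT x|lborel. indicator (cube s x0) x *\<^sub>R wave (2 * pi / s) n x) = (if n = 0 then of_real (s ^ CARD('n)) else 0)"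
proof -
  interpret product_sigma_finite "\<lambda>_::real^'n. lborel :: real measure" ..
  define f where "f b t = indicator {(x0 \<bullet> b) - s / 2..(x0 \<bullet> b) - s / 2 + s} t *\<^sub>R exp (\<i> * of_real (2 * pi / s * ((rvec n \<bullet> b) * t)))"
    for b :: "real ^ 'n" and t :: real
  have [measurable]: "f b \<in> borel_measurable borel" for b
  proof -
    have "(\<lambda>t::real. exp (\<i> * of_real (2 * pi / s * ((rvec n \<bullet> b) * t)))) \<in> borel_measurable borel"
      by (intro borel_measurable_continuous_onI continuous_intros)
    thus ?thesis unfolding f_def[abs_def] by measurable
  qed
  have B: "Basis = range (\<lambda>i. axis i 1 :: real ^ 'n)" by (auto simp: Basis_vec_def)
  have inj: "inj (\<lambda>i. axis i 1 :: real ^ 'n)" by (auto simp: inj_def axis_eq_axis)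
  have prod: "indicator (cube s x0) x *\<^sub>R wave (2 * pi / s) n x = (\<Prod>b\<in>Basis. f b (x \<bullet> b))" for x
  proof -
    have "(\<Prod>b\<in>Basis. f b (x \<bullet> b)) = (\<Prod>b\<in>Basis. of_real (indicator {(x0 \<bullet> b) - s / 2..(x0 \<bullet> b) - s / 2 + s} (x \<bullet> b))) *
        (\<Prod>b\<in>Basis. exp (\<i> * of_real (2 * pi / s * ((rvec n \<bullet> b) * (x \<bullet> b)))))"
      unfolding f_def by (simp add: scaleR_conv_of_real prod.distrib)
    also have "(\<Prod>b\<in>Basis. exp (\<i> * of_real (2 * pi / s * ((rvec n \<bullet> b) * (x \<bullet> b))))) = wave (2 * pi / s) n x"
      unfolding wave_def
      by (subst exp_sum[symmetric]) (simp_all add: euclidean_inner[of "rvec n" x] sum_distrib_left)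
    also have "(\<Prod>b\<in>Basis. of_real (indicator {(x0 \<bullet> b) - s / 2..(x0 \<bullet> b) - s / 2 + s} (x \<bullet> b))) = (of_real (indicator (cube s x0) x) :: complex)"
    proof (cases "x \<in> cube s x0")
      case True
      have "x \<bullet> b \<in> {(x0 \<bullet> b) - s / 2..(x0 \<bullet> b) - s / 2 + s}" if b: "b \<in> Basis" for b
      proof -
        obtain i where "b = axis i 1" using b unfolding B by blast
        thus ?thesis using True[unfolded mem_cube, rule_format, of i]
          by (simp only: inner_axis inner_real_def mult_1_right atLeastAtMost_iff) arith
      qed
      thus ?thesis using True by simp
    next
      case False
      then obtain i where i: "\<not> \<bar>x $ i - x0 $ i\<bar> \<le> s / 2" unfolding mem_cube by blast
      have "x \<bullet> axis i 1 \<notin> {(x0 \<bullet> axis i 1) - s / 2..(x0 \<bullet> axis i 1) - s / 2 + s}"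
        using i by (simp only: inner_axis inner_real_def mult_1_right atLeastAtMost_iff) arith
      hence "\<exists>b\<in>Basis. x \<bullet> b \<notin> {(x0 \<bullet> b) - s / 2..(x0 \<bullet> b) - s / 2 + s}" unfolding B by blast
      thus ?thesis using False by (auto intro!: prod_zero simp: indicator_def)
    qed
    finally show ?thesis by (simp add: scaleR_conv_of_real)
  qed
  have "(LINT x|lborel. indicator (cube s x0) x *\<^sub>R wave (2 * pi / s) n x) = (LINT x|lborel. (\<Prod>b\<in>Basis. f b (x \<bullet> b)))"
    unfolding prod ..
  also have "\<dots> = (LINT y|(\<Pi>\<^sub>M b\<in>Basis. lborel). (\<Prod>b\<in>Basis. f b ((\<Sum>b\<in>Basis. y b *\<^sub>R b) \<bullet> b)))"
    by (subst lborel_eq, subst integral_distr) auto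
  also have "\<dots> = (LINT y|(\<Pi>\<^sub>M b\<in>Basis. lborel). (\<Prod>b\<in>(Basis :: (real^'n) set). f b (y b)))"
    by (intro Bochner_Integration.integral_cong refl prod.cong) (simp add: inner_sum_left inner_Basis if_distrib sum.delta cong: if_cong)
  also have "\<dots> = (\<Prod>b\<in>Basis. (LINT t|lborel. f b t))"
  proof (rule product_integral_prod)
    fix b :: "real ^ 'n"
    show "integrable lborel (f b)"
    proof (rule Bochner_Integration.integrable_bound)
      show "integrable lborel (indicator {(x0 \<bullet> b) - s / 2..(x0 \<bullet> b) - s / 2 + s} :: real \<Rightarrow> real)"
        by (rule integrable_indicator_compact) simp
    qed (auto simp: f_def)
  qed simp
  also have "\<dots> = (if n = 0 then of_real (s ^ CARD('n)) else 0)"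
  proof (cases "n = 0")
    case True
    have "(LINT t|lborel. f b t) = of_real s" for b
      using True s by (simp add: f_def scaleR_conv_of_real)
    thus ?thesis using True by simp
  next
    case False
    then obtain i where i: "n $ i \<noteq> 0" by (auto simp: vec_eq_iff)
    have "(LINT t|lborel. f (axis i 1) t) = 0"
      unfolding f_def using integral_full_period[OF s i, of "x0 $ i - s / 2"] by (simp add: inner_axis)
    moreover have "axis i 1 \<in> (Basis :: (real ^ 'n) set)" unfolding B by blast
    ultimately show ?thesis using False by (auto intro!: prod_zero)
  qed
  finally show ?thesis .
qed

section \<open>Trigonometric polynomials and uniform approximation on the torus\<close>

definition trig_poly :: "real \<Rightarrow> (real ^ 'n \<Rightarrow> complex) \<Rightarrow> bool" where
  "trig_poly c p \<longleftrightarrow> (\<exists>S b. finite S \<and> p = (\<lambda>x. \<Sum>n\<in>S. b n * wave c n x))"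

lemma trig_polyI: "finite S \<Longrightarrow> p = (\<lambda>x. \<Sum>n\<in>S. b n * wave c n x) \<Longrightarrow> trig_poly c p"
  unfolding trig_poly_def by blast

lemma trig_poly_wave: "trig_poly c (\<lambda>x. b * wave c n x)"
  by (rule trig_polyI[of "{n}" _ "\<lambda>_. b"]) auto

lemma trig_poly_const: "trig_poly c (\<lambda>x. b)"
  using trig_poly_wave[of c b 0] by simp

lemma trig_poly_add:
  assumes "trig_poly c p" "trig_poly c q"
  shows "trig_poly c (\<lambda>x. p x + q x)"
proof -
  obtain S b where S: "finite S" "p = (\<lambda>x. \<Sum>n\<in>S. b n * wave c n x)" using assms(1) by (auto simp: trig_poly_def)
  obtain T d where T: "finite T" "q = (\<lambda>x. \<Sum>n\<in>T. d n * wave c n x)" using assms(2) by (auto simp: trig_poly_def)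
  have "p x = (\<Sum>n\<in>S \<union> T. (if n \<in> S then b n else 0) * wave c n x)" for x
    unfolding S(2) using S T by (intro sum.mono_neutral_cong_left) auto
  moreover have "q x = (\<Sum>n\<in>S \<union> T. (if n \<in> T then d n else 0) * wave c n x)" for x
    unfolding T(2) using S T by (intro sum.mono_neutral_cong_left) auto
  ultimately have "(\<lambda>x. p x + q x) = (\<lambda>x. \<Sum>n\<in>S \<union> T. ((if n \<in> S then b n else 0) + (if n \<in> T then d n else 0)) * wave c n x)"
    by (simp add: distrib_right sum.distrib)
  moreover have "finite (S \<union> T)" using S T by simp
  ultimately show ?thesis by (intro trig_polyI)
qed

lemma trig_poly_sum: "(\<And>i. i \<in> A \<Longrightarrow> trig_poly c (p i)) \<Longrightarrow> trig_poly c (\<lambda>x. \<Sum>i\<in>A. p i x)"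
  by (induction A rule: infinite_finite_induct) (auto intro: trig_poly_add trig_poly_const)

lemma trig_poly_mult:
  assumes "trig_poly c p" "trig_poly c q"
  shows "trig_poly c (\<lambda>x. p x * q x)"
proof -
  obtain S b where S: "finite S" "p = (\<lambda>x. \<Sum>n\<in>S. b n * wave c n x)" using assms(1) by (auto simp: trig_poly_def)
  obtain T d where T: "finite T" "q = (\<lambda>x. \<Sum>n\<in>T. d n * wave c n x)" using assms(2) by (auto simp: trig_poly_def)
  have "(\<lambda>x. p x * q x) = (\<lambda>x. \<Sum>n\<in>S. \<Sum>m\<in>T. (b n * d m) * wave c (n + m) x)"
    unfolding S(2) T(2) by (simp add: sum_product wave_add_index mult_ac)
  thus ?thesis by (simp only:) (intro trig_poly_sum trig_poly_wave)
qed

lemma trig_poly_cos_sin: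
  "trig_poly c (\<lambda>x. of_real (cos (c * x $ i)))" "trig_poly c (\<lambda>x. of_real (sin (c * x $ i)))"
proof -
  have r: "rvec (axis i 1) \<bullet> x = x $ i" for x :: "real ^ 'a"
  proof -
    have "rvec (axis i 1) = (axis i 1 :: real ^ 'a)" by (simp add: vec_eq_iff axis_def)
    thus ?thesis by (simp add: inner_axis')
  qed
  have w: "wave c (axis i 1) x = exp (\<i> * of_real (c * x $ i))" "wave c (- axis i 1) x = exp (- (\<i> * of_real (c * x $ i)))" for x
    by (simp_all add: wave_def rvec_minus r)
  have "(\<lambda>x. of_real (cos (c * x $ i))) = (\<lambda>x. (1/2) * wave c (axis i 1) x + (1/2) * wave c (- axis i 1) x)"
    unfolding w by (simp add: cos_of_real[symmetric] cos_exp_eq add_divide_distrib)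
  thus "trig_poly c (\<lambda>x. of_real (cos (c * x $ i)))"
    by (simp only:) (intro trig_poly_add trig_poly_wave)
  have "(\<lambda>x. of_real (sin (c * x $ i))) = (\<lambda>x. (- \<i>/2) * wave c (axis i 1) x + (\<i>/2) * wave c (- axis i 1) x)"
    unfolding w by (rule ext, simp only: sin_of_real[symmetric] sin_exp_eq of_real_mult, subst divide_eq_eq)
      (simp add: algebra_simps)
  thus "trig_poly c (\<lambda>x. of_real (sin (c * x $ i)))"
    by (simp only:) (intro trig_poly_add trig_poly_wave)
qed

definition torus_map :: "real \<Rightarrow> real ^ 'n \<Rightarrow> complex ^ 'n" where
  "torus_map c x = (\<chi> i. cis (c * x $ i))"

text \<open>The real coordinates of \<open>torus_map c x\<close> are the cosines and sines of
  \<open>c * x $ i\<close>, each a combination of two waves, and trigonometric polynomials are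
  closed under sums and products.\<close>

lemma trig_poly_real_polynomial:
  assumes "real_polynomial_function p"
  shows "trig_poly c (\<lambda>x :: real ^ 'n. of_real (p (torus_map c x)))"
  using assms
proof (induction p rule: real_polynomial_function.induct)
  case (linear h)
  interpret bounded_linear h by fact
  have "torus_map c x = (\<Sum>i\<in>UNIV. cos (c * x $ i) *\<^sub>R axis i 1 + sin (c * x $ i) *\<^sub>R axis i \<i>)" for x :: "real ^ 'n"
    by (simp add: vec_eq_iff torus_map_def axis_def if_distrib sum.distrib cis.ctr complex_eq_iff cong: if_cong)
  hence "(\<lambda>x. of_real (h (torus_map c x))) = (\<lambda>x. \<Sum>i\<in>UNIV. (of_real (cos (c * x $ i)) * of_real (h (axis i 1)) +
      of_real (sin (c * x $ i)) * of_real (h (axis i \<i>)) :: complex))"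
    by (simp add: sum add scaleR)
  thus ?case
    by (simp only:) (intro trig_poly_sum trig_poly_add trig_poly_mult trig_poly_cos_sin trig_poly_const)
qed (auto simp: trig_poly_const intro: trig_poly_add trig_poly_mult)

lemma trig_poly_polynomial:
  fixes g :: "complex ^ 'n \<Rightarrow> complex"
  assumes "polynomial_function g"
  shows "trig_poly c (\<lambda>x. g (torus_map c x))"
proof -
  have "real_polynomial_function (Re \<circ> g)" "real_polynomial_function (Im \<circ> g)"
    using assms bounded_linear_Re bounded_linear_Im by (auto simp: polynomial_function_def)
  hence "trig_poly c (\<lambda>x. of_real ((Re \<circ> g) (torus_map c x)) + \<i> * of_real ((Im \<circ> g) (torus_map c x)))"
    by (intro trig_poly_add trig_poly_mult trig_poly_const trig_poly_real_polynomial)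
  thus ?thesis by (simp add: complex_eq[symmetric])
qed

definition torus_inv :: "real \<Rightarrow> complex ^ 'n \<Rightarrow> real ^ 'n" where
  "torus_inv c z = (\<chi> i. Arg (z $ i) / c)"

text \<open>\<open>Arg\<close> omits \<open>- pi\<close> and attains \<open>pi\<close>, so on the
  cube the inverse is exact except that the faces \<open>x $ i = - R\<close> are glued to the
  opposite ones.\<close>

lemma torus_inv_map:
  assumes R: "R > 0" and x: "x \<in> cube (2 * R) 0"
  shows "torus_inv (pi / R) (torus_map (pi / R) x) $ i = (if x $ i = - R then R else x $ i)"
proof -
  have xi: "\<bar>x $ i\<bar> \<le> R" using x by (simp add: mem_cube)
  show ?thesis
  proof (cases "x $ i = - R")
    case True
    hence "pi / R * x $ i = - pi" using R by simp
    thus ?thesis using True R by (simp add: torus_inv_def torus_map_def cis_conv_exp exp_minus Arg_eq_pi[THEN iffD2])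
  next
    case False
    hence "- R < x $ i" "x $ i \<le> R" using xi by auto
    hence "pi / R * (- R) < pi / R * x $ i" "pi / R * x $ i \<le> pi / R * R"
      using R by (intro mult_strict_left_mono mult_left_mono; simp)+
    hence "Arg (cis (pi / R * x $ i)) = pi / R * x $ i" using R by (intro Arg_cis) simp
    thus ?thesis using False R by (simp add: torus_inv_def torus_map_def)
  qed
qed

lemma torus_map_inv:
  assumes "c \<noteq> 0" "\<And>i. cmod (z $ i) = 1"
  shows "torus_map c (torus_inv c z) = z"
proof -
  have "cis (Arg (z $ i)) = z $ i" for i
  proof -
    have "z $ i \<noteq> 0" using assms(2)[of i] by auto
    thus ?thesis using assms(2)[of i] by (simp add: cis_Arg sgn_div_norm)
  qed
  thus ?thesis using assms(1) by (simp add: torus_map_def torus_inv_def vec_eq_iff)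
qed

lemma continuous_on_torus_map: "continuous_on S (torus_map c)"
  unfolding torus_map_def[abs_def] by (intro continuous_intros)

lemma isCont_torus_inv:
  assumes "\<And>i. z $ i \<notin> \<real>\<^sub>\<le>\<^sub>0"
  shows "isCont (torus_inv c) z"
  unfolding isCont_def
proof (rule vec_tendstoI)
  fix i
  have "((\<lambda>w. Arg (w $ i) / c) \<longlongrightarrow> Arg (z $ i) / c) (at z)"
  proof -
    have "((\<lambda>w. w $ i) \<longlongrightarrow> z $ i) (at z)" by (intro tendsto_vec_nth tendsto_ident_at)
    moreover have "isCont Arg (z $ i)" by (rule continuous_at_Arg[OF assms])
    ultimately have "((\<lambda>w. Arg (w $ i)) \<longlongrightarrow> Arg (z $ i)) (at z)" by (rule isCont_tendsto_compose[rotated])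
    thus ?thesis by (auto simp: divide_inverse intro!: tendsto_intros)
  qed
  thus "((\<lambda>w. torus_inv c w $ i) \<longlongrightarrow> torus_inv c z $ i) (at z)" by (simp add: torus_inv_def)
qed

text \<open>Stone-Weierstrass on the torus: a continuous function supported in the open cube factors
  through the map of the cube onto the torus.\<close>

lemma trig_poly_uniform_approx:
  fixes f :: "real ^ 'n \<Rightarrow> complex"
  assumes R: "R > 0" and f: "continuous_on UNIV f"
    and L: "compact L" "\<And>x i. x \<in> L \<Longrightarrow> \<bar>x $ i\<bar> < R" "\<And>x. x \<notin> L \<Longrightarrow> f x = 0" and e: "e > 0"
  obtains p where "trig_poly (pi / R) p" "\<And>x. x \<in> cube (2 * R) 0 \<Longrightarrow> cmod (f x - p x) < e"
proof -
  define c where "c = pi / R"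
  have c: "c \<noteq> 0" using R by (simp add: c_def)
  define K where "K = cube (2 * R) (0 :: real ^ 'n)"
  define T where "T = torus_map c ` K"
  have T: "compact T"
    unfolding T_def K_def by (rule compact_continuous_image[OF continuous_on_torus_map compact_cube])
  have T1: "cmod (z $ i) = 1" if "z \<in> T" for z i using that by (auto simp: T_def torus_map_def)
  have inv_map: "torus_inv c (torus_map c x) $ i = (if x $ i = - R then R else x $ i)" if "x \<in> K" for x i
    using that unfolding c_def K_def by (rule torus_inv_map[OF R])
  have LK: "x \<in> K" if "x \<in> L" for x using L(2)[OF that] by (simp add: K_def mem_cube less_imp_le)
  have inv_L: "torus_inv c (torus_map c x) = x" if "x \<in> L" for x
  proof -
    have "x $ i \<noteq> - R" for i using L(2)[OF that, of i] by auto
    thus ?thesis by (simp add: vec_eq_iff inv_map[OF LK[OF that]])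
  qed
  define F where "F z = f (torus_inv c z)" for z
  have Fzero: "F z = 0" if "z \<in> T" "z \<notin> torus_map c ` L" for z
  proof -
    have "torus_inv c z \<notin> L"
    proof
      assume "torus_inv c z \<in> L"
      hence "torus_map c (torus_inv c z) \<in> torus_map c ` L" by (rule imageI)
      thus False using that(2) torus_map_inv[OF c T1[OF that(1)]] by simp
    qed
    thus ?thesis by (simp add: F_def L(3))
  qed
  have cL: "closed (torus_map c ` L)"
    by (rule compact_imp_closed[OF compact_continuous_image[OF continuous_on_torus_map L(1)]])
  \<comment> \<open>Off the cut of \<open>Arg\<close> this is a composition. A point of the torus
    with a coordinate on the cut comes from a face of the cube, so it has positive distance from the
    compact image of \<open>L\<close>, and \<open>F\<close> vanishes nearby.\<close>
  have "continuous_on T F"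
    unfolding continuous_on_eq_continuous_within
  proof
    fix z assume z: "z \<in> T"
    show "continuous (at z within T) F"
    proof (cases "\<forall>i. z $ i \<notin> \<real>\<^sub>\<le>\<^sub>0")
      case True
      have "isCont f (torus_inv c z)" using f by (simp add: continuous_on_eq_continuous_at)
      moreover have "isCont (torus_inv c) z" by (rule isCont_torus_inv) (use True in blast)
      ultimately have "isCont (\<lambda>w. f (torus_inv c w)) z" by (rule isCont_o2[rotated])
      thus ?thesis unfolding F_def[abs_def] by (rule continuous_at_imp_continuous_at_within)
    next
      case False
      then obtain i where i: "z $ i \<in> \<real>\<^sub>\<le>\<^sub>0" by blast
      have "z \<notin> torus_map c ` L"
      proof
        assume "z \<in> torus_map c ` L"
        then obtain x where x: "x \<in> L" "z = torus_map c x" by blast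
        have "z $ i \<noteq> 0" using T1[OF z, of i] by auto
        hence "Arg (z $ i) = pi"
          using i by (auto simp: Arg_eq_pi complex_nonpos_Reals_iff complex_eq_iff less_le)
        hence "torus_inv c z $ i = R" using R by (simp add: torus_inv_def c_def)
        hence "x $ i = R" using inv_L[OF x(1)] x(2) by simp
        thus False using L(2)[OF x(1), of i] R by simp
      qed
      hence "z \<in> - torus_map c ` L" by simp
      then obtain d where d: "d > 0" "ball z d \<subseteq> - torus_map c ` L"
        by (rule openE[OF open_Compl[OF cL]])
      show ?thesis
      proof (rule continuous_transform_within[OF continuous_const d(1) z])
        fix w assume "w \<in> T" "dist w z < d"
        thus "0 = F w" using Fzero[of w] d(2) by (auto simp: dist_commute subset_eq)
      qed
    qed
  qed
  from Stone_Weierstrass_polynomial_function[OF T this e] obtain g where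
    g: "polynomial_function g" "\<And>z. z \<in> T \<Longrightarrow> cmod (F z - g z) < e" by auto
  show ?thesis
  proof (rule that[of "\<lambda>x. g (torus_map c x)"])
    show "trig_poly (pi / R) (\<lambda>x. g (torus_map c x))"
      unfolding c_def[symmetric] by (rule trig_poly_polynomial[OF g(1)])
    fix x :: "real ^ 'n" assume "x \<in> cube (2 * R) 0"
    hence x: "x \<in> K" by (simp add: K_def)
    \<comment> \<open>Outside \<open>L\<close> both sides are 0; the gluing of faces does no harm
      because no point of \<open>L\<close> lies on a face.\<close>
    have "F (torus_map c x) = f x"
    proof (cases "x \<in> L")
      case False
      have "torus_inv c (torus_map c x) \<notin> L"
      proof
        assume y: "torus_inv c (torus_map c x) \<in> L"
        have "x $ i \<noteq> - R" for i using L(2)[OF y, of i] inv_map[OF x, of i] R by auto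
        hence "torus_inv c (torus_map c x) = x" by (simp add: vec_eq_iff inv_map[OF x])
        thus False using y False by simp
      qed
      thus ?thesis using False by (simp add: F_def L(3))
    qed (simp add: F_def inv_L)
    thus "cmod (f x - g (torus_map c x)) < e" using g(2)[of "torus_map c x"] x by (simp add: T_def)
  qed
qed

section \<open>Approximation in the mean on a cube\<close>

lemma open_cube_eq_box: "{x :: real ^ 'n. \<forall>i. \<bar>x $ i\<bar> < R} = box (\<chi> i. - R) (\<chi> i. R)"
proof -
  have "(\<bar>t\<bar> < R) = (- R < t \<and> t < R)" for t by arith
  thus ?thesis by (simp add: set_eq_iff mem_box_cart)
qed

lemma AE_cube_interior:
  assumes "R > 0"
  shows "AE x :: real ^ 'n in lborel. x \<in> cube (2 * R) 0 \<longleftrightarrow> (\<forall>i. \<bar>x $ i\<bar> < R)"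
proof -
  define A where "A = cbox ((\<chi> i. - R) :: real ^ 'n) (\<chi> i. R)"
  define B where "B = box ((\<chi> i. - R) :: real ^ 'n) (\<chi> i. R)"
  have "(\<bar>t\<bar> \<le> R) = (- R \<le> t \<and> t \<le> R)" for t by arith
  hence A: "cube (2 * R) 0 = A"
    by (simp add: A_def set_eq_iff mem_cube mem_box_cart)
  have B: "(\<forall>i. \<bar>x $ i\<bar> < R) = (x \<in> B)" for x
    unfolding B_def open_cube_eq_box[symmetric] by simp
  have BA: "B \<subseteq> A" unfolding A_def B_def by (rule box_subset_cbox)
  have "A - B \<in> null_sets lborel"
    using negligible_frontier_interval[of "(\<chi> i. - R) :: real ^ 'n" "\<chi> i. R"]
    by (simp add: negligible_iff_null_sets null_sets_completion_iff A_def B_def)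
  thus ?thesis
    by (rule AE_I') (use BA A B in auto)
qed

text \<open>Approximation in the \<open>L1\<close> norm is enough, since by Young's inequality it
  controls the quadratic form, and it avoids any convergence question for the Fourier series of
  \<open>a\<close>. The intermediate continuous function lives in the open cube; the faces form a
  null set.\<close>

lemma trig_poly_L1_approx:
  fixes a :: "real ^ 'n \<Rightarrow> complex"
  assumes R: "R > 0" and a: "integrable lborel a" and e: "e > 0"
  obtains p where "trig_poly (pi / R) p" "(LINT x|lborel. indicator (cube (2 * R) 0) x * cmod (a x - p x)) < e"
proof -
  define \<Omega> where "\<Omega> = {x :: real ^ 'n. \<forall>i. \<bar>x $ i\<bar> < R}"
  define K where "K = cube (2 * R) (0 :: real ^ 'n)"
  have O: "open \<Omega>" unfolding \<Omega>_def open_cube_eq_box by (rule open_box)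
  have e2: "e/2 > 0" using e by simp
  obtain f L where f: "continuous_on UNIV f" "compact L" "L \<subseteq> \<Omega>" "\<And>x. x \<notin> L \<Longrightarrow> f x = 0" "integrable lborel f"
    "(LINT x|lborel. cmod (indicator \<Omega> x *\<^sub>R a x - f x)) < e/2"
    using L1_approx_continuous[OF a O e2] by blast
  define m where "m = measure lborel K"
  have m: "m \<ge> 0" by (simp add: m_def)
  have "e / (2 * (m + 1)) > 0" using e m by simp
  then obtain p where p: "trig_poly (pi / R) p" "\<And>x. x \<in> K \<Longrightarrow> cmod (f x - p x) < e / (2 * (m + 1))"
    using trig_poly_uniform_approx[OF R f(1,2) _ f(4), of "e / (2 * (m + 1))"] f(3) unfolding \<Omega>_def K_def by blast
  have [measurable]: "p \<in> borel_measurable borel" "a \<in> borel_measurable borel" "f \<in> borel_measurable borel" "K \<in> sets borel"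
    using p(1) a f(5) by (auto simp: trig_poly_def K_def)
  have Kint: "integrable lborel (indicator K :: _ \<Rightarrow> real)"
    unfolding K_def by (rule integrable_indicator_compact[OF compact_cube])
  show ?thesis
  proof (rule that[OF p(1)])
    have "\<Omega> \<in> sets lborel" using O by simp
    note i1 = Bochner_Integration.integrable_norm[OF Bochner_Integration.integrable_diff[OF
        integrable_mult_indicator[OF this a] f(5)]]
    have i: "integrable lborel (\<lambda>x. cmod (indicator \<Omega> x *\<^sub>R a x - f x) + e / (2 * (m + 1)) * indicator K x)"
      by (intro Bochner_Integration.integrable_add i1 integrable_mult_right Kint)
    have "(LINT x|lborel. indicator K x * cmod (a x - p x)) \<le>
        (LINT x|lborel. cmod (indicator \<Omega> x *\<^sub>R a x - f x) + e / (2 * (m + 1)) * indicator K x)"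
    proof (rule integral_mono_AE'[OF i])
      show "AE x in lborel. indicator K x * cmod (a x - p x) \<le> cmod (indicator \<Omega> x *\<^sub>R a x - f x) + e / (2 * (m + 1)) * indicator K x"
        using AE_cube_interior[OF R]
      proof eventually_elim
        case (elim x)
        show ?case
        proof (cases "x \<in> K")
          case True
          hence "x \<in> \<Omega>" using elim by (simp add: \<Omega>_def K_def)
          have "cmod (a x - p x) \<le> cmod (a x - f x) + cmod (f x - p x)"
            using norm_triangle_ineq[of "a x - f x" "f x - p x"] by simp
          also have "cmod (f x - p x) \<le> e / (2 * (m + 1))" using p(2)[OF True] by simp
          finally show ?thesis using True \<open>x \<in> \<Omega>\<close> by simp
        qed simp
      qed
    qed (use e m in \<open>auto intro!: AE_I2 add_nonneg_nonneg\<close>)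
    also have "\<dots> = (LINT x|lborel. cmod (indicator \<Omega> x *\<^sub>R a x - f x)) + e / (2 * (m + 1)) * m"
      using i1 Kint by (subst Bochner_Integration.integral_add) (auto simp: m_def simp del: times_divide_eq_left)
    also have "\<dots> < e/2 + e/2"
    proof (rule add_less_le_mono[OF f(6)])
      have "m / (m + 1) \<le> 1" using m by simp
      from mult_left_mono[OF this, of "e/2"] show "e / (2 * (m + 1)) * m \<le> e/2" using e by simp
    qed
    finally show "(LINT x|lborel. indicator (cube (2 * R) 0) x * cmod (a x - p x)) < e" by (simp add: K_def)
  qed
qed

section \<open>The quadratic form of a convolution in Fourier coefficients\<close>

text \<open>Unnormalised, unlike \<open>a_coeff\<close>: powers of \<open>2 * R\<close> therefore
  accompany Bessel's inequality but not the diagonal form of a convolution.\<close>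

definition fcoeff :: "real \<Rightarrow> (real ^ 'n \<Rightarrow> complex) \<Rightarrow> int ^ 'n \<Rightarrow> complex" where
  "fcoeff R w n = (LINT x|lborel. w x * cnj (wave (pi / R) n x))"

lemma indicator_cube_L2: "(\<lambda>x :: real ^ 'n. indicator (cube s x0) x :: complex) \<in> L2"
proof (rule L2_bound[OF _ integrable_indicator_compact[OF compact_cube]])
  show "(cmod (indicator (cube s x0) x))\<^sup>2 \<le> indicator (cube s x0) x" for x by (simp add: indicator_def)
qed simp

lemma L2_cube_integrable:
  assumes "w \<in> L2" "\<And>x. x \<notin> cube s x0 \<Longrightarrow> w x = 0"
  shows "integrable lborel (w :: real ^ 'n \<Rightarrow> complex)"
proof -
  have "w = (\<lambda>x. indicator (cube s x0) x * w x)"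
  proof
    fix x show "w x = indicator (cube s x0) x * w x" using assms(2)[of x] by (cases "x \<in> cube s x0") auto
  qed
  thus ?thesis using L2_mult_integrable[OF indicator_cube_L2 assms(1)] by metis
qed

lemma integrable_mult_wave:
  assumes "integrable lborel w"
  shows "integrable lborel (\<lambda>x. w x * wave c n x)" "integrable lborel (\<lambda>x. w x * cnj (wave c n x))"
proof -
  have [measurable]: "w \<in> borel_measurable borel" using assms by auto
  show "integrable lborel (\<lambda>x. w x * wave c n x)" "integrable lborel (\<lambda>x. w x * cnj (wave c n x))"
    by (rule Bochner_Integration.integrable_bound[OF assms]; simp add: norm_mult)+
qed

lemma integrable_cube_indicator: "integrable lborel (\<lambda>x :: real ^ 'n. indicator (cube s x0) x :: complex)"
  by (rule L2_cube_integrable[OF indicator_cube_L2, of s x0]) simp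

lemma wave_orthogonal:
  fixes x0 :: "real ^ 'n"
  assumes "s > 0"
  shows "(LINT x|lborel. indicator (cube s x0) x * (wave (2 * pi / s) n x * cnj (wave (2 * pi / s) m x))) =
    (if n = m then of_real (s ^ CARD('n)) else 0)"
  using integral_wave_cube[OF assms, of x0 "n - m"]
  by (simp add: wave_diff_index[symmetric] scaleR_conv_of_real of_real_indicator)

lemma integrable_trig_poly_cube:
  "integrable lborel (\<lambda>x :: real ^ 'n. indicator (cube s x0) x * (\<Sum>n\<in>S. b n * wave c n x))"
proof -
  have "integrable lborel (\<lambda>x. \<Sum>n\<in>S. b n * (indicator (cube s x0) x * wave c n x))"
    by (intro Bochner_Integration.integrable_sum integrable_mult_right integrable_mult_wave integrable_cube_indicator)
  thus ?thesis by (simp add: sum_distrib_left mult_ac)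
qed

lemma cube_mono: "s \<le> t \<Longrightarrow> cube s x0 \<subseteq> cube t x0"
proof
  fix x assume "s \<le> t" "x \<in> cube s x0"
  hence "\<bar>x $ i - x0 $ i\<bar> \<le> t / 2" for i
    unfolding mem_cube by (meson divide_right_mono order_trans zero_le_numeral)
  thus "x \<in> cube t x0" by (simp add: mem_cube)
qed

text \<open>The waves of period \<open>2 * R\<close> are orthogonal on the doubled cube about
  \<open>x0\<close>, outside which \<open>w\<close> vanishes. Expanding the squared norm of
  \<open>w\<close> minus its projection \<open>p\<close> leaves the squared norm of \<open>w\<close>
  minus \<open>B / D\<close>.\<close>

lemma Bessel_cube:
  fixes w :: "real ^ 'n \<Rightarrow> complex"
  assumes R: "R > 0" and w: "w \<in> L2" "\<And>x. x \<notin> cube R x0 \<Longrightarrow> w x = 0" and S: "finite S"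
  shows "(\<Sum>n\<in>S. (cmod (fcoeff R w n))\<^sup>2) \<le> (2 * R) ^ CARD('n) * (LINT x|lborel. (cmod (w x))\<^sup>2)"
proof -
  define D where "D = (2 * R) ^ CARD('n)"
  have D: "D > 0" using R by (simp add: D_def)
  define c where "c = 2 * pi / (2 * R)"
  have c: "pi / R = c" using R by (simp add: c_def)
  define b where "b n = fcoeff R w n / of_real D" for n
  define K where "K = cube (2 * R) x0"
  define p where "p x = indicator K x * (\<Sum>n\<in>S. b n * wave c n x)" for x
  have wK: "w x = 0" if "x \<notin> K" for x
  proof -
    have "x \<notin> cube R x0" using that cube_mono[of R "2 * R" x0] R unfolding K_def by auto
    thus ?thesis by (rule w(2))
  qed
  have wint: "integrable lborel w" by (rule L2_cube_integrable[OF w])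
  have pint: "integrable lborel p" unfolding p_def[abs_def] K_def by (rule integrable_trig_poly_cube)
  define B where "B = (\<Sum>n\<in>S. (cmod (fcoeff R w n))\<^sup>2)"
  have "p \<in> L2"
  proof -
    have "p = (\<lambda>x. \<Sum>n\<in>S. (b n * wave c n x) * indicator K x)" by (auto simp: p_def sum_distrib_left mult_ac)
    moreover have "(\<lambda>x. \<Sum>n\<in>S. (b n * wave c n x) * indicator K x) \<in> L2"
      unfolding K_def
      by (intro L2_sum L2_bounded_mult[OF indicator_cube_L2, where C = "cmod (b _)"]) (auto simp: norm_mult)
    ultimately show ?thesis by simp
  qed
  note int = L2_mult_integrable[OF w(1) L2_cnj[OF w(1)]] L2_mult_integrable[OF w(1) L2_cnj[OF \<open>p \<in> L2\<close>]]
    L2_mult_integrable[OF \<open>p \<in> L2\<close> L2_cnj[OF w(1)]] L2_mult_integrable[OF \<open>p \<in> L2\<close> L2_cnj[OF \<open>p \<in> L2\<close>]]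
  have wp: "(LINT x|lborel. w x * cnj (p x)) = of_real (B / D)"
  proof -
    have "w x * cnj (p x) = (\<Sum>n\<in>S. cnj (b n) * (w x * cnj (wave c n x)))" for x
      using wK[of x] by (cases "x \<in> K") (auto simp: p_def sum_distrib_left mult_ac)
    hence "(LINT x|lborel. w x * cnj (p x)) = (\<Sum>n\<in>S. cnj (b n) * fcoeff R w n)"
      unfolding fcoeff_def c by (simp add: wint integrable_mult_wave)
    also have "\<dots> = of_real (B / D)"
      by (simp add: b_def B_def sum_divide_distrib complex_norm_square[symmetric] mult.commute del: of_real_power)
    finally show ?thesis .
  qed
  have pw: "(LINT x|lborel. p x * cnj (w x)) = of_real (B / D)"
  proof -
    have "(LINT x|lborel. p x * cnj (w x)) = (LINT x|lborel. cnj (w x * cnj (p x)))" by (simp add: mult.commute)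
    also have "\<dots> = of_real (B / D)" by (subst Bochner_Integration.integral_cnj, subst wp) simp
    finally show ?thesis .
  qed
  have pp: "(LINT x|lborel. p x * cnj (p x)) = of_real (B / D)"
  proof -
    have "p x * cnj (p x) = (\<Sum>n\<in>S. \<Sum>m\<in>S. (b n * cnj (b m)) * (indicator K x * (wave c n x * cnj (wave c m x))))" for x
      by (cases "x \<in> K") (auto simp: p_def sum_product mult_ac)
    hence "(LINT x|lborel. p x * cnj (p x)) = (\<Sum>n\<in>S. \<Sum>m\<in>S. (b n * cnj (b m)) * (LINT x|lborel. indicator K x * (wave c n x * cnj (wave c m x))))"
      by (simp add: K_def wave_diff_index[symmetric] integrable_mult_wave integrable_cube_indicator)
    also have "\<dots> = (\<Sum>n\<in>S. \<Sum>m\<in>S. (b n * cnj (b m)) * (if n = m then of_real D else 0))"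
      unfolding K_def c_def D_def by (subst wave_orthogonal) (use R in simp_all)
    also have "\<dots> = (\<Sum>n\<in>S. b n * cnj (b n) * of_real D)"
      using S by (simp add: if_distrib sum.delta cong: if_cong)
    also have "\<dots> = of_real (B / D)"
      using D by (simp add: b_def B_def sum_divide_distrib complex_norm_square[symmetric] del: of_real_power)
    finally show ?thesis .
  qed
  have "complex_of_real (LINT x|lborel. (cmod (w x - p x))\<^sup>2) =
      (LINT x|lborel. w x * cnj (w x) - w x * cnj (p x) - p x * cnj (w x) + p x * cnj (p x))"
    unfolding integral_complex_of_real[symmetric] complex_norm_square by (simp add: algebra_simps)
  also have "\<dots> = (LINT x|lborel. w x * cnj (w x)) - of_real (B / D) - of_real (B / D) + of_real (B / D)"
    by (simp add: int wp pw pp)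
  also have "(LINT x|lborel. w x * cnj (w x)) = of_real (LINT x|lborel. (cmod (w x))\<^sup>2)"
    unfolding integral_complex_of_real[symmetric] complex_norm_square ..
  finally have "complex_of_real (LINT x|lborel. (cmod (w x - p x))\<^sup>2) = of_real ((LINT x|lborel. (cmod (w x))\<^sup>2) - B / D)"
    by simp
  hence "(LINT x|lborel. (cmod (w x - p x))\<^sup>2) = (LINT x|lborel. (cmod (w x))\<^sup>2) - B / D"
    by (simp only: of_real_eq_iff)
  moreover have "0 \<le> (LINT x|lborel. (cmod (w x - p x))\<^sup>2)" by simp
  ultimately have "0 \<le> (LINT x|lborel. (cmod (w x))\<^sup>2) - B / D" by simp
  thus ?thesis using D by (simp add: B_def D_def field_simps)
qed

section \<open>Diagonalising the quadratic form of a convolution\<close>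

lemma convolution_cube_kernel:
  assumes w: "\<And>x. x \<notin> cube R x0 \<Longrightarrow> w x = 0" and x: "x \<in> cube R x0"
  shows "convolution (\<lambda>x. indicator (cube (2 * R) 0) x * a x) w x = convolution a w x"
  unfolding convolution_def
proof (rule Bochner_Integration.integral_cong[OF refl])
  fix y
  show "indicator (cube (2 * R) 0) (x - y) * a (x - y) * w y = a (x - y) * w y"
    using w[of y] cube_diff[OF x, of y] by (cases "y \<in> cube R x0") auto
qed

lemma form_abs_l2:
  assumes a: "integrable lborel a" and w: "w \<in> L2"
  shows "conv_l2 a (abs_l2 w) \<bullet> abs_l2 w = Re (LINT x|lborel. convolution a w x * cnj (w x))"
  unfolding conv_l2_abs[OF a w] by (rule inner_abs_l2[OF convolution_L2[OF a w] w])

lemma integrable_cube_kernel: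
  assumes "integrable lborel a"
  shows "integrable lborel (\<lambda>x :: real ^ 'n. indicator (cube s x0) x * a x :: complex)"
  using integrable_mult_indicator[OF _ assms, of "cube s x0"]
  by (simp add: scaleR_conv_of_real of_real_indicator)

text \<open>Only \<open>x\<close> and \<open>y\<close> in the cube of side \<open>R\<close> enter
  the form, so the kernel may be altered outside the doubled cube.\<close>

lemma form_cube_kernel:
  assumes a: "integrable lborel a" and w: "w \<in> L2" "\<And>x. x \<notin> cube R x0 \<Longrightarrow> w x = 0"
  shows "conv_l2 (\<lambda>x. indicator (cube (2 * R) 0) x * a x) (abs_l2 w) \<bullet> abs_l2 w = conv_l2 a (abs_l2 w) \<bullet> abs_l2 w"
proof -
  have "convolution (\<lambda>x. indicator (cube (2 * R) 0) x * a x) w x * cnj (w x) = convolution a w x * cnj (w x)" for x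
  proof (cases "x \<in> cube R x0")
    case True
    show ?thesis
      by (rule arg_cong[where f = "\<lambda>z. z * cnj (w x)"], rule convolution_cube_kernel[OF w(2) True])
  qed (simp add: w(2))
  thus ?thesis
    unfolding form_abs_l2[OF a w(1)] form_abs_l2[OF integrable_cube_kernel[OF a] w(1)] by (simp only:)
qed

text \<open>By \<open>wave_diff\<close> each wave of the kernel separates into a function of
  \<open>x\<close> times one of \<open>y\<close>, so it contributes a rank-one form, the squared
  modulus of a Fourier coefficient.\<close>

lemma form_trig_poly:
  fixes w :: "real ^ 'n \<Rightarrow> complex"
  assumes w: "w \<in> L2" "\<And>x. x \<notin> cube R x0 \<Longrightarrow> w x = 0"
  shows "conv_l2 (\<lambda>x. indicator (cube (2 * R) 0) x * (\<Sum>n\<in>S. b n * wave (pi / R) n x)) (abs_l2 w) \<bullet> abs_l2 w =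
    (\<Sum>n\<in>S. Re (b n) * (cmod (fcoeff R w n))\<^sup>2)"
proof -
  define p where "p = (\<lambda>x. \<Sum>n\<in>S. b n * wave (pi / R) n x)"
  have wint: "integrable lborel w" by (rule L2_cube_integrable[OF w])
  have conv: "convolution (\<lambda>x. indicator (cube (2 * R) 0) x * p x) w x * cnj (w x) =
      (\<Sum>n\<in>S. b n * fcoeff R w n * (wave (pi / R) n x * cnj (w x)))" for x
  proof (cases "x \<in> cube R x0")
    case True
    have "convolution (\<lambda>x. indicator (cube (2 * R) 0) x * p x) w x = convolution p w x"
      by (rule convolution_cube_kernel[OF w(2) True])
    also have "\<dots> = (LINT y|lborel. (\<Sum>n\<in>S. b n * wave (pi / R) n x * (w y * cnj (wave (pi / R) n y))))"
      unfolding convolution_def p_def by (simp add: wave_diff sum_distrib_right sum_distrib_left mult_ac)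
    also have "\<dots> = (\<Sum>n\<in>S. b n * wave (pi / R) n x * fcoeff R w n)"
      unfolding fcoeff_def by (simp add: wint integrable_mult_wave)
    finally show ?thesis by (simp add: sum_distrib_right sum_distrib_left mult_ac)
  qed (simp add: w(2))
  have cint: "integrable lborel (\<lambda>x. wave (pi / R) n x * cnj (w x))" for n
    using integrable_mult_wave(1)[of "\<lambda>x. cnj (w x)" "pi / R" n] wint by (simp add: mult.commute)
  have cw: "(LINT x|lborel. wave (pi / R) n x * cnj (w x)) = cnj (fcoeff R w n)" for n
    unfolding fcoeff_def by (subst Bochner_Integration.integral_cnj[symmetric]) (simp add: mult.commute)
  have "(LINT x|lborel. convolution (\<lambda>x. indicator (cube (2 * R) 0) x * p x) w x * cnj (w x)) =
      (\<Sum>n\<in>S. b n * fcoeff R w n * cnj (fcoeff R w n))"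
    unfolding conv by (simp add: cint cw)
  also have "\<dots> = (\<Sum>n\<in>S. b n * of_real ((cmod (fcoeff R w n))\<^sup>2))"
    by (simp add: complex_norm_square mult.assoc del: of_real_power)
  finally show ?thesis
    using form_abs_l2[OF integrable_trig_poly_cube[where s = "2 * R" and ?x0.0 = 0 and S = S and b = b and c = "pi / R"] w(1)]
    unfolding p_def by (simp del: of_real_power)
qed

lemma a_coeff_complex_eq:
  fixes a :: "real ^ 'n \<Rightarrow> complex"
  assumes "R > 0"
  shows "of_real ((2 * R) ^ CARD('n)) * a_coeff_complex a R n =
    (LINT x|lborel. indicator (cube (2 * R) 0) x * a x * cnj (wave (pi / R) n x))"
  using assms
  by (simp add: a_coeff_complex_def set_lebesgue_integral_def wave_def exp_cnj scaleR_conv_of_real of_real_indicator mult.assoc)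

lemma form_diff_bound:
  assumes a: "integrable lborel a" and b: "integrable lborel b" and w: "w \<in> L2"
  shows "\<bar>conv_l2 a (abs_l2 w) \<bullet> abs_l2 w - conv_l2 b (abs_l2 w) \<bullet> abs_l2 w\<bar> \<le>
    (LINT x|lborel. cmod (a x - b x)) * (LINT x|lborel. (cmod (w x))\<^sup>2)"
proof -
  let ?W = "abs_l2 w"
  have "\<bar>conv_l2 a ?W \<bullet> ?W - conv_l2 b ?W \<bullet> ?W\<bar> = \<bar>conv_l2 (\<lambda>x. a x - b x) ?W \<bullet> ?W\<bar>"
    by (simp add: conv_l2_diff_kernel[OF a b] inner_diff_left)
  also have "\<dots> \<le> norm (conv_l2 (\<lambda>x. a x - b x) ?W) * norm ?W" by (rule Cauchy_Schwarz_ineq2)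
  also have "\<dots> \<le> ((LINT x|lborel. cmod (a x - b x)) * norm ?W) * norm ?W"
    by (intro mult_right_mono norm_conv_l2 Bochner_Integration.integrable_diff a b) simp
  also have "\<dots> = (LINT x|lborel. cmod (a x - b x)) * (norm ?W)\<^sup>2" by (simp add: power2_eq_square mult.assoc)
  finally show ?thesis by (simp add: norm_abs_l2[OF w])
qed

text \<open>A finite substitute for the Fourier expansion of the form. The set \<open>S0\<close>
  depends on \<open>a\<close>, \<open>R\<close> and \<open>e\<close> only, and every finite
  \<open>S\<close> above it works, so later arguments may enlarge it. The error has two parts: the
  kernel is replaced by a trigonometric polynomial \<open>p\<close>, and the coefficients of
  \<open>p\<close> by those of \<open>a\<close>, the latter summed with Bessel's inequality.\<close>

lemma form_fourier:
  fixes a :: "real ^ 'n \<Rightarrow> complex"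
  assumes R: "R > 0" and a: "integrable lborel a" and e: "e > 0"
  obtains S0 where "finite S0" "\<And>n. n \<notin> S0 \<Longrightarrow> \<bar>a_coeff a R n\<bar> \<le> e"
    "\<And>x0 w S. w \<in> L2 \<Longrightarrow> (\<And>x. x \<notin> cube R x0 \<Longrightarrow> w x = 0) \<Longrightarrow> finite S \<Longrightarrow> S0 \<subseteq> S \<Longrightarrow>
      \<bar>conv_l2 a (abs_l2 w) \<bullet> abs_l2 w - (\<Sum>n\<in>S. a_coeff a R n * (cmod (fcoeff R w n))\<^sup>2)\<bar>
        \<le> e * (LINT x|lborel. (cmod (w x))\<^sup>2)"
proof -
  define D where "D = (2 * R) ^ CARD('n)"
  have D: "D > 0" using R by (simp add: D_def)
  \<comment> \<open>Half of \<open>e\<close> for each of the two errors in the form; the factor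
    \<open>D\<close> for the decay of the coefficients, which are known up to
    \<open>\<delta> / D\<close>.\<close>
  define \<delta> where "\<delta> = min (e / 2) (e * D)"
  have \<delta>: "\<delta> > 0" "2 * \<delta> \<le> e" "\<delta> / D \<le> e" using e D by (auto simp: \<delta>_def field_simps min_def)
  define K where "K = cube (2 * R) (0 :: real ^ 'n)"
  obtain p where p: "trig_poly (pi / R) p" "(LINT x|lborel. indicator K x * cmod (a x - p x)) < \<delta>"
    unfolding K_def using trig_poly_L1_approx[OF R a \<delta>(1)] by blast
  obtain S0 b where S0: "finite S0" "p = (\<lambda>x. \<Sum>n\<in>S0. b n * wave (pi / R) n x)"
    using p(1) by (auto simp: trig_poly_def)
  define b' where "b' n = (if n \<in> S0 then b n else 0)" for n
  define aK where "aK x = indicator K x * a x" for x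
  define pK where "pK x = indicator K x * p x" for x
  have aK: "integrable lborel aK" unfolding aK_def[abs_def] K_def by (rule integrable_cube_kernel[OF a])
  have pK: "integrable lborel pK" unfolding pK_def[abs_def] K_def S0(2) by (rule integrable_trig_poly_cube)
  have L1: "(LINT x|lborel. cmod (aK x - pK x)) < \<delta>"
  proof -
    have "cmod (aK x - pK x) = indicator K x * cmod (a x - p x)" for x
      by (cases "x \<in> K") (simp_all add: aK_def pK_def)
    thus ?thesis using p(2) by simp
  qed
  have coeff_p: "(LINT x|lborel. pK x * cnj (wave (pi / R) n x)) = of_real D * b' n" for n
  proof -
    have "pK x * cnj (wave (pi / R) n x) = (\<Sum>m\<in>S0. b m * (indicator K x * (wave (pi / R) m x * cnj (wave (pi / R) n x))))" for x
      by (simp add: pK_def S0(2) sum_distrib_left sum_distrib_right mult_ac)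
    hence "(LINT x|lborel. pK x * cnj (wave (pi / R) n x)) =
        (\<Sum>m\<in>S0. b m * (LINT x|lborel. indicator K x * (wave (pi / R) m x * cnj (wave (pi / R) n x))))"
      by (simp add: K_def wave_diff_index[symmetric] integrable_mult_wave integrable_cube_indicator)
    also have "\<dots> = (\<Sum>m\<in>S0. b m * (if m = n then of_real D else 0))"
      unfolding K_def D_def using wave_orthogonal[of "2 * R" "0 :: real ^ 'n" _ n] R by simp
    also have "\<dots> = of_real D * b' n"
      using S0(1) by (simp add: b'_def if_distrib sum.delta cong: if_cong)
    finally show ?thesis .
  qed
  have coeff: "\<bar>a_coeff a R n - Re (b' n)\<bar> \<le> \<delta> / D" for n
  proof -
    have "of_real D * a_coeff_complex a R n = (LINT x|lborel. aK x * cnj (wave (pi / R) n x))"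
      unfolding D_def a_coeff_complex_eq[OF R] aK_def K_def ..
    hence "of_real D * a_coeff_complex a R n - of_real D * b' n =
        (LINT x|lborel. aK x * cnj (wave (pi / R) n x)) - (LINT x|lborel. pK x * cnj (wave (pi / R) n x))"
      by (simp only: coeff_p)
    also have "\<dots> = (LINT x|lborel. (aK x - pK x) * cnj (wave (pi / R) n x))"
      unfolding left_diff_distrib
      by (rule Bochner_Integration.integral_diff[symmetric]) (intro integrable_mult_wave aK pK)+
    also have "cmod \<dots> \<le> (LINT x|lborel. cmod ((aK x - pK x) * cnj (wave (pi / R) n x)))"
      by (rule integral_norm_bound)
    also have "\<dots> \<le> \<delta>" using L1 by (simp add: norm_mult)
    finally have "cmod (of_real D * (a_coeff_complex a R n - b' n)) \<le> \<delta>"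
      by (simp only: right_diff_distrib)
    hence "D * cmod (a_coeff_complex a R n - b' n) \<le> \<delta>"
      using D by (simp only: norm_mult norm_of_real abs_of_pos)
    hence "cmod (a_coeff_complex a R n - b' n) \<le> \<delta> / D" using D by (simp add: field_simps)
    thus ?thesis unfolding a_coeff_def using abs_Re_le_cmod[of "a_coeff_complex a R n - b' n"] by simp
  qed
  show ?thesis
  proof (rule that[OF S0(1)])
    show "\<bar>a_coeff a R n\<bar> \<le> e" if "n \<notin> S0" for n
      using coeff[of n] that \<delta>(3) by (simp add: b'_def)
    fix x0 S and w :: "real ^ 'n \<Rightarrow> complex"
    assume w: "w \<in> L2" "\<And>x. x \<notin> cube R x0 \<Longrightarrow> w x = 0" and S: "finite S" "S0 \<subseteq> S"
    define N where "N = (LINT x|lborel. (cmod (w x))\<^sup>2)"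
    have N: "N \<ge> 0" by (simp add: N_def)
    define q where "q n = (cmod (fcoeff R w n))\<^sup>2" for n
    have q0: "q n \<ge> 0" for n by (simp add: q_def)
    have 1: "\<bar>conv_l2 a (abs_l2 w) \<bullet> abs_l2 w - (\<Sum>n\<in>S0. Re (b n) * q n)\<bar> \<le> \<delta> * N"
    proof -
      have "conv_l2 aK (abs_l2 w) \<bullet> abs_l2 w = conv_l2 a (abs_l2 w) \<bullet> abs_l2 w"
        unfolding aK_def[abs_def] K_def by (rule form_cube_kernel[OF a w])
      moreover have "conv_l2 pK (abs_l2 w) \<bullet> abs_l2 w = (\<Sum>n\<in>S0. Re (b n) * q n)"
        unfolding pK_def[abs_def] K_def S0(2) q_def by (rule form_trig_poly[OF w])
      ultimately have "\<bar>conv_l2 a (abs_l2 w) \<bullet> abs_l2 w - (\<Sum>n\<in>S0. Re (b n) * q n)\<bar> \<le> (LINT x|lborel. cmod (aK x - pK x)) * N"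
        using form_diff_bound[OF aK pK w(1)] by (simp add: N_def)
      also have "\<dots> \<le> \<delta> * N" using L1 N by (intro mult_right_mono) auto
      finally show ?thesis .
    qed
    have 2: "(\<Sum>n\<in>S0. Re (b n) * q n) = (\<Sum>n\<in>S. Re (b' n) * q n)"
      using S by (intro sum.mono_neutral_cong_left) (auto simp: b'_def)
    have "\<bar>(\<Sum>n\<in>S. Re (b' n) * q n) - (\<Sum>n\<in>S. a_coeff a R n * q n)\<bar> = \<bar>\<Sum>n\<in>S. (Re (b' n) - a_coeff a R n) * q n\<bar>"
      by (simp add: sum_subtractf left_diff_distrib)
    also have "\<dots> \<le> (\<Sum>n\<in>S. \<delta> / D * q n)"
    proof (rule order_trans[OF sum_abs sum_mono])
      fix n
      show "\<bar>(Re (b' n) - a_coeff a R n) * q n\<bar> \<le> \<delta> / D * q n"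
        using coeff[of n] q0[of n] by (simp only: abs_mult abs_of_nonneg abs_minus_commute mult_right_mono)
    qed
    also have "\<dots> = \<delta> / D * (\<Sum>n\<in>S. q n)" by (simp add: sum_distrib_left)
    also have "\<dots> \<le> \<delta> / D * (D * N)"
      using Bessel_cube[OF R w S(1)] \<delta>(1) D unfolding q_def N_def D_def by (intro mult_left_mono) auto
    also have "\<dots> = \<delta> * N" using D by simp
    finally have "\<bar>conv_l2 a (abs_l2 w) \<bullet> abs_l2 w - (\<Sum>n\<in>S. a_coeff a R n * q n)\<bar> \<le> 2 * \<delta> * N"
      using 1 unfolding 2 by linarith
    also have "\<dots> \<le> e * N" using \<delta>(2) N by (intro mult_right_mono) auto
    finally show "\<bar>conv_l2 a (abs_l2 w) \<bullet> abs_l2 w - (\<Sum>n\<in>S. a_coeff a R n * (cmod (fcoeff R w n))\<^sup>2)\<bar>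
        \<le> e * (LINT x|lborel. (cmod (w x))\<^sup>2)" by (simp add: q_def N_def)
  qed
qed

text \<open>Up to the \<open>L1\<close> tail of \<open>a\<close> outside the cube,
  \<open>a_coeff a R n\<close> times (2R)^d is the transform sampled at
  \<open>(pi / R) *\<^sub>R rvec n\<close>, hence at least \<open>- m\<close> minus that tail.
  Bessel's inequality converts this into a bound for the form.\<close>

lemma form_lower_bound_cube:
  fixes a :: "real ^ 'n \<Rightarrow> complex"
  assumes R: "R > 0" and a: "integrable lborel a" and w: "w \<in> L2" "\<And>x. x \<notin> cube R x0 \<Longrightarrow> w x = 0"
    and m: "m \<ge> 0" "\<And>x. - m \<le> Re (fourier a x)"
  shows "- (m + (LINT x|lborel. (1 - indicator (cube (2 * R) 0) x) * cmod (a x))) * (LINT x|lborel. (cmod (w x))\<^sup>2)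
    \<le> conv_l2 a (abs_l2 w) \<bullet> abs_l2 w"
proof (rule field_le_epsilon)
  fix e :: real assume e: "e > 0"
  define D where "D = (2 * R) ^ CARD('n)"
  have D: "D > 0" using R by (simp add: D_def)
  define N where "N = (LINT x|lborel. (cmod (w x))\<^sup>2)"
  have N: "N \<ge> 0" by (simp add: N_def)
  define K where "K = cube (2 * R) (0 :: real ^ 'n)"
  have [measurable]: "K \<in> sets borel" "a \<in> borel_measurable borel" using a by (auto simp: K_def)
  define t where "t = (LINT x|lborel. (1 - indicator K x) * cmod (a x))"
  have t: "t \<ge> 0" unfolding t_def by (rule integral_nonneg_AE) (auto simp: indicator_def)
  have coeff: "- (m + t) / D \<le> a_coeff a R n" for n
  proof -
    have i: "integrable lborel (\<lambda>x. indicator K x * a x * cnj (wave (pi / R) n x))"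
      unfolding K_def by (intro integrable_mult_wave integrable_cube_kernel a)
    have "fourier a ((pi / R) *\<^sub>R rvec n) = (LINT x|lborel. a x * cnj (wave (pi / R) n x))"
      unfolding fourier_def wave_def by (simp add: exp_cnj)
    hence "fourier a ((pi / R) *\<^sub>R rvec n) - of_real D * a_coeff_complex a R n =
        (LINT x|lborel. a x * cnj (wave (pi / R) n x)) - (LINT x|lborel. indicator K x * a x * cnj (wave (pi / R) n x))"
      unfolding D_def a_coeff_complex_eq[OF R] K_def by simp
    also have "\<dots> = (LINT x|lborel. a x * cnj (wave (pi / R) n x) - indicator K x * a x * cnj (wave (pi / R) n x))"
      by (rule Bochner_Integration.integral_diff[symmetric]) (intro integrable_mult_wave a i)+
    also have "cmod \<dots> \<le> (LINT x|lborel. cmod (a x * cnj (wave (pi / R) n x) - indicator K x * a x * cnj (wave (pi / R) n x)))"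
      by (rule integral_norm_bound)
    also have "\<dots> = t"
      unfolding t_def by (intro Bochner_Integration.integral_cong refl) (auto simp: indicator_def norm_mult)
    finally have "\<bar>Re (fourier a ((pi / R) *\<^sub>R rvec n)) - D * a_coeff a R n\<bar> \<le> t"
      using abs_Re_le_cmod[of "fourier a ((pi / R) *\<^sub>R rvec n) - of_real D * a_coeff_complex a R n"]
      by (simp add: a_coeff_def)
    hence "- (m + t) \<le> D * a_coeff a R n" using m(2)[of "(pi / R) *\<^sub>R rvec n"] by linarith
    thus ?thesis using D by (simp add: field_simps)
  qed
  have "e / (N + 1) > 0" using e N by simp
  then obtain S0 where S0: "finite S0" "\<bar>conv_l2 a (abs_l2 w) \<bullet> abs_l2 w - (\<Sum>n\<in>S0. a_coeff a R n * (cmod (fcoeff R w n))\<^sup>2)\<bar>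
        \<le> e / (N + 1) * N"
  proof (rule form_fourier[OF R a])
    fix S0
    assume S0: "finite S0" "\<And>x0 v S. v \<in> L2 \<Longrightarrow> (\<And>x. x \<notin> cube R x0 \<Longrightarrow> v x = 0) \<Longrightarrow> finite S \<Longrightarrow> S0 \<subseteq> S \<Longrightarrow>
      \<bar>conv_l2 a (abs_l2 v) \<bullet> abs_l2 v - (\<Sum>n\<in>S. a_coeff a R n * (cmod (fcoeff R v n))\<^sup>2)\<bar>
        \<le> e / (N + 1) * (LINT x|lborel. (cmod (v x))\<^sup>2)"
    show thesis
      by (rule that[OF S0(1)]) (use S0(2)[OF w S0(1) order_refl] in \<open>simp add: N_def\<close>)
  qed
  have "- (m + t) * N = - (m + t) / D * (D * N)" using D by simp
  \<comment> \<open>Bessel's inequality is multiplied by a nonpositive number, which is where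
    \<open>m \<ge> 0\<close> enters.\<close>
  also have "\<dots> \<le> - (m + t) / D * (\<Sum>n\<in>S0. (cmod (fcoeff R w n))\<^sup>2)"
    using Bessel_cube[OF R w S0(1)] m(1) t D unfolding D_def N_def
    by (intro mult_left_mono_neg) (auto simp: field_simps)
  also have "\<dots> = (\<Sum>n\<in>S0. - (m + t) / D * (cmod (fcoeff R w n))\<^sup>2)" by (rule sum_distrib_left)
  also have "\<dots> \<le> (\<Sum>n\<in>S0. a_coeff a R n * (cmod (fcoeff R w n))\<^sup>2)"
    by (intro sum_mono mult_right_mono coeff) simp
  also have "\<dots> \<le> conv_l2 a (abs_l2 w) \<bullet> abs_l2 w + e / (N + 1) * N" using S0(2) by linarith
  also have "e / (N + 1) * N \<le> e" using e N by (simp add: field_simps)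
  finally show "- (m + (LINT x|lborel. (1 - indicator (cube (2 * R) 0) x) * cmod (a x))) * (LINT x|lborel. (cmod (w x))\<^sup>2)
    \<le> conv_l2 a (abs_l2 w) \<bullet> abs_l2 w + e" by (simp add: t_def N_def K_def)
qed

lemma cube_tail_tendsto_0:
  fixes f :: "real ^ 'n \<Rightarrow> real" and s :: "nat \<Rightarrow> real"
  assumes f: "integrable lborel f" and s: "filterlim s at_top sequentially"
  shows "(\<lambda>k. LINT x|lborel. (1 - indicator (cube (s k) 0) x) * f x) \<longlonglongrightarrow> 0"
proof -
  have [measurable]: "f \<in> borel_measurable borel" using f by auto
  have "(\<lambda>k. LINT x|lborel. (1 - indicator (cube (s k) 0) x) * f x) \<longlonglongrightarrow> (LINT x|(lborel :: (real ^ 'n) measure). 0)"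
  proof (rule integral_dominated_convergence[where w = "\<lambda>x. norm (f x)"])
    show "AE x in lborel. (\<lambda>k. (1 - indicator (cube (s k) 0) x) * f x) \<longlonglongrightarrow> 0"
    proof (rule AE_I2)
      fix x :: "real ^ 'n"
      have "\<forall>\<^sub>F k in sequentially. 2 * norm x \<le> s k" using s by (simp add: filterlim_at_top)
      hence "\<forall>\<^sub>F k in sequentially. (1 - indicator (cube (s k) 0) x) * f x = 0"
      proof eventually_elim
        case (elim k)
        have "\<bar>x $ i\<bar> \<le> s k / 2" for i using component_le_norm_cart[of x i] elim by linarith
        hence "x \<in> cube (s k) 0" by (simp add: mem_cube)
        thus ?case by simp
      qed
      thus "(\<lambda>k. (1 - indicator (cube (s k) 0) x) * f x) \<longlonglongrightarrow> 0" by (rule tendsto_eventually)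
    qed
  qed (use f in \<open>auto simp: indicator_def\<close>)
  thus ?thesis by simp
qed

text \<open>The inequality that Plancherel would give, obtained instead by cutting \<open>u\<close>
  off to growing cubes: the tail of \<open>a\<close> and the part of \<open>u\<close> cut away both
  vanish in the limit.\<close>

lemma conv_l2_lower_bound:
  fixes a :: "real ^ 'n::finite \<Rightarrow> complex"
  assumes a: "integrable lborel a" and m: "m \<ge> 0" "\<And>x. - m \<le> Re (fourier a x)"
  shows "- m * (norm u)\<^sup>2 \<le> conv_l2 a u \<bullet> u"
proof -
  define s where "s k = real (Suc k)" for k
  have s: "filterlim s at_top sequentially" "filterlim (\<lambda>k. 2 * s k) at_top sequentially"     unfolding s_def
    by (rule filterlim_compose[OF filterlim_real_sequentially filterlim_Suc],
        rule filterlim_tendsto_pos_mult_at_top[OF tendsto_const _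
          filterlim_compose[OF filterlim_real_sequentially filterlim_Suc]]) simp
  have s0: "s k > 0" for k by (simp add: s_def)
  define w where "w k x = indicator (cube (s k) 0) x * rep_l2 u x" for k x
  have w: "w k \<in> L2" "x \<notin> cube (s k) 0 \<Longrightarrow> w k x = 0" for k x
    unfolding w_def[abs_def] by (auto intro!: L2_bounded_mult[where C = 1] simp: indicator_def)
  have lim: "(\<lambda>k. abs_l2 (w k)) \<longlonglongrightarrow> u"
  proof -
    have "(norm (abs_l2 (w k) - u))\<^sup>2 = (LINT x|lborel. (1 - indicator (cube (s k) 0) x) * (cmod (rep_l2 u x))\<^sup>2)" for k
    proof -
      have "abs_l2 (w k) - u = abs_l2 (\<lambda>x. w k x - rep_l2 u x)"
        using abs_l2_diff[OF w(1), of "rep_l2 u" k] by simp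
      hence "(norm (abs_l2 (w k) - u))\<^sup>2 = (LINT x|lborel. (cmod (w k x - rep_l2 u x))\<^sup>2)"
        by (simp add: norm_abs_l2 L2_diff w(1))
      also have "\<dots> = (LINT x|lborel. (1 - indicator (cube (s k) 0) x) * (cmod (rep_l2 u x))\<^sup>2)"
        by (intro Bochner_Integration.integral_cong refl) (auto simp: w_def indicator_def)
      finally show ?thesis .
    qed
    hence "(\<lambda>k. (norm (abs_l2 (w k) - u))\<^sup>2) \<longlonglongrightarrow> 0"
      using cube_tail_tendsto_0[OF L2_integrable[OF rep_l2_in_L2[of u]] s(1)] by simp
    hence "(\<lambda>k. norm (abs_l2 (w k) - u)) \<longlonglongrightarrow> 0" by simp
    thus ?thesis by (simp only: tendsto_norm_zero_iff LIM_zero_iff)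
  qed
  define t where "t k = (LINT x|lborel. (1 - indicator (cube (2 * s k) 0) x) * cmod (a x))" for k
  have t: "t \<longlonglongrightarrow> 0" unfolding t_def
    by (rule cube_tail_tendsto_0[OF Bochner_Integration.integrable_norm[OF a] s(2)])
  have "- (m + t k) * (norm (abs_l2 (w k)))\<^sup>2 \<le> conv_l2 a (abs_l2 (w k)) \<bullet> abs_l2 (w k)" for k
    unfolding norm_abs_l2[OF w(1)] t_def by (rule form_lower_bound_cube[OF s0 a w m])
  moreover have "(\<lambda>k. - (m + t k) * (norm (abs_l2 (w k)))\<^sup>2) \<longlonglongrightarrow> - (m + 0) * (norm u)\<^sup>2"
    by (intro tendsto_intros t lim)
  moreover have "(\<lambda>k. conv_l2 a (abs_l2 (w k)) \<bullet> abs_l2 (w k)) \<longlonglongrightarrow> conv_l2 a u \<bullet> u"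
    by (intro tendsto_inner bounded_linear.tendsto[OF bounded_linear_conv_l2[OF a]] lim)
  ultimately have "- (m + 0) * (norm u)\<^sup>2 \<le> conv_l2 a u \<bullet> u"
    by (intro LIMSEQ_le) auto
  thus ?thesis by simp
qed

section \<open>Test functions and the eigenvalue count\<close>

text \<open>Gaussian elimination: equation \<open>e\<close> eliminates the unknown \<open>p\<close>.
  In the span of the test waves this produces a nontrivial combination orthogonal to any family of
  vectors that has fewer members than there are waves.\<close>

lemma underdetermined_system:
  fixes M :: "'e \<Rightarrow> 'k \<Rightarrow> 'a::field"
  assumes "finite E" "finite F" "card E < card F"
  shows "\<exists>\<alpha>. (\<exists>k\<in>F. \<alpha> k \<noteq> 0) \<and> (\<forall>e\<in>E. (\<Sum>k\<in>F. \<alpha> k * M e k) = 0)"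
  using assms
proof (induction E arbitrary: F M rule: finite_induct)
  case empty
  hence "F \<noteq> {}" by auto
  thus ?case by (intro exI[of _ "\<lambda>_. 1"]) auto
next
  case (insert e E)
  show ?case
  proof (cases "\<forall>k\<in>F. M e k = 0")
    case True
    have "card E < card F" using insert by simp
    from insert.IH[OF insert.prems(1) this, of M] True show ?thesis by auto
  next
    case False
    then obtain p where p: "p \<in> F" "M e p \<noteq> 0" by blast
    define F' where "F' = F - {p}"
    have F: "F = insert p F'" "p \<notin> F'" "finite F'" using p insert.prems by (auto simp: F'_def)
    have "card E < card F'" using insert p by (simp add: F'_def)
    then obtain \<alpha> where \<alpha>: "\<exists>k\<in>F'. \<alpha> k \<noteq> 0"
      "\<And>d. d \<in> E \<Longrightarrow> (\<Sum>k\<in>F'. \<alpha> k * (M d k - M d p * M e k / M e p)) = 0"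
      using insert.IH[OF F(3), of "\<lambda>d k. M d k - M d p * M e k / M e p"] by blast
    define \<beta> where "\<beta> = \<alpha>(p := - (\<Sum>k\<in>F'. \<alpha> k * M e k) / M e p)"
    have sum: "(\<Sum>k\<in>F. \<beta> k * M d k) = \<beta> p * M d p + (\<Sum>k\<in>F'. \<alpha> k * M d k)" for d
    proof -
      have "(\<Sum>k\<in>F'. \<beta> k * M d k) = (\<Sum>k\<in>F'. \<alpha> k * M d k)"
        using F(2) by (intro sum.cong) (auto simp: \<beta>_def)
      thus ?thesis unfolding F(1) using F by simp
    qed
    have "(\<Sum>k\<in>F. \<beta> k * M d k) = 0" if "d \<in> insert e E" for d
    proof (cases "d = e")
      case True
      thus ?thesis using p unfolding sum by (simp add: \<beta>_def)
    next
      case False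
      hence "(\<Sum>k\<in>F'. \<alpha> k * M d k) - (\<Sum>k\<in>F'. \<alpha> k * M e k) * (M d p / M e p) = 0"
        using \<alpha>(2)[of d] that by (simp add: right_diff_distrib sum_subtractf sum_distrib_left sum_distrib_right mult_ac)
      thus ?thesis unfolding sum by (simp add: \<beta>_def)
    qed
    moreover have "\<exists>k\<in>F. \<beta> k \<noteq> 0" using \<alpha>(1) F by (auto simp: \<beta>_def)
    ultimately show ?thesis by blast
  qed
qed

section \<open>Test functions and their Fourier coefficients\<close>

definition test_fun :: "real \<Rightarrow> real ^ 'n \<Rightarrow> (int ^ 'n) set \<Rightarrow> (int ^ 'n \<Rightarrow> complex) \<Rightarrow> real ^ 'n \<Rightarrow> complex" where
  "test_fun r x0 F \<alpha> x = indicator (cube r x0) x * (\<Sum>k\<in>F. \<alpha> k * wave (2 * pi / r) k x)"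

lemma test_fun_L2: "test_fun r x0 F \<alpha> \<in> L2"
proof -
  have "test_fun r x0 F \<alpha> = (\<lambda>x. \<Sum>k\<in>F. (\<alpha> k * wave (2 * pi / r) k x) * indicator (cube r x0) x)"
    by (rule ext) (simp add: test_fun_def sum_distrib_left mult_ac)
  moreover have "(\<lambda>x. \<Sum>k\<in>F. (\<alpha> k * wave (2 * pi / r) k x) * indicator (cube r x0) x) \<in> L2"
    by (intro L2_sum L2_bounded_mult[OF indicator_cube_L2, where C = "cmod (\<alpha> _)"]) (auto simp: norm_mult)
  ultimately show ?thesis by simp
qed

lemma test_fun_outside: "x \<notin> cube r x0 \<Longrightarrow> test_fun r x0 F \<alpha> x = 0"
  by (simp add: test_fun_def)

lemma test_fun_pairing:
  assumes "v \<in> L2"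
  shows "(LINT x|lborel. test_fun r x0 F \<alpha> x * cnj (v x)) =
    (\<Sum>k\<in>F. \<alpha> k * (LINT x|lborel. indicator (cube r x0) x * (wave (2 * pi / r) k x * cnj (v x))))"
proof -
  have int: "integrable lborel (\<lambda>x. indicator (cube r x0) x * (wave (2 * pi / r) k x * cnj (v x)))" for k
    by (intro L2_mult_integrable indicator_cube_L2 L2_bounded_mult[where C = 1] L2_cnj assms) auto
  have "test_fun r x0 F \<alpha> x * cnj (v x) = (\<Sum>k\<in>F. \<alpha> k * (indicator (cube r x0) x * (wave (2 * pi / r) k x * cnj (v x))))" for x
    by (simp add: test_fun_def sum_distrib_left sum_distrib_right mult_ac)
  thus ?thesis using int by simp
qed

lemma test_fun_weighted_square:
  fixes q :: "real ^ 'n \<Rightarrow> complex"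
  assumes q: "q \<in> borel_measurable borel" "\<And>x. cmod (q x) \<le> C"
  shows "(LINT x|lborel. q x * test_fun r x0 F \<alpha> x * cnj (test_fun r x0 F \<alpha> x)) =
    (\<Sum>k\<in>F. \<Sum>l\<in>F. \<alpha> k * cnj (\<alpha> l) * (LINT x|lborel. indicator (cube r x0) x * (q x * wave (2 * pi / r) (k - l) x)))"
proof -
  have int: "integrable lborel (\<lambda>x. indicator (cube r x0) x * (q x * wave (2 * pi / r) n x))" for n
  proof -
    have "integrable lborel (\<lambda>x. (q x * indicator (cube r x0) x) * (wave (2 * pi / r) n x * indicator (cube r x0) x))"
      by (intro L2_mult_integrable L2_bounded_mult[OF indicator_cube_L2 q]
          L2_bounded_mult[OF indicator_cube_L2, where C = 1]) auto
    moreover have "(q x * indicator (cube r x0) x) * (wave (2 * pi / r) n x * indicator (cube r x0) x) =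
        indicator (cube r x0) x * (q x * wave (2 * pi / r) n x)" for x
      by (cases "x \<in> cube r x0") auto
    ultimately show ?thesis by simp
  qed
  have "q x * test_fun r x0 F \<alpha> x * cnj (test_fun r x0 F \<alpha> x) =
      (\<Sum>k\<in>F. \<Sum>l\<in>F. \<alpha> k * cnj (\<alpha> l) * (indicator (cube r x0) x * (q x * wave (2 * pi / r) (k - l) x)))" for x
    by (cases "x \<in> cube r x0")
       (auto simp: test_fun_def sum_product sum_distrib_left wave_diff_index mult_ac)
  thus ?thesis using int by simp
qed

lemma test_fun_norm:
  fixes x0 :: "real ^ 'n"
  assumes r: "r > 0" and F: "finite F"
  shows "(LINT x|lborel. (cmod (test_fun r x0 F \<alpha> x))\<^sup>2) = r ^ CARD('n) * (\<Sum>k\<in>F. (cmod (\<alpha> k))\<^sup>2)"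
proof -
  have "complex_of_real (LINT x|lborel. (cmod (test_fun r x0 F \<alpha> x))\<^sup>2) =
      (LINT x|lborel. 1 * test_fun r x0 F \<alpha> x * cnj (test_fun r x0 F \<alpha> x))"
    unfolding integral_complex_of_real[symmetric] complex_norm_square by simp
  also have "\<dots> = (\<Sum>k\<in>F. \<Sum>l\<in>F. \<alpha> k * cnj (\<alpha> l) * (LINT x|lborel. indicator (cube r x0) x * (1 * wave (2 * pi / r) (k - l) x)))"
    by (rule test_fun_weighted_square[where C = 1]) auto
  also have "\<dots> = (\<Sum>k\<in>F. \<Sum>l\<in>F. \<alpha> k * cnj (\<alpha> l) * (if k = l then of_real (r ^ CARD('n)) else 0))"
    by (simp add: wave_diff_index wave_orthogonal[OF r])
  also have "\<dots> = (\<Sum>k\<in>F. of_real (r ^ CARD('n)) * (\<alpha> k * cnj (\<alpha> k)))"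
    using F by (simp add: if_distrib sum.delta mult_ac cong: if_cong)
  also have "\<dots> = of_real (r ^ CARD('n) * (\<Sum>k\<in>F. (cmod (\<alpha> k))\<^sup>2))"
    by (simp add: complex_norm_square[symmetric] sum_distrib_left del: of_real_power)
  finally show ?thesis by (simp only: of_real_eq_iff)
qed

text \<open>By \<open>wave_double\<close>, pairing with an even frequency of period
  \<open>2 * r\<close> is pairing with a wave of period \<open>r\<close>, and these are orthogonal
  on the cube.\<close>

lemma test_fun_fcoeff_even:
  fixes x0 :: "real ^ 'n"
  assumes r: "r > 0" and F: "finite F"
  shows "fcoeff r (test_fun r x0 F \<alpha>) (2 *s m) = (if m \<in> F then of_real (r ^ CARD('n)) * \<alpha> m else 0)"
proof -
  define K where "K = cube r x0"
  have "test_fun r x0 F \<alpha> x * cnj (wave (pi / r) (2 *s m) x) =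
      (\<Sum>k\<in>F. \<alpha> k * (indicator K x * (wave (2 * pi / r) k x * cnj (wave (2 * pi / r) m x))))" for x
    by (simp add: test_fun_def K_def wave_double sum_distrib_left sum_distrib_right mult_ac)
  hence "fcoeff r (test_fun r x0 F \<alpha>) (2 *s m) =
      (\<Sum>k\<in>F. \<alpha> k * (LINT x|lborel. indicator K x * (wave (2 * pi / r) k x * cnj (wave (2 * pi / r) m x))))"
    unfolding fcoeff_def by (simp add: K_def wave_diff_index[symmetric] integrable_mult_wave integrable_cube_indicator)
  also have "\<dots> = (\<Sum>k\<in>F. \<alpha> k * (if k = m then of_real (r ^ CARD('n)) else 0))"
    unfolding K_def wave_orthogonal[OF r] ..
  also have "\<dots> = (if m \<in> F then of_real (r ^ CARD('n)) * \<alpha> m else 0)"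
    using F by (simp add: if_distrib sum.delta mult_ac cong: if_cong)
  finally show ?thesis .
qed

lemma even_lattice_eq: "even_lattice = range ((*s) 2)"
proof
  show "even_lattice \<subseteq> range ((*s) (2 :: int) :: int ^ 'n \<Rightarrow> _)"
  proof
    fix n :: "int ^ 'n" assume "n \<in> even_lattice"
    hence "n = 2 *s (\<chi> i. n $ i div 2)" by (simp add: even_lattice_def vec_eq_iff)
    thus "n \<in> range ((*s) 2)" by blast
  qed
qed (auto simp: even_lattice_def)

lemma infinite_odd_indices: "infinite (UNIV - even_lattice :: (int ^ 'n) set)"
proof -
  have "inj (\<lambda>k. \<chi> i. 2 * int k + 1 :: int ^ 'n)" by (auto simp: inj_def vec_eq_iff)
  hence "infinite (range (\<lambda>k. \<chi> i. 2 * int k + 1 :: int ^ 'n))" by (rule range_inj_infinite)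
  moreover have "range (\<lambda>k. \<chi> i. 2 * int k + 1 :: int ^ 'n) \<subseteq> UNIV - even_lattice"
    by (auto simp: even_lattice_def)
  ultimately show ?thesis by (rule infinite_super[rotated])
qed

text \<open>The coefficients tend to zero, so an upper bound over infinitely many indices is nonnegative.\<close>

lemma odd_bound_nonneg:
  assumes r: "r > 0" and a: "integrable lborel (a :: real ^ 'n \<Rightarrow> complex)"
    and s: "\<And>n. n \<notin> even_lattice \<Longrightarrow> a_coeff a r n \<le> s"
  shows "s \<ge> 0"
proof (rule field_le_epsilon)
  fix e :: real assume e: "e > 0"
  obtain S0 where S0: "finite S0" "\<And>n. n \<notin> S0 \<Longrightarrow> \<bar>a_coeff a r n\<bar> \<le> e"
    using form_fourier[OF r a e] by metis
  have "\<not> UNIV - even_lattice \<subseteq> S0" using infinite_odd_indices S0(1) finite_subset by blast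
  then obtain n where "n \<notin> even_lattice" "n \<notin> S0" by blast
  thus "0 \<le> s + e" using s[of n] S0(2)[of n] by linarith
qed

text \<open>At even indices the coefficients are explicit, and r^(2d) against the factor r^d in the
  squared norm leaves r^d. At the others \<open>s\<close> is multiplied by the full Bessel bound,
  even part included, which is legitimate because \<open>s \<ge> 0\<close>.\<close>

lemma test_fun_conv_bound:
  fixes a :: "real ^ 'n::finite \<Rightarrow> complex" and x0 :: "real ^ 'n" and \<alpha> :: "int ^ 'n \<Rightarrow> complex"
  assumes r: "r > 0" and a: "integrable lborel a" and F: "finite F"
    and M: "\<And>k. k \<in> F \<Longrightarrow> a_coeff a r (2 *s k) \<le> M"
    and s: "\<And>n. n \<notin> even_lattice \<Longrightarrow> a_coeff a r n \<le> s"
  defines "u \<equiv> test_fun r x0 F \<alpha>"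
  shows "conv_l2 a (abs_l2 u) \<bullet> abs_l2 u \<le>
    (r ^ CARD('n) * M + (2 * r) ^ CARD('n) * s) * (LINT x|lborel. (cmod (u x))\<^sup>2)"
proof (rule field_le_epsilon)
  fix e :: real assume e: "e > 0"
  define N where "N = (LINT x|lborel. (cmod (u x))\<^sup>2)"
  have N: "N \<ge> 0" by (simp add: N_def)
  have u: "u \<in> L2" "\<And>x. x \<notin> cube r x0 \<Longrightarrow> u x = 0"
    unfolding u_def by (rule test_fun_L2, rule test_fun_outside)
  have s0: "s \<ge> 0" by (rule odd_bound_nonneg[OF r a s])
  define q where "q n = (cmod (fcoeff r u n))\<^sup>2" for n
  have q0: "q n \<ge> 0" for n by (simp add: q_def)
  have "e / (N + 1) > 0" using e N by simp
  then obtain S0 where S0: "finite S0" "\<And>S. finite S \<Longrightarrow> S0 \<subseteq> S \<Longrightarrow>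
      \<bar>conv_l2 a (abs_l2 u) \<bullet> abs_l2 u - (\<Sum>n\<in>S. a_coeff a r n * q n)\<bar> \<le> e / (N + 1) * N"
  proof (rule form_fourier[OF r a])
    fix S0
    assume S0: "finite S0" "\<And>x0 v S. v \<in> L2 \<Longrightarrow> (\<And>x. x \<notin> cube r x0 \<Longrightarrow> v x = 0) \<Longrightarrow> finite S \<Longrightarrow> S0 \<subseteq> S \<Longrightarrow>
      \<bar>conv_l2 a (abs_l2 v) \<bullet> abs_l2 v - (\<Sum>n\<in>S. a_coeff a r n * (cmod (fcoeff r v n))\<^sup>2)\<bar>
        \<le> e / (N + 1) * (LINT x|lborel. (cmod (v x))\<^sup>2)"
    show thesis
      by (rule that[OF S0(1)]) (use S0(2)[OF u] in \<open>simp add: N_def q_def\<close>)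
  qed
  \<comment> \<open>Adding the doubled indices ensures that all nonzero even coefficients are
    counted, whatever \<open>S0\<close> is.\<close>
  define S where "S = S0 \<union> (*s) 2 ` F"
  have S: "finite S" "S0 \<subseteq> S" using S0(1) F by (auto simp: S_def)
  have inj: "inj_on ((*s) (2 :: int) :: int ^ 'n \<Rightarrow> _) F" by (auto simp: inj_on_def vec_eq_iff)
  have even: "(\<Sum>n\<in>S \<inter> even_lattice. a_coeff a r n * q n) \<le> r ^ CARD('n) * M * N"
  proof -
    have "(\<Sum>n\<in>S \<inter> even_lattice. a_coeff a r n * q n) = (\<Sum>n\<in>(*s) 2 ` F. a_coeff a r n * q n)"
    proof (rule sum.mono_neutral_right)
      show "\<forall>n\<in>S \<inter> even_lattice - (*s) 2 ` F. a_coeff a r n * q n = 0"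
              proof
        fix n assume n: "n \<in> S \<inter> even_lattice - (*s) 2 ` F"
        then obtain k where k: "n = 2 *s k" unfolding even_lattice_eq by blast
        hence "k \<notin> F" using n by blast
        thus "a_coeff a r n * q n = 0" by (simp add: k q_def u_def test_fun_fcoeff_even[OF r F])
      qed
    qed (use S in \<open>auto simp: S_def even_lattice_eq\<close>)
    also have "\<dots> = (\<Sum>k\<in>F. a_coeff a r (2 *s k) * q (2 *s k))"
      by (subst sum.reindex[OF inj]) simp
    also have "\<dots> = (\<Sum>k\<in>F. a_coeff a r (2 *s k) * ((r ^ CARD('n))\<^sup>2 * (cmod (\<alpha> k))\<^sup>2))"
      using r by (intro sum.cong refl) (simp add: q_def u_def test_fun_fcoeff_even[OF r F] norm_mult power_mult_distrib norm_power)
    also have "\<dots> \<le> (\<Sum>k\<in>F. M * ((r ^ CARD('n))\<^sup>2 * (cmod (\<alpha> k))\<^sup>2))"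
      by (intro sum_mono mult_right_mono M) auto
    also have "\<dots> = r ^ CARD('n) * M * N"
      unfolding N_def u_def test_fun_norm[OF r F] by (simp add: sum_distrib_left power2_eq_square mult_ac)
    finally show ?thesis .
  qed
  have odd: "(\<Sum>n\<in>S - even_lattice. a_coeff a r n * q n) \<le> (2 * r) ^ CARD('n) * s * N"
  proof -
    have "(\<Sum>n\<in>S - even_lattice. a_coeff a r n * q n) \<le> (\<Sum>n\<in>S - even_lattice. s * q n)"
      using s q0 by (intro sum_mono mult_right_mono) auto
    also have "\<dots> = s * (\<Sum>n\<in>S - even_lattice. q n)" by (simp add: sum_distrib_left)
    also have "\<dots> \<le> s * ((2 * r) ^ CARD('n) * N)"
      unfolding q_def N_def by (intro mult_left_mono Bessel_cube[OF r u] s0) (use S in auto)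
    finally show ?thesis by (simp add: mult_ac)
  qed
  have "conv_l2 a (abs_l2 u) \<bullet> abs_l2 u \<le> (\<Sum>n\<in>S. a_coeff a r n * q n) + e / (N + 1) * N"
    using S0(2)[OF S] by linarith
  also have "(\<Sum>n\<in>S. a_coeff a r n * q n) =
      (\<Sum>n\<in>S \<inter> even_lattice. a_coeff a r n * q n) + (\<Sum>n\<in>S - even_lattice. a_coeff a r n * q n)"
    by (rule sum.Int_Diff[OF S(1)])
  also have "e / (N + 1) * N \<le> e" using e N by (simp add: field_simps)
  finally show "conv_l2 a (abs_l2 u) \<bullet> abs_l2 u \<le>
    (r ^ CARD('n) * M + (2 * r) ^ CARD('n) * s) * (LINT x|lborel. (cmod (u x))\<^sup>2) + e"
    using even odd unfolding N_def[symmetric] by (simp add: algebra_simps)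
qed

section \<open>The potential term\<close>

lemma cnj_indicator: "cnj (indicator A x) = indicator A x"
  by (simp add: indicator_def)

text \<open>Moving the cube to the origin costs only a phase, so the moduli, which alone enter
  \<open>nu\<close>, are unchanged.\<close>

lemma V_coeff_translate:
  fixes V :: "real ^ 'n \<Rightarrow> complex"
  assumes [measurable]: "V \<in> borel_measurable borel"
  shows "(LINT x|lborel. indicator (cube r x0) x * ((V x - of_real (inf_val V)) * wave (2 * pi / r) n x)) =
    wave (2 * pi / r) n x0 * V_coeff V r x0 n"
proof -
  define f where "f x = indicator (cube r x0) x * ((V x - of_real (inf_val V)) * wave (2 * pi / r) n x)" for x
  have [measurable]: "f \<in> borel_measurable borel" unfolding f_def[abs_def] by measurable
  have ind: "indicator (cube r x0) (x + x0) = (indicator (cube r 0) x :: complex)" for x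
    by (simp add: indicator_def mem_cube)
  have "(LINT x|lborel. f x) = (LINT x|lborel. f (x + x0))" by (rule integral_translate[symmetric]) measurable
  also have "\<dots> = (LINT x|lborel. wave (2 * pi / r) n x0 *
      (indicator (cube r 0) x *\<^sub>R ((V (x + x0) - of_real (inf_val V)) * exp (\<i> * of_real (2 * pi / r * (rvec n \<bullet> x))))))"
    by (intro Bochner_Integration.integral_cong refl)
       (simp only: f_def ind wave_add wave_def[symmetric] scaleR_conv_of_real of_real_indicator, simp only: mult_ac)
  also have "\<dots> = wave (2 * pi / r) n x0 * V_coeff V r x0 n"
    unfolding V_coeff_def set_lebesgue_integral_def by (rule Bochner_Integration.integral_mult_right_zero)
  finally show ?thesis by (simp add: f_def)
qed

text \<open>Schur's test: the moduli of \<open>W (k - l)\<close> are symmetric because the potential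
  is real, so row sums bound the form. Expressing the result through the norm of the test function
  gives the factor 1/r^d that also stands in \<open>nu\<close>.\<close>

lemma test_fun_potential_bound:
  fixes V :: "real ^ 'n::finite \<Rightarrow> complex" and x0 :: "real ^ 'n" and \<alpha> :: "int ^ 'n \<Rightarrow> complex"
  assumes r: "r > 0" and F: "finite F"
    and V: "V \<in> borel_measurable borel" "\<And>x. cmod (V x) \<le> C" "\<And>x. Im (V x) = 0"
    and N: "\<And>k. k \<in> F \<Longrightarrow> (\<Sum>l\<in>F. cmod (V_coeff V r x0 (k - l))) \<le> N"
  defines "u \<equiv> test_fun r x0 F \<alpha>"
  shows "mult_l2 (\<lambda>x. V x - of_real (inf_val V)) (abs_l2 u) \<bullet> abs_l2 u \<le>
    N / r ^ CARD('n) * (LINT x|lborel. (cmod (u x))\<^sup>2)"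
proof -
  define q where "q x = V x - of_real (inf_val V)" for x
  interpret q: bounded_function q "C + \<bar>inf_val V\<bar>"
  proof
    note [measurable] = V(1)
    show "q \<in> borel_measurable borel" unfolding q_def[abs_def] by measurable
    show "cmod (q x) \<le> C + \<bar>inf_val V\<bar>" for x
      using norm_triangle_ineq4[of "V x" "of_real (inf_val V)"] V(2)[of x] by (simp add: q_def)
  qed
  define W where "W n = (LINT x|lborel. indicator (cube r x0) x * (q x * wave (2 * pi / r) n x))" for n
  have cW: "cmod (W n) = cmod (V_coeff V r x0 n)" for n
    unfolding W_def q_def V_coeff_translate[OF V(1)] by (simp add: norm_mult)
  have qr: "cnj (q x) = q x" for x using V(3)[of x] by (simp add: q_def complex_eq_iff)
  have Wm: "W (- n) = cnj (W n)" for n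
    unfolding W_def
    by (subst Bochner_Integration.integral_cnj[symmetric]) (simp add: wave_minus_index qr cnj_indicator)
  have sym: "cmod (W (l - k)) = cmod (W (k - l))" for k l
    using Wm[of "k - l"] by simp
  have uL2: "u \<in> L2" unfolding u_def by (rule test_fun_L2)
  have qu: "(\<lambda>x. q x * u x) \<in> L2" by (rule L2_bounded_mult[OF uL2 q.measurable_g q.bounded_g])
  have "mult_l2 q (abs_l2 u) \<bullet> abs_l2 u = Re (LINT x|lborel. q x * u x * cnj (u x))"
    unfolding q.mult_l2_abs[OF uL2] by (rule inner_abs_l2[OF qu uL2])
  also have "(LINT x|lborel. q x * u x * cnj (u x)) = (\<Sum>k\<in>F. \<Sum>l\<in>F. \<alpha> k * cnj (\<alpha> l) * W (k - l))"
    unfolding W_def u_def by (rule test_fun_weighted_square[OF q.measurable_g q.bounded_g])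
  also have "Re \<dots> \<le> cmod \<dots>" by (rule complex_Re_le_cmod)
  also have "\<dots> \<le> (\<Sum>k\<in>F. \<Sum>l\<in>F. ((cmod (\<alpha> k))\<^sup>2 + (cmod (\<alpha> l))\<^sup>2) / 2 * cmod (W (k - l)))"
  proof (intro order_trans[OF norm_sum] sum_mono)
    fix k l
    have "cmod (\<alpha> k) * cmod (\<alpha> l) \<le> ((cmod (\<alpha> k))\<^sup>2 + (cmod (\<alpha> l))\<^sup>2) / 2"
      using sum_squares_bound[of "cmod (\<alpha> k)" "cmod (\<alpha> l)"] by simp
    thus "cmod (\<alpha> k * cnj (\<alpha> l) * W (k - l)) \<le> ((cmod (\<alpha> k))\<^sup>2 + (cmod (\<alpha> l))\<^sup>2) / 2 * cmod (W (k - l))"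
      by (simp only: norm_mult complex_mod_cnj mult_right_mono norm_ge_zero)
  qed
  also have "\<dots> = (\<Sum>k\<in>F. \<Sum>l\<in>F. (cmod (\<alpha> k))\<^sup>2 / 2 * cmod (W (k - l))) + (\<Sum>k\<in>F. \<Sum>l\<in>F. (cmod (\<alpha> l))\<^sup>2 / 2 * cmod (W (k - l)))"
    by (simp only: add_divide_distrib distrib_right sum.distrib)
  also have "(\<Sum>k\<in>F. \<Sum>l\<in>F. (cmod (\<alpha> l))\<^sup>2 / 2 * cmod (W (k - l))) = (\<Sum>k\<in>F. \<Sum>l\<in>F. (cmod (\<alpha> k))\<^sup>2 / 2 * cmod (W (k - l)))"
    by (subst sum.swap) (simp only: sym)
  also have "\<dots> + \<dots> = (\<Sum>k\<in>F. (cmod (\<alpha> k))\<^sup>2 * (\<Sum>l\<in>F. cmod (W (k - l))))"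
    by (simp add: sum_distrib_left sum.distrib[symmetric] mult.commute)
  also have "\<dots> \<le> (\<Sum>k\<in>F. (cmod (\<alpha> k))\<^sup>2 * N)"
    by (intro sum_mono mult_left_mono) (use N in \<open>auto simp: cW\<close>)
  also have "\<dots> = N / r ^ CARD('n) * (LINT x|lborel. (cmod (u x))\<^sup>2)"
    unfolding u_def test_fun_norm[OF r F] using r by (simp add: sum_distrib_left mult.commute)
  finally show ?thesis unfolding q_def[abs_def] .
qed

section \<open>Real transforms, bounded coefficients and square roots\<close>

lemma fourier_real:
  fixes u :: "real ^ 'n \<Rightarrow> complex"
  assumes "hermitian_L1 u"
  shows "Im (fourier u x) = 0"
proof -
  have u: "integrable lborel u" and sym: "AE x in lborel. u (- x) = cnj (u x)"
    using assms by (auto simp: hermitian_L1_def)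
  define f where "f \<xi> = u \<xi> * exp (- (\<i> * of_real (x \<bullet> \<xi>)))" for \<xi>
  have [measurable]: "u \<in> borel_measurable borel" using u by auto
  have fm [measurable]: "f \<in> borel_measurable borel"
    using integrable_fourier_integrand[OF u, of x] unfolding f_def[abs_def] by auto
  have "fourier u x = (LINT \<xi>|lborel. f (0 - \<xi>))"
    unfolding fourier_def f_def[symmetric] by (rule integral_reflect[OF fm, symmetric])
  also have "\<dots> = (LINT \<xi>|lborel. cnj (f \<xi>))"
    by (rule integral_cong_AE)
       (measurable, use sym in \<open>eventually_elim, simp add: f_def exp_cnj\<close>)
  also have "\<dots> = cnj (fourier u x)"
    unfolding fourier_def f_def[symmetric] by (rule Bochner_Integration.integral_cnj)
  finally show ?thesis by (simp add: complex_eq_iff)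
qed

text \<open>Real-valued \<open>SUP\<close> and \<open>INF\<close> over the coefficients obey the
  usual rules only once boundedness is known; here it follows from the decay, with finitely many
  exceptions.\<close>

lemma a_coeff_bounded:
  fixes a :: "real ^ 'n \<Rightarrow> complex"
  assumes "r > 0" "integrable lborel a"
  obtains B where "\<And>n. \<bar>a_coeff a r n\<bar> \<le> B"
proof -
  obtain S0 where S0: "finite S0" "\<And>n. n \<notin> S0 \<Longrightarrow> \<bar>a_coeff a r n\<bar> \<le> 1"
    using form_fourier[OF assms zero_less_one] by metis
  have "\<bar>a_coeff a r n\<bar> \<le> 1 + (\<Sum>n\<in>S0. \<bar>a_coeff a r n\<bar>)" for n
  proof (cases "n \<in> S0")
    case True
    thus ?thesis using member_le_sum[of n S0 "\<lambda>n. \<bar>a_coeff a r n\<bar>"] S0(1) by simp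
  next
    case False
    have "0 \<le> (\<Sum>n\<in>S0. \<bar>a_coeff a r n\<bar>)" by (simp add: sum_nonneg)
    thus ?thesis using S0(2)[OF False] by linarith
  qed
  thus ?thesis by (rule that)
qed

text \<open>Passes the decay of \<open>V\<close> at infinity on to
  \<open>sqrt (m + Re (V x)) - sqrt m\<close>, uniformly in \<open>m\<close> and so also for
  \<open>m = 0\<close>, where the square root is not differentiable.\<close>

lemma abs_sqrt_diff_le:
  assumes "x \<ge> 0" "y \<ge> 0"
  shows "\<bar>sqrt x - sqrt y\<bar> \<le> sqrt \<bar>x - y\<bar>"
proof (rule real_le_rsqrt)
  have "\<bar>sqrt x - sqrt y\<bar> \<le> sqrt x + sqrt y"
    using real_sqrt_ge_zero[OF assms(1)] real_sqrt_ge_zero[OF assms(2)] by linarith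
  hence "\<bar>sqrt x - sqrt y\<bar>\<^sup>2 \<le> \<bar>sqrt x - sqrt y\<bar> * (sqrt x + sqrt y)"
    unfolding power2_eq_square by (intro mult_left_mono) auto
  also have "\<dots> = \<bar>(sqrt x - sqrt y) * (sqrt x + sqrt y)\<bar>"
    using assms by (simp add: abs_mult)
  also have "(sqrt x - sqrt y) * (sqrt x + sqrt y) = x - y"
    using assms by (simp add: algebra_simps)
  finally show "\<bar>sqrt x - sqrt y\<bar>\<^sup>2 \<le> \<bar>x - y\<bar>" .
qed

section \<open>The complex structure and linear independence\<close>

lemma scaleC_l2_eq_mult: "scaleC_l2 c u = mult_l2 (\<lambda>_. c) u"
  by (simp add: scaleC_l2_def mult_l2_def)

lemma bounded_linear_scaleC: "bounded_linear (scaleC_l2 c :: 'n::finite l2 \<Rightarrow> 'n l2)"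
proof -
  interpret bounded_function "\<lambda>_ :: real ^ 'n. c" "cmod c" by unfold_locales auto
  show ?thesis using bounded_linear_mult_l2 by (simp add: scaleC_l2_eq_mult[abs_def])
qed

lemma scaleC_decompose: "scaleC_l2 c u = Re c *\<^sub>R u + Im c *\<^sub>R scaleC_l2 \<i> u"
  by (rule l2_eqI)
     (use rep_l2_scaleC[of c u] rep_l2_scaleC[of \<i> u] rep_l2_scaleR[of "Re c" u] rep_l2_scaleR[of "Im c" "scaleC_l2 \<i> u"]
        rep_l2_add[of "Re c *\<^sub>R u" "Im c *\<^sub>R scaleC_l2 \<i> u"]
      in \<open>eventually_elim, simp add: complex_eq_iff\<close>)

lemma inner_scaleC_i_left: "scaleC_l2 \<i> u \<bullet> v = - (u \<bullet> scaleC_l2 \<i> v)"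
proof -
  have "(LINT x|lborel. rep_l2 (scaleC_l2 \<i> u) x * cnj (rep_l2 v x)) =
      (LINT x|lborel. (-1) * (rep_l2 u x * cnj (rep_l2 (scaleC_l2 \<i> v) x)))"
    by (rule integral_cong_AE; (intro borel_measurable_integrable integrable_mult_right inner_l2_integrable)?)
       (use rep_l2_scaleC[of \<i> u] rep_l2_scaleC[of \<i> v] in \<open>eventually_elim, simp\<close>)
  thus ?thesis by (simp add: inner_l2_def)
qed

lemma inner_scaleC_i_self: "u \<bullet> scaleC_l2 \<i> u = 0"
  using inner_scaleC_i_left[of u u] by (simp add: inner_commute)

lemma inner_scaleC_i_both: "scaleC_l2 \<i> u \<bullet> scaleC_l2 \<i> v = u \<bullet> v"
proof -
  have "(LINT x|lborel. rep_l2 (scaleC_l2 \<i> u) x * cnj (rep_l2 (scaleC_l2 \<i> v) x)) =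
      (LINT x|lborel. rep_l2 u x * cnj (rep_l2 v x))"
    by (rule integral_cong_AE; (intro borel_measurable_integrable integrable_mult_right inner_l2_integrable)?)
       (use rep_l2_scaleC[of \<i> u] rep_l2_scaleC[of \<i> v] in \<open>eventually_elim, simp add: complex_eq_iff algebra_simps\<close>)
  thus ?thesis by (simp add: inner_l2_def)
qed

lemma rep_l2_sum:
  assumes "finite A"
  shows "AE x in lborel. rep_l2 (\<Sum>i\<in>A. scaleC_l2 (c i) (u i)) x = (\<Sum>i\<in>A. c i * rep_l2 (u i) x)"
  using assms
proof (induction A rule: finite_induct)
  case empty
  thus ?case using rep_l2_zero by simp
next
  case (insert i A)
  from insert.IH rep_l2_add[of "scaleC_l2 (c i) (u i)" "\<Sum>i\<in>A. scaleC_l2 (c i) (u i)"] rep_l2_scaleC[of "c i" "u i"]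
  show ?case by eventually_elim (simp add: insert.hyps)
qed

text \<open>Pairing the relation with \<open>u j\<close> isolates the real part of
  \<open>c j\<close>, pairing it with \<open>scaleC_l2 \<i> (u j)\<close> the imaginary
  part.\<close>

lemma unitary_family_independent:
  fixes u :: "nat \<Rightarrow> 'n::finite l2" and c :: "nat \<Rightarrow> complex"
  assumes u: "\<And>i. i < N \<Longrightarrow> norm (u i) = 1"
      "\<And>i j. i < N \<Longrightarrow> j < N \<Longrightarrow> i \<noteq> j \<Longrightarrow> u i \<bullet> u j = 0 \<and> u i \<bullet> scaleC_l2 \<i> (u j) = 0"
    and A: "A \<subseteq> {..<N}" and z: "AE x in lborel. (\<Sum>i\<in>A. c i * rep_l2 (u i) x) = 0"
    and j: "j \<in> A"
  shows "c j = 0"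
proof -
  have fin: "finite A" using A finite_subset by blast
  define S where "S = (\<Sum>i\<in>A. scaleC_l2 (c i) (u i))"
  have "S = 0"
    by (rule l2_eqI)
       (use rep_l2_sum[OF fin, of c u] rep_l2_zero z in \<open>eventually_elim, simp add: S_def\<close>)
  have jN: "j < N" using A j by auto
  have uj: "u j \<bullet> u j = 1" using u(1)[OF jN] by (simp add: power2_norm_eq_inner[symmetric])
  have o: "u i \<bullet> u j = (if i = j then 1 else 0)" "u i \<bullet> scaleC_l2 \<i> (u j) = 0" if "i \<in> A" for i
    using u(2)[of i j] that A jN uj inner_scaleC_i_self[of "u j"] by auto
  have "S \<bullet> u j = (\<Sum>i\<in>A. Re (c i) * (u i \<bullet> u j) - Im (c i) * (u i \<bullet> scaleC_l2 \<i> (u j)))"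
    unfolding S_def by (subst scaleC_decompose) (simp add: inner_sum_left inner_add_left inner_scaleC_i_left)
  also have "\<dots> = (\<Sum>i\<in>A. Re (c i) * (if i = j then 1 else 0))" by (intro sum.cong refl) (simp add: o)
  also have "\<dots> = Re (c j)" using fin j by (simp add: if_distrib sum.delta cong: if_cong)
  finally have 1: "Re (c j) = 0" using \<open>S = 0\<close> by simp
  have "S \<bullet> scaleC_l2 \<i> (u j) = (\<Sum>i\<in>A. Re (c i) * (u i \<bullet> scaleC_l2 \<i> (u j)) + Im (c i) * (u i \<bullet> u j))"
    unfolding S_def by (subst scaleC_decompose) (simp add: inner_sum_left inner_add_left inner_scaleC_i_both)
  also have "\<dots> = (\<Sum>i\<in>A. Im (c i) * (if i = j then 1 else 0))" by (intro sum.cong refl) (simp add: o)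
  also have "\<dots> = Im (c j)" using fin j by (simp add: if_distrib sum.delta cong: if_cong)
  finally have "Im (c j) = 0" using \<open>S = 0\<close> by simp
  with 1 show ?thesis by (simp add: complex_eq_iff)
qed

lemma conv_op_eq: "conv_op a V u x = convolution a u x + V x * u x"
  by (simp add: conv_op_def convolution_def)

section \<open>The shifted operator and its factorisation\<close>

locale convolution_potential =
  fixes a Vhat V :: "real ^ 'n::finite \<Rightarrow> complex" and x0 :: "real ^ 'n"
  assumes a: "hermitian_L1 a" and Vhat: "hermitian_L1 Vhat" and V_eq: "V = fourier Vhat"
    and min_le: "inf_val V \<le> inf_val (fourier a)" and x0: "\<And>x. Re (V x0) \<le> Re (V x)"
begin

definition m :: real where "m = - inf_val V"

definition shifted :: "'n l2 \<Rightarrow> 'n l2" where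
  "shifted u = conv_l2 a u + mult_l2 V u + m *\<^sub>R u"

lemma a_int: "integrable lborel a" and Vhat_int: "integrable lborel Vhat"
  using a Vhat by (auto simp: hermitian_L1_def)

lemma V_measurable [measurable]: "V \<in> borel_measurable borel"
  unfolding V_eq by (rule measurable_fourier[OF Vhat_int])

lemma V_real: "Im (V x) = 0"
  unfolding V_eq by (rule fourier_real[OF Vhat])

lemma V_bounded: "cmod (V x) \<le> (LINT \<xi>|lborel. cmod (Vhat \<xi>))"
  unfolding V_eq by (rule norm_fourier_le[OF Vhat_int])

sublocale V: bounded_function V "LINT \<xi>|lborel. cmod (Vhat \<xi>)"
  by unfold_locales (auto simp: V_bounded)

lemma inf_V: "inf_val V = Re (V x0)"
  unfolding inf_val_def using x0 by (intro cInf_eq_minimum) auto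

lemma m_plus_V: "0 \<le> m + Re (V x)"
  using x0[of x] by (simp add: m_def inf_V)

text \<open>\<open>V\<close> tends to zero at infinity, so its infimum cannot be positive.\<close>

lemma m_nonneg: "m \<ge> 0"
proof (rule ccontr)
  assume "\<not> m \<ge> 0"
  then obtain R where R: "\<And>x. R \<le> norm x \<Longrightarrow> cmod (V x) < - m"
    using Riemann_Lebesgue[OF Vhat_int, of "- m"] unfolding V_eq by auto
  obtain x :: "real ^ 'n" where "norm x = max R 0" using vector_choose_size[of "max R 0"] by auto
  hence "cmod (V x) < - m" by (intro R) simp
  thus False using m_plus_V[of x] abs_Re_le_cmod[of "V x"] by linarith
qed

lemma fourier_a_bound: "- m \<le> Re (fourier a x)"
proof -
  have "bdd_below (range (\<lambda>x. Re (fourier a x)))"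
  proof (rule bdd_belowI)
    fix y assume "y \<in> range (\<lambda>x. Re (fourier a x))"
    then obtain x where "y = Re (fourier a x)" by blast
    thus "- (LINT x|lborel. cmod (a x)) \<le> y"
      using abs_Re_le_cmod[of "fourier a x"] norm_fourier_le[OF a_int, of x] by linarith
  qed
  hence "inf_val (fourier a) \<le> Re (fourier a x)" unfolding inf_val_def by (intro cINF_lower) auto
  thus ?thesis using min_le by (simp add: m_def)
qed

definition g :: "real ^ 'n \<Rightarrow> complex" where
  "g x = of_real (sqrt (m + Re (V x)) - sqrt m)"

lemma norm_g_le: "cmod (g x) \<le> sqrt (cmod (V x))"
proof -
  have "\<bar>sqrt (m + Re (V x)) - sqrt m\<bar> \<le> sqrt \<bar>Re (V x)\<bar>"
    using abs_sqrt_diff_le[OF m_plus_V m_nonneg, of x] by simp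
  also have "\<dots> \<le> sqrt (cmod (V x))" by (simp add: abs_Re_le_cmod)
  finally show ?thesis unfolding g_def norm_of_real .
qed

sublocale g: vanishing_function g "sqrt (LINT \<xi>|lborel. cmod (Vhat \<xi>))"
proof
  show "g \<in> borel_measurable borel" unfolding g_def[abs_def] by measurable
  show "cmod (g x) \<le> sqrt (LINT \<xi>|lborel. cmod (Vhat \<xi>))" for x
    using norm_g_le[of x] V_bounded[of x] by (meson order_trans real_sqrt_le_mono)
  fix e :: real assume e: "e > 0"
  \<comment> \<open>The threshold is \<open>e\<^sup>2\<close> because \<open>g\<close> is controlled
    only by the square root of the modulus of \<open>V\<close>.\<close>
  then obtain R where R: "\<And>x. R \<le> norm x \<Longrightarrow> cmod (V x) < e\<^sup>2"
    using Riemann_Lebesgue[OF Vhat_int, of "e\<^sup>2"] unfolding V_eq by auto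
  have "cmod (g x) < e" if "R \<le> norm x" for x
  proof -
    have "sqrt (cmod (V x)) < sqrt (e\<^sup>2)" using R[OF that] by (rule real_sqrt_less_mono)
    thus ?thesis using norm_g_le[of x] e by simp
  qed
  thus "\<exists>R. \<forall>x. R \<le> norm x \<longrightarrow> cmod (g x) < e" by blast
qed

lemma g_real: "Im (g x) = 0"
  by (simp add: g_def)

definition Q :: "'n l2 \<Rightarrow> 'n l2" where
  "Q u = sqrt m *\<^sub>R u + mult_l2 g u"

lemma Q_symmetric: "Q u \<bullet> v = u \<bullet> Q v"
  by (simp add: Q_def inner_add_left inner_add_right g.mult_l2_symmetric[OF g_real])

lemma Q_Q: "Q (Q u) = mult_l2 V u + m *\<^sub>R u"
proof (rule l2_eqI)
  have sq: "(of_real (sqrt m) + g x) * (of_real (sqrt m) + g x) = V x + of_real m" for x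
    using m_plus_V[of x] V_real[of x] by (simp add: g_def complex_eq_iff)
  have *: "of_real (sqrt m) * (of_real (sqrt m) * y + g x * y) + g x * (of_real (sqrt m) * y + g x * y) = V x * y + of_real m * y" for x y
  proof -
    have "of_real (sqrt m) * (of_real (sqrt m) * y + g x * y) + g x * (of_real (sqrt m) * y + g x * y) =
        (of_real (sqrt m) + g x) * (of_real (sqrt m) + g x) * y"
      by (simp only: distrib_left distrib_right mult_ac add_ac)
    also have "\<dots> = (V x + of_real m) * y" by (simp only: sq)
    also have "\<dots> = V x * y + of_real m * y" by (rule distrib_right)
    finally show ?thesis .
  qed
  from rep_l2_add[of "sqrt m *\<^sub>R Q u" "mult_l2 g (Q u)"] rep_l2_scaleR[of "sqrt m" "Q u"] g.rep_mult_l2[of "Q u"]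
    rep_l2_add[of "sqrt m *\<^sub>R u" "mult_l2 g u"] rep_l2_scaleR[of "sqrt m" u] g.rep_mult_l2[of u]
    rep_l2_add[of "mult_l2 V u" "m *\<^sub>R u"] V.rep_mult_l2[of u] rep_l2_scaleR[of m u]
  show "AE x in lborel. rep_l2 (Q (Q u)) x = rep_l2 (mult_l2 V u + m *\<^sub>R u) x"
    unfolding Q_def[of "Q u"] by eventually_elim (simp add: Q_def * del: of_real_mult)
qed

text \<open>For \<open>m > 0\<close> this is \<open>(1/m) Q (a * _ + m) Q\<close> minus the shifted operator. For \<open>m = 0\<close> the
  convention \<open>1 / 0 = 0\<close> makes it vanish, and then the shifted operator is itself nonnegative.\<close>

definition K :: "'n l2 \<Rightarrow> 'n l2" where
  "K u = (1 / m) *\<^sub>R (sqrt m *\<^sub>R mult_l2 g (conv_l2 a u) + sqrt m *\<^sub>R conv_l2 a (mult_l2 g u) +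
    mult_l2 g (conv_l2 a (mult_l2 g u)))"

lemma compact_operator_K: "compact_operator K"
  unfolding K_def[abs_def]
  by (intro compact_operator_scaleR compact_operator_add
      g.compact_operator_mult_conv[OF a_int] g.compact_operator_conv_mult[OF a_int]
      compact_operator_compose_left[OF g.bounded_linear_mult_l2])

lemma shifted_plus_K_nonneg: "0 \<le> (shifted u + K u) \<bullet> u"
proof (cases "m = 0")
  case True
  have "0 \<le> conv_l2 a u \<bullet> u"
    using conv_l2_lower_bound[OF a_int m_nonneg fourier_a_bound, of u] True by simp
  moreover have "Q (Q u) \<bullet> u = Q u \<bullet> Q u" by (rule Q_symmetric)
  hence "0 \<le> Q (Q u) \<bullet> u" by simp
  ultimately show ?thesis using True by (simp add: shifted_def K_def Q_Q inner_add_left)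
next
  case False
  hence m: "m > 0" using m_nonneg by simp
  note lin = linear_add[OF bounded_linear.linear] linear_scale[OF bounded_linear.linear]
  have mm: "sqrt m * sqrt m = m" using m by simp
  \<comment> \<open>Writing \<open>Q\<close> as \<open>sqrt m\<close> plus \<open>g\<close> on both
    sides yields \<open>m *\<^sub>R conv_l2 a u\<close> and three terms containing \<open>g\<close>,
    which together are \<open>m *\<^sub>R K u\<close>.\<close>
  have "Q (conv_l2 a (Q u)) = m *\<^sub>R conv_l2 a u + m *\<^sub>R K u"
    using m mm
    by (simp add: Q_def K_def lin[OF bounded_linear_conv_l2[OF a_int]] lin[OF g.bounded_linear_mult_l2] scaleR_add_right)
  hence "shifted u + K u = (1 / m) *\<^sub>R Q (conv_l2 a (Q u)) + Q (Q u)"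
    using m by (simp add: shifted_def Q_Q scaleR_add_right)
  \<comment> \<open>Symmetry moves one \<open>Q\<close> to the other side, so that the lower bound
    for the convolution is applied to \<open>Q u\<close>.\<close>
  hence "(shifted u + K u) \<bullet> u = (1 / m) * (conv_l2 a (Q u) \<bullet> Q u + m * (norm (Q u))\<^sup>2)"
    using m by (simp add: inner_add_left Q_symmetric power2_norm_eq_inner field_simps)
  also have "\<dots> \<ge> 0"
    using conv_l2_lower_bound[OF a_int m_nonneg fourier_a_bound, of "Q u"] m by simp
  finally show ?thesis .
qed

lemma bounded_linear_shifted: "bounded_linear shifted"
  unfolding shifted_def[abs_def]
  by (intro bounded_linear_add bounded_linear_conv_l2 a_int V.bounded_linear_mult_l2 bounded_linear_scaleR_right)

lemma shifted_symmetric: "shifted u \<bullet> v = u \<bullet> shifted v"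
  by (simp add: shifted_def inner_add_left inner_add_right conv_l2_symmetric[OF a] V.mult_l2_symmetric[OF V_real])

lemma shifted_scaleC: "shifted (scaleC_l2 c u) = scaleC_l2 c (shifted u)"
  by (simp add: shifted_def conv_l2_scaleC[OF a_int] V.mult_l2_scaleC
      linear_add[OF bounded_linear.linear[OF bounded_linear_scaleC]]
      linear_scale[OF bounded_linear.linear[OF bounded_linear_scaleC]])

lemma rep_shifted: "AE x in lborel. rep_l2 (shifted u) x = conv_op a V (rep_l2 u) x + of_real m * rep_l2 u x"
  using rep_l2_add[of "conv_l2 a u + mult_l2 V u" "m *\<^sub>R u"] rep_l2_add[of "conv_l2 a u" "mult_l2 V u"]
    rep_conv_l2[OF a_int, of u] V.rep_mult_l2[of u] rep_l2_scaleR[of m u]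
  by eventually_elim (simp add: shifted_def conv_op_eq)

section \<open>From eigenvectors to the count of eigenvalues\<close>

lemma eigenspace_rep:
  assumes "shifted u = l *\<^sub>R u"
  shows "rep_l2 u \<in> eigenspace (conv_op a V) (l - m)"
proof -
  from rep_shifted[of u] rep_l2_scaleR[of l u]
  have "AE x in lborel. conv_op a V (rep_l2 u) x = of_real (l - m) * rep_l2 u x"
    by eventually_elim (simp add: assms algebra_simps)
  thus ?thesis by (simp add: eigenspace_def)
qed

lemma eigenspace_abs:
  assumes "f \<in> eigenspace (conv_op a V) t"
  shows "shifted (abs_l2 f) = (t + m) *\<^sub>R abs_l2 f"
proof (rule l2_eqI)
  have f: "f \<in> L2" and eig: "AE x in lborel. conv_op a V f x = of_real t * f x"
    using assms by (auto simp: eigenspace_def)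
  have [measurable]: "a \<in> borel_measurable borel" using a_int by auto
  have cg: "convolution a (rep_l2 (abs_l2 f)) = convolution a f"
    by (rule ext, rule convolution_cong_AE[OF rep_abs_l2[OF f]]) (use f L2_measurable in auto)
  from rep_shifted[of "abs_l2 f"] rep_l2_scaleR[of "t + m" "abs_l2 f"] rep_abs_l2[OF f] eig
  show "AE x in lborel. rep_l2 (shifted (abs_l2 f)) x = rep_l2 ((t + m) *\<^sub>R abs_l2 f) x"
    by eventually_elim (simp add: conv_op_eq cg algebra_simps)
qed

lemma eigenvalueI:
  assumes "shifted u = l *\<^sub>R u" "u \<noteq> 0"
  shows "l - m \<in> eigenvalues (conv_op a V)"
proof -
  have "\<not> (AE x in lborel. rep_l2 u x = 0)"
  proof
    assume "AE x in lborel. rep_l2 u x = 0"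
    hence "AE x in lborel. rep_l2 u x = rep_l2 0 x" using rep_l2_zero by eventually_elim simp
    thus False using assms(2) l2_eqI by blast
  qed
  thus ?thesis unfolding eigenvalues_def using eigenspace_rep[OF assms(1)] by blast
qed

lemma eigenvalue_lower_bound:
  assumes "t \<in> eigenvalues (conv_op a V)" "\<And>v. l * (v \<bullet> v) \<le> shifted v \<bullet> v"
  shows "l - m \<le> t"
proof -
  obtain f where f: "f \<in> eigenspace (conv_op a V) t" "\<not> (AE x in lborel. f x = 0)"
    using assms(1) by (auto simp: eigenvalues_def)
  have fL2: "f \<in> L2" using f(1) by (simp add: eigenspace_def)
  have "abs_l2 f \<noteq> 0"
  proof
    assume "abs_l2 f = 0"
    hence "AE x in lborel. f x = 0"
      using rep_abs_l2[OF fL2] rep_l2_zero by (auto elim: eventually_elim2)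
    thus False using f(2) by blast
  qed
  hence "abs_l2 f \<bullet> abs_l2 f > 0" by simp
  moreover have "l * (abs_l2 f \<bullet> abs_l2 f) \<le> (t + m) * (abs_l2 f \<bullet> abs_l2 f)"
    using assms(2)[of "abs_l2 f"] by (simp add: eigenspace_abs[OF f(1)])
  ultimately show ?thesis by simp
qed

text \<open>Several indices may share an eigenvalue, so they are grouped by \<open>t\<close>: each
  fibre is an independent family in one eigenspace, hence no larger than the multiplicity, and the
  fibre sizes add up to \<open>N\<close>.\<close>

lemma count_negative_eigenvectors:
  assumes u: "\<And>i. i < N \<Longrightarrow> norm (u i) = 1 \<and> l i < 0 \<and> shifted (u i) = l i *\<^sub>R u i \<and>
      (\<forall>j<i. u i \<bullet> u j = 0 \<and> u i \<bullet> scaleC_l2 \<i> (u j) = 0)"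
  shows "enat N \<le> num_eigenvalues_below (conv_op a V) (inf_val V)"
proof -
  define t where "t i = l i - m" for i
  define S where "S = t ` {..<N}"
  have orth: "u i \<bullet> u j = 0 \<and> u i \<bullet> scaleC_l2 \<i> (u j) = 0" if "i < N" "j < N" "i \<noteq> j" for i j
  proof (cases "j < i")
    case True
    thus ?thesis using u[OF that(1)] by blast
  next
    case False
    hence "u j \<bullet> u i = 0" "u j \<bullet> scaleC_l2 \<i> (u i) = 0" using u[OF that(2)] that by auto
    thus ?thesis using inner_scaleC_i_left[of "u j" "u i"] by (simp add: inner_commute)
  qed
  have S: "finite S" "S \<subseteq> {t \<in> eigenvalues (conv_op a V). t < inf_val V}"
  proof -
    show "S \<subseteq> {t \<in> eigenvalues (conv_op a V). t < inf_val V}"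
    proof
      fix y assume "y \<in> S"
      then obtain i where i: "i < N" "y = t i" by (auto simp: S_def)
      have "u i \<noteq> 0" using u[OF i(1)] by auto
      thus "y \<in> {t \<in> eigenvalues (conv_op a V). t < inf_val V}"
        using u[OF i(1)] eigenvalueI[of "u i" "l i"] i(2) by (auto simp: t_def m_def)
    qed
  qed (simp add: S_def)
  have mult: "enat (card {i \<in> {..<N}. t i = y}) \<le> multiplicity_of (conv_op a V) y" for y
  proof -
    define A where "A = {i \<in> {..<N}. t i = y}"
    have A: "finite A" "A \<subseteq> {..<N}" by (auto simp: A_def)
    obtain h where h: "bij_betw h {0..<card A} A" using ex_bij_betw_nat_finite[OF A(1)] by blast
    hence hA: "h i \<in> A" if "i < card A" for i using that by (auto simp: bij_betw_def)
    have "rep_l2 (u (h i)) \<in> eigenspace (conv_op a V) y" if "i < card A" for i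
      using hA[OF that] eigenspace_rep[of "u (h i)" "l (h i)"] u[of "h i"] by (auto simp: A_def t_def)
    moreover have "c j = 0" if z: "AE x in lborel. (\<Sum>i<card A. c i * rep_l2 (u (h i)) x) = 0" and j: "j < card A" for c j
    proof -
      \<comment> \<open>The bijection \<open>h\<close> numbers a fibre by an initial segment, as
        \<open>multiplicity_of\<close> demands; \<open>c'\<close> carries the coefficients back to
        the original indices.\<close>
      define c' where "c' k = c (inv_into {0..<card A} h k)" for k
      have c': "c' (h i) = c i" if "i < card A" for i
        using that h by (simp add: c'_def bij_betw_def)
      have "(\<Sum>i<card A. c i * rep_l2 (u (h i)) x) = (\<Sum>k\<in>A. c' k * rep_l2 (u k) x)" for x
        using sum.reindex_bij_betw[OF h, of "\<lambda>k. c' k * rep_l2 (u k) x"] c'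
        by (simp add: atLeast0LessThan)
      hence "c' (h j) = 0"
        using unitary_family_independent[of N u A c' "h j"] u orth A(2) z hA[OF j] by simp
      thus ?thesis by (simp add: c' j)
    qed
    ultimately have "enat (card A) \<in> {enat k | k. \<exists>v. (\<forall>i<k. v i \<in> eigenspace (conv_op a V) y) \<and>
        (\<forall>c :: nat \<Rightarrow> complex. (AE x in lborel. (\<Sum>i<k. c i * v i x) = 0) \<longrightarrow> (\<forall>i<k. c i = 0))}"
      by (intro CollectI exI[of _ "card A"] conjI refl exI[of _ "\<lambda>i. rep_l2 (u (h i))"]) blast+
    thus ?thesis unfolding multiplicity_of_def A_def by (rule Sup_upper)
  qed
  have "N = (\<Sum>y\<in>S. card {i \<in> {..<N}. t i = y})"
    using sum.image_gen[of "{..<N}" "\<lambda>_. 1::nat" t] by (simp add: S_def)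
  hence "enat N = (\<Sum>y\<in>S. enat (card {i \<in> {..<N}. t i = y}))"
    by (simp flip: of_nat_eq_enat of_nat_sum)
  also have "\<dots> \<le> (\<Sum>y\<in>S. multiplicity_of (conv_op a V) y)" by (intro sum_mono mult)
  also have "\<dots> \<le> num_eigenvalues_below (conv_op a V) (inf_val V)"
    unfolding num_eigenvalues_below_def using S by (intro SUP_upper) auto
  finally show ?thesis .
qed

text \<open>Serves twice: with \<open>F\<close> a finite part of \<open>I\<close> for the count, and
  with a singleton at an arbitrary index for the bound on the lowest eigenvalue.\<close>

lemma form_shifted_test_fun:
  assumes r: "r > 0" and F: "finite F"
    and M: "\<And>k. k \<in> F \<Longrightarrow> a_coeff a r (2 *s k) \<le> M"
    and s: "\<And>n. n \<notin> even_lattice \<Longrightarrow> a_coeff a r n \<le> s"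
    and N: "\<And>k. k \<in> F \<Longrightarrow> (\<Sum>l\<in>F. cmod (V_coeff V r x0 (k - l))) \<le> N"
  shows "shifted (abs_l2 (test_fun r x0 F \<alpha>)) \<bullet> abs_l2 (test_fun r x0 F \<alpha>) \<le>
    (r ^ CARD('n) * M + (2 * r) ^ CARD('n) * s + N / r ^ CARD('n)) *
      (LINT x|lborel. (cmod (test_fun r x0 F \<alpha> x))\<^sup>2)"
proof -
  define u where "u = test_fun r x0 F \<alpha>"
  have u: "u \<in> L2" unfolding u_def by (rule test_fun_L2)
  have qL2: "(\<lambda>x. (V x - of_real (inf_val V)) * u x) \<in> L2"
    using L2_diff[OF L2_bounded_mult[OF u V.measurable_g V.bounded_g] L2_mult[OF u, of "of_real (inf_val V)"]]
    by (simp add: left_diff_distrib)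
  interpret q: bounded_function "\<lambda>x. V x - of_real (inf_val V)" "(LINT \<xi>|lborel. cmod (Vhat \<xi>)) + \<bar>inf_val V\<bar>"
  proof
    show "cmod (V x - of_real (inf_val V)) \<le> (LINT \<xi>|lborel. cmod (Vhat \<xi>)) + \<bar>inf_val V\<bar>" for x
      using norm_triangle_ineq4[of "V x" "of_real (inf_val V)"] V_bounded[of x] by simp
  qed measurable
  have vm: "complex_of_real (inf_val V) = - of_real m" by (simp add: m_def)
  have "mult_l2 V (abs_l2 u) + m *\<^sub>R abs_l2 u = mult_l2 (\<lambda>x. V x - of_real (inf_val V)) (abs_l2 u)"
    by (rule l2_eqI)
       (use rep_l2_add[of "mult_l2 V (abs_l2 u)" "m *\<^sub>R abs_l2 u"] V.rep_mult_l2[of "abs_l2 u"]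
          rep_l2_scaleR[of m "abs_l2 u"] q.rep_mult_l2[of "abs_l2 u"]
        in \<open>eventually_elim, simp add: vm algebra_simps\<close>)
  hence "shifted (abs_l2 u) \<bullet> abs_l2 u =
      conv_l2 a (abs_l2 u) \<bullet> abs_l2 u + mult_l2 (\<lambda>x. V x - of_real (inf_val V)) (abs_l2 u) \<bullet> abs_l2 u"
    by (simp add: shifted_def inner_add_left add.assoc flip: inner_add_left)
  also have "\<dots> \<le> (r ^ CARD('n) * M + (2 * r) ^ CARD('n) * s) * (LINT x|lborel. (cmod (u x))\<^sup>2) +
      N / r ^ CARD('n) * (LINT x|lborel. (cmod (u x))\<^sup>2)"
    unfolding u_def
    by (intro add_mono test_fun_conv_bound[OF r a_int F M s] test_fun_potential_bound[OF r F V_measurable V_bounded V_real N])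
  finally show ?thesis by (simp add: u_def algebra_simps)
qed

text \<open>The hypothesis makes the constant in \<open>form_shifted_test_fun\<close> negative, so
  the form is negative on a space of dimension \<open>card F\<close> for each finite
  \<open>F \<subseteq> I\<close>. The bound on the lowest eigenvalue comes from single waves at any
  index, since \<open>l\<close> lies below every Rayleigh quotient.\<close>

lemma eigenvalues_below_minimum:
  assumes r: "r > 0" and I: "I \<noteq> {}"
    and sum_neg: "ereal (r ^ CARD('n) * (SUP n\<in>I. a_coeff a r (2 *s n))
           + (2 * r) ^ CARD('n) * (SUP n\<in>UNIV - even_lattice. a_coeff a r n))
           + enn2ereal (nu V r x0 I) < 0"
  shows "ecard I \<le> num_eigenvalues_below (conv_op a V) (inf_val V) \<and>
    (\<exists>lam_min. is_lowest_eigenvalue (conv_op a V) lam_min \<and>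
       lam_min \<le> r ^ CARD('n) * (INF n. a_coeff a r (2 *s n))
         + (2 * r) ^ CARD('n) * (SUP n\<in>UNIV - even_lattice. a_coeff a r n)
         + 1 / r ^ CARD('n) * (LINT x:cube r x0|lborel. Re (V x) - inf_val V))"
proof -
  define D where "D = r ^ CARD('n)"
  have D: "D > 0" using r by (simp add: D_def)
  define s where "s = (SUP n\<in>UNIV - even_lattice. a_coeff a r n)"
  define M where "M = (SUP n\<in>I. a_coeff a r (2 *s n))"
  obtain B where B: "\<And>n. \<bar>a_coeff a r n\<bar> \<le> B" using a_coeff_bounded[OF r a_int] by blast
  have B': "a_coeff a r n \<le> B" "- B \<le> a_coeff a r n" for n using B[of n] by (auto simp: abs_le_iff)
  have s: "a_coeff a r n \<le> s" if "n \<notin> even_lattice" for n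
    unfolding s_def using that by (intro cSUP_upper bdd_aboveI2[where M = B] B'(1)) auto
  have M: "a_coeff a r (2 *s n) \<le> M" if "n \<in> I" for n
    unfolding M_def using that by (intro cSUP_upper bdd_aboveI2[where M = B] B'(1)) auto
  define X where "X = D * M + (2 * r) ^ CARD('n) * s"
  have hyp: "ereal X + enn2ereal (nu V r x0 I) < 0"
    using sum_neg by (simp only: X_def D_def M_def s_def)
  \<comment> \<open>Otherwise the extended sum would be infinite, not negative.\<close>
  hence "nu V r x0 I \<noteq> top" by auto
  then obtain \<nu> where \<nu>: "nu V r x0 I = ennreal \<nu>" "\<nu> \<ge> 0" by (cases "nu V r x0 I") auto
  have neg: "X + \<nu> < 0" using hyp \<nu> by (simp add: enn2ereal_ennreal)
  \<comment> \<open>A finite partial row sum is below the full row sum, hence below r^d times the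
    supremum defining \<open>nu\<close>, normalised.\<close>
  have row: "(\<Sum>l\<in>F. cmod (V_coeff V r x0 (k - l))) \<le> D * \<nu>" if F: "finite F" "F \<subseteq> I" "k \<in> I" for F k
  proof -
    have "ennreal (\<Sum>l\<in>F. cmod (V_coeff V r x0 (k - l))) = (\<Sum>l\<in>F. ennreal (cmod (V_coeff V r x0 (k - l))))"
      by (simp add: sum_ennreal)
    also have "\<dots> \<le> (\<Sum>\<^sub>\<infinity>l\<in>I. ennreal (cmod (V_coeff V r x0 (k - l))))"
      by (subst infsum_finite[OF F(1), symmetric], rule infsum_mono_neutral)
         (use F in \<open>auto intro: nonneg_summable_on_complete\<close>)
    also have "\<dots> \<le> (SUP n\<in>I. \<Sum>\<^sub>\<infinity>l\<in>I. ennreal (cmod (V_coeff V r x0 (n - l))))"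
      by (rule SUP_upper[OF F(3)])
    finally have "ennreal (1 / D) * ennreal (\<Sum>l\<in>F. cmod (V_coeff V r x0 (k - l))) \<le> ennreal \<nu>"
      unfolding \<nu>(1)[symmetric] nu_def D_def by (rule mult_left_mono) simp
    hence "1 / D * (\<Sum>l\<in>F. cmod (V_coeff V r x0 (k - l))) \<le> \<nu>"
      using D \<nu>(2) by (simp add: ennreal_mult[symmetric] sum_nonneg del: times_divide_eq_left)
    thus ?thesis using D by (simp add: field_simps)
  qed
  have form_neg: "shifted (abs_l2 (test_fun r x0 F \<alpha>)) \<bullet> abs_l2 (test_fun r x0 F \<alpha>) < 0"
    if F: "finite F" "F \<subseteq> I" and \<alpha>: "\<exists>k\<in>F. \<alpha> k \<noteq> 0" for F \<alpha>
  proof -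
    define N where "N = (LINT x|lborel. (cmod (test_fun r x0 F \<alpha> x))\<^sup>2)"
    obtain k where k: "k \<in> F" "\<alpha> k \<noteq> 0" using \<alpha> by blast
    have "0 < (cmod (\<alpha> k))\<^sup>2" using k by simp
    also have "\<dots> \<le> (\<Sum>k\<in>F. (cmod (\<alpha> k))\<^sup>2)" using k F by (intro member_le_sum) auto
    finally have N: "N > 0" unfolding N_def test_fun_norm[OF r F(1)] using r by simp
    have "shifted (abs_l2 (test_fun r x0 F \<alpha>)) \<bullet> abs_l2 (test_fun r x0 F \<alpha>) \<le> (X + D * \<nu> / D) * N"
      unfolding X_def D_def N_def
      by (rule form_shifted_test_fun[OF r F(1) M s row[unfolded D_def]]) (use F in auto)
    also have "\<dots> = (X + \<nu>) * N" using D by simp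
    also have "\<dots> < 0" using neg N by (rule mult_neg_pos)
    finally show ?thesis .
  qed
  have count: "enat (card F) \<le> num_eigenvalues_below (conv_op a V) (inf_val V)" if F: "finite F" "F \<subseteq> I" for F
  proof -
    have "\<exists>u l. \<forall>i<card F. norm (u i :: 'n l2) = 1 \<and> l i < (0 :: real) \<and> shifted (u i) = l i *\<^sub>R u i \<and>
        (\<forall>j<i. u i \<bullet> u j = 0 \<and> u i \<bullet> scaleC_l2 \<i> (u j) = 0)"
    proof (rule negative_eigenvectors[OF bounded_linear_shifted compact_operator_K shifted_symmetric shifted_plus_K_nonneg])
      show "shifted (scaleC_l2 \<i> u) = scaleC_l2 \<i> (shifted u)" for u by (rule shifted_scaleC)
      show "scaleC_l2 \<i> (c *\<^sub>R u) = c *\<^sub>R scaleC_l2 \<i> u" for c and u :: "'n l2"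
        by (rule linear_scale[OF bounded_linear.linear[OF bounded_linear_scaleC]])
      fix U :: "'n l2 set" assume U: "finite U" "card U < card F"
      \<comment> \<open>One complex equation for each \<open>v\<close> in \<open>U\<close> covers
        both real conditions, orthogonality to \<open>v\<close> and to
        \<open>scaleC_l2 \<i> v\<close>.\<close>
      define P where "P v k = (LINT x|lborel. indicator (cube r x0) x * (wave (2 * pi / r) k x * cnj (rep_l2 v x)))" for v k
      obtain \<alpha> where \<alpha>: "\<exists>k\<in>F. \<alpha> k \<noteq> 0" "\<And>v. v \<in> U \<Longrightarrow> (\<Sum>k\<in>F. \<alpha> k * P v k) = 0"
        using underdetermined_system[OF U(1) F(1) U(2), of P] by blast
      define w where "w = abs_l2 (test_fun r x0 F \<alpha>)"
      have w: "w \<bullet> abs_l2 f = Re (\<Sum>k\<in>F. \<alpha> k * (LINT x|lborel. indicator (cube r x0) x * (wave (2 * pi / r) k x * cnj (f x))))"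
        if "f \<in> L2" for f
        unfolding w_def inner_abs_l2[OF test_fun_L2 that] test_fun_pairing[OF that] ..
      have "w \<bullet> v = 0 \<and> w \<bullet> scaleC_l2 \<i> v = 0" if v: "v \<in> U" for v
      proof
        show "w \<bullet> v = 0" 
          using w[OF rep_l2_in_L2, of v] unfolding P_def[symmetric] abs_rep_l2 by (simp only: \<alpha>(2)[OF v] zero_complex.sel)
        have "(LINT x|lborel. indicator (cube r x0) x * (wave (2 * pi / r) k x * cnj (\<i> * rep_l2 v x))) = - \<i> * P v k" for k
        proof -
          have "(LINT x|lborel. indicator (cube r x0) x * (wave (2 * pi / r) k x * cnj (\<i> * rep_l2 v x))) =
              (LINT x|lborel. - \<i> * (indicator (cube r x0) x * (wave (2 * pi / r) k x * cnj (rep_l2 v x))))"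
            by (intro Bochner_Integration.integral_cong refl) (simp add: mult_ac)
          thus ?thesis unfolding P_def by (simp only: Bochner_Integration.integral_mult_right_zero)
        qed
        hence "w \<bullet> scaleC_l2 \<i> v = Re (\<Sum>k\<in>F. \<alpha> k * (- \<i> * P v k))"
          unfolding scaleC_l2_def by (subst w) (auto intro: L2_mult)
        also have "(\<Sum>k\<in>F. \<alpha> k * (- \<i> * P v k)) = - \<i> * (\<Sum>k\<in>F. \<alpha> k * P v k)"
          by (simp add: sum_distrib_left mult_ac sum_negf)
        also have "\<dots> = 0" by (simp add: \<alpha>(2)[OF v])
        finally show "w \<bullet> scaleC_l2 \<i> v = 0" by simp
      qed
      moreover have "shifted w \<bullet> w < 0" unfolding w_def by (rule form_neg[OF F \<alpha>(1)])
      ultimately show "\<exists>w. shifted w \<bullet> w < 0 \<and> (\<forall>u\<in>U. w \<bullet> u = 0 \<and> w \<bullet> scaleC_l2 \<i> u = 0)" by blast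
    qed
    then obtain u :: "nat \<Rightarrow> 'n l2" and l where
      "\<forall>i<card F. norm (u i) = 1 \<and> l i < (0 :: real) \<and> shifted (u i) = l i *\<^sub>R u i \<and>
        (\<forall>j<i. u i \<bullet> u j = 0 \<and> u i \<bullet> scaleC_l2 \<i> (u j) = 0)" by blast
    thus ?thesis by (intro count_negative_eigenvectors[where u = u and l = l]) blast
  qed
  have "ecard I \<le> num_eigenvalues_below (conv_op a V) (inf_val V)"
  proof (cases "finite I")
    case True
    thus ?thesis using count[OF True order_refl] by (simp add: ecard_def)
  next
    case False
    \<comment> \<open>An infinite \<open>I\<close> contains finite sets of every size.\<close>
    have "enat N \<le> num_eigenvalues_below (conv_op a V) (inf_val V)" for N
      using infinite_arbitrarily_large[OF False, of N] count by metis
    hence "num_eigenvalues_below (conv_op a V) (inf_val V) = \<infinity>"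
      by (cases "num_eigenvalues_below (conv_op a V) (inf_val V)") (metis Suc_n_not_le_n enat_ord_simps(1), simp)
    thus ?thesis by simp
  qed
  moreover have "\<exists>lam_min. is_lowest_eigenvalue (conv_op a V) lam_min \<and>
       lam_min \<le> r ^ CARD('n) * (INF n. a_coeff a r (2 *s n))
         + (2 * r) ^ CARD('n) * (SUP n\<in>UNIV - even_lattice. a_coeff a r n)
         + 1 / r ^ CARD('n) * (LINT x:cube r x0|lborel. Re (V x) - inf_val V)"
  proof -
    obtain k0 where k0: "k0 \<in> I" using I by blast
    \<comment> \<open>A single index of \<open>I\<close> already makes the form negative somewhere,
      which guarantees that a lowest eigenvalue exists.\<close>
    have "shifted (abs_l2 (test_fun r x0 {k0} (\<lambda>_. 1))) \<bullet> abs_l2 (test_fun r x0 {k0} (\<lambda>_. 1)) < 0"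
      by (rule form_neg) (use k0 in auto)
    then obtain u l where u: "norm u = 1" "l < 0" "shifted u = l *\<^sub>R u" "\<And>v. l * (v \<bullet> v) \<le> shifted v \<bullet> v"
      using lowest_eigenvector[OF bounded_linear_shifted compact_operator_K shifted_symmetric shifted_plus_K_nonneg
          subspace_UNIV closed_UNIV UNIV_I UNIV_I] by (metis UNIV_I)
    have "u \<noteq> 0" using u(1) by auto
    have lowest: "is_lowest_eigenvalue (conv_op a V) (l - m)"
      unfolding is_lowest_eigenvalue_def
      using eigenvalueI[OF u(3) \<open>u \<noteq> 0\<close>] eigenvalue_lower_bound[OF _ u(4)] by blast
    define T where "T = (LINT x:cube r x0|lborel. Re (V x) - inf_val V)"
    \<comment> \<open>The only row sum of a singleton test set. At index 0 the translation phase is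
      1, and nonnegativity of the integrand removes the modulus.\<close>
    have T: "cmod (V_coeff V r x0 0) = T"
    proof -
      have "V_coeff V r x0 0 = (LINT x|lborel. indicator (cube r x0) x * ((V x - of_real (inf_val V)) * wave (2 * pi / r) 0 x))"
        by (subst V_coeff_translate[OF V_measurable]) simp
      also have "\<dots> = (LINT x|lborel. of_real (indicator (cube r x0) x *\<^sub>R (Re (V x) - inf_val V)))"
        by (intro Bochner_Integration.integral_cong refl) (auto simp: indicator_def complex_eq_iff V_real)
      also have "\<dots> = of_real T"
        unfolding T_def set_lebesgue_integral_def by (rule integral_complex_of_real)
      finally have "cmod (V_coeff V r x0 0) = \<bar>T\<bar>" by simp
      moreover have "T \<ge> 0"
        unfolding T_def set_lebesgue_integral_def
        by (intro integral_nonneg_AE AE_I2) (use m_plus_V in \<open>auto simp: m_def indicator_def\<close>)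
      ultimately show ?thesis by simp
    qed
    have bound: "l \<le> D * a_coeff a r (2 *s k) + (2 * r) ^ CARD('n) * s + T / D" for k
    proof -
      define w where "w = test_fun r x0 {k} (\<lambda>_. 1)"
      have w: "(LINT x|lborel. (cmod (w x))\<^sup>2) = D"
        unfolding w_def by (simp add: test_fun_norm[OF r] D_def)
      have "w \<in> L2" unfolding w_def by (rule test_fun_L2)
      hence "l * D = l * (abs_l2 w \<bullet> abs_l2 w)"
        by (simp only: power2_norm_eq_inner[of "abs_l2 w", symmetric] norm_abs_l2 w)
      also have "\<dots> \<le> shifted (abs_l2 w) \<bullet> abs_l2 w" by (rule u(4))
      also have "\<dots> \<le> (D * a_coeff a r (2 *s k) + (2 * r) ^ CARD('n) * s + T / D) * (LINT x|lborel. (cmod (w x))\<^sup>2)"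
        unfolding w_def D_def by (rule form_shifted_test_fun[OF r _ _ s]) (use T in auto)
      finally show ?thesis using D by (simp add: w)
    qed
    have "(l - (2 * r) ^ CARD('n) * s - T / D) / D \<le> (INF n. a_coeff a r (2 *s n))"
    proof (rule cINF_greatest)
      fix k
      show "(l - (2 * r) ^ CARD('n) * s - T / D) / D \<le> a_coeff a r (2 *s k)"
        using bound[of k] D by (simp add: pos_divide_le_eq mult.commute)
    qed simp
    hence "l - (2 * r) ^ CARD('n) * s - T / D \<le> D * (INF n. a_coeff a r (2 *s n))"
      using D by (simp add: pos_divide_le_eq mult.commute)
    \<comment> \<open>The eigenvalue of the unshifted operator is \<open>l - m\<close>; the bound
      proved for \<open>l\<close> passes to it because \<open>m \<ge> 0\<close>.\<close>
    hence "l - m \<le> D * (INF n. a_coeff a r (2 *s n)) + (2 * r) ^ CARD('n) * s + 1 / D * T"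
      using m_nonneg by simp
    thus ?thesis using lowest unfolding D_def s_def T_def by blast
  qed
  ultimately show ?thesis by blast
qed

end

theorem theorem2p3:
  fixes a Vhat V :: "real ^ 'n \<Rightarrow> complex"
    and r :: real and x0 :: "real ^ 'n" and I :: "(int ^ 'n) set"
  assumes "hermitian_L1 a"
    and "hermitian_L1 Vhat" and "V = fourier Vhat"
    and "inf_val V \<le> inf_val (fourier a)"
    and "\<forall>x. Re (V x0) \<le> Re (V x)"
    and "r > 0"
    and "J0 a r \<noteq> {}"
    and "I \<subseteq> J0 a r" and "I \<noteq> {}"
    and "ereal (r ^ CARD('n) * (SUP n\<in>I. a_coeff a r (2 *s n))
           + (2 * r) ^ CARD('n) * (SUP n\<in>UNIV - even_lattice. a_coeff a r n))
           + enn2ereal (nu V r x0 I) < 0"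
  shows "ecard I \<le> num_eigenvalues_below (conv_op a V) (inf_val V) \<and>
    (\<exists>lam_min. is_lowest_eigenvalue (conv_op a V) lam_min \<and>
       lam_min \<le> r ^ CARD('n) * (INF n. a_coeff a r (2 *s n))
         + (2 * r) ^ CARD('n) * (SUP n\<in>UNIV - even_lattice. a_coeff a r n)
         + 1 / r ^ CARD('n) * (LINT x:cube r x0|lborel. Re (V x) - inf_val V))"
proof -
  have "convolution_potential a Vhat V x0"
    by unfold_locales (use assms in auto)
  from convolution_potential.eigenvalues_below_minimum[OF this assms(6,9,10)] show ?thesis .
qed

end
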